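(* Let $q\equiv1\bmod8$ be a prime power and let $s \geq 3$ be an integer. Let $(a_1, \ldots, a_{s + 1}) \in \left(\mathbb{F}_q(T)^*/\mathbb{F}_q(T)^{* 2}\right)^{s + 1}$ consist of classes of squarefree monic polynomials of positive degree that are pairwise coprime. Suppose that for each $i \in [s]$ and each pair of disjoint strict subsets $S_1, S_2$ of $[s] - \{i\}$, the map $$ \hat{\phi}_{S_1,S_2;a_i,a_{s+1}}(\mathfrak{G}):=\hat{\phi}_{\{a_j : j \in S_1\}, \{a_l : l \in S_2\}; a_i, a_{s + 1}}(\mathfrak{G}) $$ exists. Assume furthermore that, for every $i \in [s]$, the expansion map $\phi_{\{a_l : l \in [s] - \{i\}\}; a_i}(\mathfrak{G})$ exists. Moreover, assume that $\phi_{\{a_j : j \in [s]\}; a_{s + 1}}(\mathfrak{G})$ exists. Set for each $i \in [s]$ $$ \hat{\phi}_i := \phi_{\{a_j : j \in [s]\}; a_{s + 1}}(\mathfrak{G}) + \sum_{\substack{S_1 \sqcup S_2 = [s] - \{i\} \\ S_1, S_2 \subsetneq [s] - \{i\}}} \hat{\phi}_{S_1, S_2; a_i, a_{s + 1}}(\mathfrak{G}), $$ and let $\mathcal{H}$ be the absolute Galois group of the compositum of the fields $L(\phi_{\{a_l : l \in [s] - \{i\}\}; a_i}(\mathfrak{G}))$, $i\in[s]$. Set $\mathcal{Q} := \mathrm{Gal}(\mathbb{F}_q(T)(\sqrt{a_j} : j \in [s])/\mathbb{F}_q(T))$. Then $\mathrm{res}_{\mathcal{H}} \, \phi_{\{a_j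 : j \in [s]\}; a_{s + 1}}(\mathfrak{G})$ and $\mathrm{res}_{\mathcal{H}} \, \hat{\phi}_i$ (with $i \in [s]$) are all quadratic characters and satisfy the following independence: $$ \mathrm{res}_{\mathcal{H}} \, \sum_{g \in \mathcal{Q} - \{1\}} \phi_{\{a_j : j \in [s]\}; a_{s + 1}}(\mathfrak{G})^g \not \in \langle \mathrm{res}_{\mathcal{H}} \, \hat{\phi}_1, \dots, \mathrm{res}_{\mathcal{H}} \, \hat{\phi}_s \rangle. $$
   Context: $k:=\mathbb{F}_q(T)$ with fixed separable closure, $G_k$ its absolute Galois group, $G_k(2)$ the maximal pro-$2$ quotient; $[n]=\{1,\dots,n\}$. For each place $v$ of $k$ fix an embedding $k^{\mathrm{sep}}\to k_v^{\mathrm{sep}}$; the image of the inertia group at $v$ in $G_k(2)$ is isomorphic to $\mathbb{Z}_2$; fix a topological generator $\sigma_v$. Fix $\mathrm{Frob}_q\in G_k(2)$ in the image of the decomposition group at $\infty$ acting on $\bigcup_n\mathbb{F}_{q^{2^n}}$ as $x\mapsto x^q$ and fixing $\sqrt T$ (it then fixes $\sqrt\pi$ for every monic irreducible $\pi$). $\mathfrak{G}:=\{\sigma_v:v\text{ a finite place}\}\cup\{\mathrm{Frob}_q\}$, a minimal set of topological generators of $G_k(2)$. $\chi_a:G_k\to\mathbb{F}_2$ is the quadratic character attached to $\sqrt a$; for a finite set $U\subset k^*/k^{*2}$, $\chi_U:=\prod_{a\in U}\chi_a$ (product in $\mathbb{F}_2$, a $1$-cochain; $\chi_\emptyset=1$).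 For a $1$-cochain $f$ with values in $\mathbb{F}_2$, $\mathrm{d}f(\sigma,\tau)=f(\sigma)+f(\tau)-f(\sigma\tau)$. *Normalized expansion maps.* For linearly independent $c_1,\dots,c_{m+1}$ in $k^*/k^{*2}$ we say $\phi_{\{c_1,\dots,c_m\};c_{m+1}}(\mathfrak{G})$ exists if there is a (necessarily unique) family of continuous $1$-cochains $\phi_{S;c_{m+1}}(\mathfrak{G}):G_k\to\mathbb{F}_2$ factoring through $G_k(2)$, for $S\subseteq\{c_1,\dots,c_m\}$, with $\phi_{\emptyset;c_{m+1}}(\mathfrak G)=\chi_{c_{m+1}}$, $\mathrm{d}\phi_{S;c_{m+1}}(\mathfrak G)(\sigma,\tau)=\sum_{\emptyset\neq U\subseteq S}\chi_U(\sigma)\phi_{S-U;c_{m+1}}(\mathfrak G)(\tau)$, and vanishing on $\mathfrak{G}$ for $S\ne\emptyset$. *Normalized $\hat\phi$-expansion maps.* Let $A,B$ be disjoint finite subsets of $k^*/k^{*2}$ and $c,c'\in k^*/k^{*2}$ such that $A\cup B\cup\{c,c'\}$ is linearly independent of size $|A|+|B|+2$. We say $\hat\phi_{A,B;c,c'}(\mathfrak{G})$ exists if $\phi_{A;c}(\mathfrak{G})$ and $\phi_{B;c'}(\mathfrak{G})$ exist and there is a (necessarily unique) family of continuous $1$-cochains $\hat\phi_{V_1,V_2;c,c'}(\mathfrak{G}):G_k\to\mathbb{F}_2$ factoring through $G_k(2)$, for $V_1\subseteq A$, $V_2\subseteq B$, all vanishing on $\mathfrak{G}$, with $$\mathrm{d}\hat\phi_{V_1,V_2;c,c'}(\mathfrak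 G)(g_1,g_2)=\sum_{\substack{U_1\subseteq V_1,U_2\subseteq V_2\\(U_1,U_2)\neq(\emptyset,\emptyset)}}\chi_{U_1\cup U_2}(g_1)\hat\phi_{V_1-U_1,V_2-U_2;c,c'}(\mathfrak G)(g_2)+\phi_{V_1;c}(\mathfrak{G})(g_1)\sum_{U\subseteq V_2}\chi_U(g_1)\phi_{V_2-U;c'}(\mathfrak{G})(g_2).$$ For a continuous cochain $f$ on $G_k$, $L(f)$ is the fixed field of the largest open normal subgroup $N_f\subseteq G_k$ such that $f$ factors through $G_k/N_f$. The cochain $\phi_{\{a_j:j\in[s]\};a_{s+1}}(\mathfrak{G})$ restricts to a quadratic character $\phi$ of the absolute Galois group of $k(\sqrt{a_j}:j\in[s])$, and $\phi^g(\tau)=\phi(\tilde g^{-1}\tau\tilde g)$ for any lift $\tilde g\in G_k$ of $g\in\mathcal{Q}$. $\langle\cdot\rangle$ denotes the $\mathbb{F}_2$-span. *)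

theory Defs
  imports
    "HOL-Analysis.Analysis"
    "HOL-Algebra.Algebra"
    "HOL-Algebra.Algebraic_Closure_Type"
    "HOL-Computational_Algebra.Computational_Algebra"
    "HOL-Library.Function_Algebras"
    "HOL-Library.Z2"
begin

text \<open>
  Fields are types of class \<^class>\<open>Fields.field\<close>; a subfield is a subset of such a type.  The base
  field is \<^typ>\<open>'a poly fract\<close> with \<^typ>\<open>'a\<close> a finite field, and a separable closure of it
  is a second field type \<^typ>\<open>'b\<close> together with an embedding \<open>\<iota>\<close>.
\<close>

abbreviation type_ring :: "'f::field ring" where
  "type_ring \<equiv> ring_of_type_algebra"

definition separable_poly :: "'f::field poly \<Rightarrow> bool" where
  "separable_poly p \<longleftrightarrow> coprime p (pderiv p)"

definition separable_over :: "'f::field set \<Rightarrow> 'f \<Rightarrow> bool" where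
  "separable_over F x \<longleftrightarrow> (\<exists>p. separable_poly p \<and> (\<forall>i. Polynomial.coeff p i \<in> F) \<and> poly p x = 0)"

definition is_separable_closure_of :: "'f::field set \<Rightarrow> bool" where
  "is_separable_closure_of F \<longleftrightarrow>
     subfield F type_ring \<and>
     (\<forall>x. separable_over F x) \<and>
     (\<forall>p::'f poly. separable_poly p \<and> Polynomial.degree p > 0 \<longrightarrow> (\<exists>x. poly p x = 0))"

text \<open>
  \<open>Gal E F\<close> is \<open>Gal(E/F)\<close>, its elements being made unique as functions by extensionality.  For
  \<open>E = UNIV\<close> the operation is ordinary composition; when the ambient type is a separable closure
  of the base field, \<open>Gal UNIV F\<close> is the absolute Galois group of the intermediate field \<open>F\<close>.
\<close>

definition Gal :: "'f::field set \<Rightarrow> 'f set \<Rightarrow> ('f \<Rightarrow> 'f) monoid" where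
  "Gal E F =
     \<lparr> carrier = {g \<in> extensional E. bij_betw g E E \<and>
          (\<forall>x\<in>E. \<forall>y\<in>E. g (x + y) = g x + g y \<and> g (x * y) = g x * g y) \<and>
          (\<forall>x\<in>F. g x = x)},
       monoid.mult = (\<lambda>g h. compose E g h),
       one = (\<lambda>x\<in>E. x) \<rparr>"

abbreviation abs_Gal :: "'f::field set \<Rightarrow> ('f \<Rightarrow> 'f) monoid" where
  "abs_Gal F \<equiv> Gal UNIV F"

text \<open>The Krull topology is the topology of pointwise convergence on a discrete field.\<close>

definition krull :: "'f::field set \<Rightarrow> ('f \<Rightarrow> 'f) topology" where
  "krull F = subtopology (product_topology (\<lambda>_. discrete_topology UNIV) UNIV) (carrier (abs_Gal F))"

definition fixed_field :: "('f \<Rightarrow> 'f) set \<Rightarrow> 'f set" where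
  "fixed_field N = {x. \<forall>\<sigma>\<in>N. \<sigma> x = x}"

definition compositum :: "'f::field set set \<Rightarrow> 'f set" where
  "compositum \<F> = generate_field type_ring (\<Union>\<F>)"

definition pro2_kernel :: "'f::field set \<Rightarrow> ('f \<Rightarrow> 'f) set" where
  "pro2_kernel F =
     \<Inter>{N. N \<lhd> abs_Gal F \<and> openin (krull F) N \<and> (\<exists>n. order (abs_Gal F Mod N) = 2 ^ n)}"

definition max_pro2 :: "'f::field set \<Rightarrow> ('f \<Rightarrow> 'f) set monoid" where
  "max_pro2 F = abs_Gal F Mod pro2_kernel F"

definition pro2_proj :: "'f::field set \<Rightarrow> ('f \<Rightarrow> 'f) \<Rightarrow> ('f \<Rightarrow> 'f) set" where
  "pro2_proj F \<sigma> = pro2_kernel F #>\<^bsub>abs_Gal F\<^esub> \<sigma>"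

definition max_pro2_topology :: "'f::field set \<Rightarrow> ('f \<Rightarrow> 'f) set topology" where
  "max_pro2_topology F = topology (\<lambda>U. U \<subseteq> carrier (max_pro2 F) \<and>
     openin (krull F) {\<sigma> \<in> carrier (abs_Gal F). pro2_proj F \<sigma> \<in> U})"

lemma openin_max_pro2_topology:
  "openin (max_pro2_topology F) U \<longleftrightarrow> U \<subseteq> carrier (max_pro2 F) \<and>
     openin (krull F) {\<sigma> \<in> carrier (abs_Gal F). pro2_proj F \<sigma> \<in> U}"
proof -
  let ?P = "\<lambda>U. {\<sigma> \<in> carrier (abs_Gal F). pro2_proj F \<sigma> \<in> U}"
  have "?P (S \<inter> T) = ?P S \<inter> ?P T" for S T by auto
  moreover have "?P (\<Union>\<K>) = \<Union>(?P ` \<K>)" for \<K> by auto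
  ultimately have "istopology (\<lambda>U. U \<subseteq> carrier (max_pro2 F) \<and> openin (krull F) (?P U))"
    unfolding istopology_def by (auto intro!: openin_Int openin_Union)
  then show ?thesis
    by (simp add: max_pro2_topology_def topology_inverse')
qed

definition valuation_on :: "'f::field set \<Rightarrow> ('f \<Rightarrow> int) \<Rightarrow> bool" where
  "valuation_on F w \<longleftrightarrow> (\<forall>x \<in> F - {0}. \<forall>y \<in> F - {0}.
     w (x * y) = w x + w y \<and> (x + y \<noteq> 0 \<longrightarrow> min (w x) (w y) \<le> w (x + y)))"

text \<open>
  A place of \<open>F\<^sub>q(T)\<close> is represented by its normalized discrete valuation, with the junk value
  \<open>0\<close> at \<open>0\<close> (a valuation is automatically trivial on the finite constant field).
\<close>

definition place :: "('a::{finite,field} poly fract \<Rightarrow> int) \<Rightarrow> bool" where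
  "place v \<longleftrightarrow> valuation_on UNIV v \<and> v 0 = 0 \<and> v ` (- {0}) = UNIV"

definition infinite_place :: "'a::{finite,field} poly fract \<Rightarrow> int" where
  "infinite_place x = (if x = 0 then 0 else
     (THE n. \<exists>f g. f \<noteq> 0 \<and> g \<noteq> 0 \<and> x = Fraction_Field.Fract f g \<and> n = int (Polynomial.degree g) - int (Polynomial.degree f)))"

definition finite_place :: "('a::{finite,field} poly fract \<Rightarrow> int) \<Rightarrow> bool" where
  "finite_place v \<longleftrightarrow> place v \<and> v \<noteq> infinite_place"

definition val_ge :: "('f::field \<Rightarrow> int) \<Rightarrow> 'f \<Rightarrow> int \<Rightarrow> bool" where
  "val_ge w x n \<longleftrightarrow> x = 0 \<or> w x \<ge> n"

text \<open>
  \<open>local_embedding \<iota> v F w \<epsilon>\<close>: the type \<^typ>\<open>'c\<close> is a separable closure of its subfield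
  \<open>F\<close>, which is a completion of \<open>F\<^sub>q(T)\<close> at \<open>v\<close> with extended valuation \<open>w\<close>, and \<open>\<epsilon>\<close> is
  an embedding of the separable closure of \<open>F\<^sub>q(T)\<close> into that of \<open>F\<close>.  One type \<^typ>\<open>'c\<close> can
  serve all places at once: each completion is \<open>F\<^sub>Q((t))\<close> for a finite extension \<open>F\<^sub>Q\<close> of
  \<open>F\<^sub>q\<close>, hence has a separable closure isomorphic, as a field, to that of \<open>F\<^sub>q((t))\<close>.
\<close>

definition local_embedding ::
  "('a::{finite,field} poly fract \<Rightarrow> 'b::field) \<Rightarrow> ('a poly fract \<Rightarrow> int) \<Rightarrow>
   'c::field set \<Rightarrow> ('c \<Rightarrow> int) \<Rightarrow> ('b \<Rightarrow> 'c) \<Rightarrow> bool" where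
  "local_embedding \<iota> v F w \<epsilon> \<longleftrightarrow>
     is_separable_closure_of F \<and>
     \<epsilon> \<in> ring_hom type_ring type_ring \<and>
     range (\<epsilon> \<circ> \<iota>) \<subseteq> F \<and>
     valuation_on F w \<and>
     (\<forall>x. x \<noteq> 0 \<longrightarrow> w (\<epsilon> (\<iota> x)) = v x) \<and>
     (\<forall>y\<in>F. \<forall>N. \<exists>x. val_ge w (y - \<epsilon> (\<iota> x)) N) \<and>
     (\<forall>u :: nat \<Rightarrow> 'c. range u \<subseteq> F \<and> (\<forall>N. \<exists>M. \<forall>m\<ge>M. \<forall>n\<ge>M. val_ge w (u m - u n) N) \<longrightarrow>
        (\<exists>y\<in>F. \<forall>N. \<exists>M. \<forall>n\<ge>M. val_ge w (u n - y) N))"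

definition local_integers :: "'c::field set \<Rightarrow> ('c \<Rightarrow> int) \<Rightarrow> 'c set" where
  "local_integers F w = {x. \<exists>p. Polynomial.lead_coeff p = 1 \<and>
     (\<forall>i. Polynomial.coeff p i \<in> F \<and> val_ge w (Polynomial.coeff p i) 0) \<and> poly p x = 0}"

text \<open>The maximal ideal of the local ring of integers consists of its non-units.\<close>

definition local_inertia :: "'c::field set \<Rightarrow> ('c \<Rightarrow> int) \<Rightarrow> ('c \<Rightarrow> 'c) set" where
  "local_inertia F w = {\<tau> \<in> carrier (abs_Gal F). \<forall>x \<in> local_integers F w.
     \<tau> x - x = 0 \<or> inverse (\<tau> x - x) \<notin> local_integers F w}"

text \<open>The image of a set of local automorphisms under restriction along \<open>\<epsilon>\<close>.\<close>

definition pull_along :: "'b::field set \<Rightarrow> ('b \<Rightarrow> 'c) \<Rightarrow> ('c \<Rightarrow> 'c) set \<Rightarrow> ('b \<Rightarrow> 'b) set" where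
  "pull_along k \<epsilon> I = {\<sigma> \<in> carrier (abs_Gal k). \<exists>\<tau>\<in>I. \<epsilon> \<circ> \<sigma> = \<tau> \<circ> \<epsilon>}"

definition inertia_image2 ::
  "'b::field set \<Rightarrow> 'c::field set \<Rightarrow> ('c \<Rightarrow> int) \<Rightarrow> ('b \<Rightarrow> 'c) \<Rightarrow> ('b \<Rightarrow> 'b) set set" where
  "inertia_image2 k F w \<epsilon> = pro2_proj k ` pull_along k \<epsilon> (local_inertia F w)"

definition decomposition_image2 ::
  "'b::field set \<Rightarrow> 'c::field set \<Rightarrow> ('b \<Rightarrow> 'c) \<Rightarrow> ('b \<Rightarrow> 'b) set set" where
  "decomposition_image2 k F \<epsilon> = pro2_proj k ` pull_along k \<epsilon> (carrier (abs_Gal F))"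

definition topological_generator_of ::
  "'b::field set \<Rightarrow> ('b \<Rightarrow> 'b) set \<Rightarrow> ('b \<Rightarrow> 'b) set set \<Rightarrow> bool" where
  "topological_generator_of k x I \<longleftrightarrow> x \<in> carrier (max_pro2 k) \<and>
     max_pro2_topology k closure_of generate (max_pro2 k) {x} = I"

text \<open>
  An element of \<open>G\<^sub>k(2)\<close> is a coset; all its members agree on the maximal pro-2 extension, which
  contains the fields \<open>F\<^bsub>q^(2^n)\<^esub>\<close> and \<open>\<surd>T\<close>.
\<close>

definition frobenius_lift ::
  "('a::{finite,field} poly fract \<Rightarrow> 'b::field) \<Rightarrow> 'c::field set \<Rightarrow> ('b \<Rightarrow> 'c) \<Rightarrow> ('b \<Rightarrow> 'b) set \<Rightarrow> bool" where
  "frobenius_lift \<iota> F \<epsilon> Fr \<longleftrightarrow>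
     Fr \<in> decomposition_image2 (range \<iota>) F \<epsilon> \<and>
     (\<forall>\<sigma>\<in>Fr. \<forall>n x. x ^ (CARD('a) ^ (2 ^ n)) = x \<longrightarrow> \<sigma> x = x ^ CARD('a)) \<and>
     (\<forall>\<sigma>\<in>Fr. \<forall>x. x\<^sup>2 = \<iota> (to_fract [:0, 1:]) \<longrightarrow> \<sigma> x = x)"

definition nonzero_squares :: "'f::field set" where
  "nonzero_squares = {y\<^sup>2 | y. y \<noteq> 0}"

definition square_classes :: "'f::field set monoid" where
  "square_classes = Multiplicative_Group.mult_of type_ring Mod nonzero_squares"

definition square_class :: "'f::field \<Rightarrow> 'f set" where
  "square_class x = nonzero_squares #>\<^bsub>Multiplicative_Group.mult_of type_ring\<^esub> x"

text \<open>
  Over the field with two elements a linear combination of a finite set of classes is the product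
  over a subset.
\<close>

definition lin_indep :: "'f::field set set \<Rightarrow> bool" where
  "lin_indep S \<longleftrightarrow> finite S \<and> S \<subseteq> carrier square_classes \<and>
     (\<forall>U\<subseteq>S. U \<noteq> {} \<longrightarrow> finprod square_classes (\<lambda>c. c) U \<noteq> \<one>\<^bsub>square_classes\<^esub>)"

text \<open>
  Cochains are total functions of which only the values on the Galois group matter.
\<close>

type_synonym 'b cochain = "('b \<Rightarrow> 'b) \<Rightarrow> bit"

definition factors_through :: "'b::field set \<Rightarrow> ('b \<Rightarrow> 'b) set \<Rightarrow> 'b cochain \<Rightarrow> bool" where
  "factors_through k N f \<longleftrightarrow> (\<forall>\<sigma>\<in>carrier (abs_Gal k). \<forall>\<tau>\<in>carrier (abs_Gal k).
     N #>\<^bsub>abs_Gal k\<^esub> \<sigma> = N #>\<^bsub>abs_Gal k\<^esub> \<tau> \<longrightarrow> f \<sigma> = f \<tau>)"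

definition cochain2 :: "'b::field set \<Rightarrow> 'b cochain \<Rightarrow> bool" where
  "cochain2 k f \<longleftrightarrow> continuous_map (krull k) (discrete_topology UNIV) f \<and>
     factors_through k (pro2_kernel k) f"

definition vanishes_on :: "('b \<Rightarrow> 'b) set set \<Rightarrow> 'b cochain \<Rightarrow> bool" where
  "vanishes_on \<GG> f \<longleftrightarrow> (\<forall>x\<in>\<GG>. \<forall>\<sigma>\<in>x. f \<sigma> = 0)"

definition coboundary :: "'b::field cochain \<Rightarrow> ('b \<Rightarrow> 'b) \<Rightarrow> ('b \<Rightarrow> 'b) \<Rightarrow> bit" where
  "coboundary f \<sigma> \<tau> = f \<sigma> + f \<tau> - f (\<sigma> \<circ> \<tau>)"

definition chi :: "('f::field \<Rightarrow> 'b::field) \<Rightarrow> 'f set \<Rightarrow> 'b cochain" where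
  "chi \<iota> c \<sigma> = (if \<forall>x. x\<^sup>2 \<in> \<iota> ` c \<longrightarrow> \<sigma> x = x then 0 else 1)"

definition chi_set :: "('f::field \<Rightarrow> 'b::field) \<Rightarrow> 'f set set \<Rightarrow> 'b cochain" where
  "chi_set \<iota> U \<sigma> = (\<Prod>c\<in>U. chi \<iota> c \<sigma>)"

definition phi_family ::
  "('f::field \<Rightarrow> 'b::field) \<Rightarrow> ('b \<Rightarrow> 'b) set set \<Rightarrow> 'f set set \<Rightarrow> 'f set \<Rightarrow> ('f set set \<Rightarrow> 'b cochain) \<Rightarrow> bool" where
  "phi_family \<iota> \<GG> A c \<Phi> \<longleftrightarrow>
     (\<forall>S\<subseteq>A. cochain2 (range \<iota>) (\<Phi> S)) \<and>
     (\<forall>\<sigma>\<in>carrier (abs_Gal (range \<iota>)). \<Phi> {} \<sigma> = chi \<iota> c \<sigma>) \<and>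
     (\<forall>S\<subseteq>A. \<forall>\<sigma>\<in>carrier (abs_Gal (range \<iota>)). \<forall>\<tau>\<in>carrier (abs_Gal (range \<iota>)).
        coboundary (\<Phi> S) \<sigma> \<tau> = (\<Sum>U\<in>Pow S - {{}}. chi_set \<iota> U \<sigma> * \<Phi> (S - U) \<tau>)) \<and>
     (\<forall>S\<subseteq>A. S \<noteq> {} \<longrightarrow> vanishes_on \<GG> (\<Phi> S))"

definition phi_exists ::
  "('f::field \<Rightarrow> 'b::field) \<Rightarrow> ('b \<Rightarrow> 'b) set set \<Rightarrow> 'f set set \<Rightarrow> 'f set \<Rightarrow> bool" where
  "phi_exists \<iota> \<GG> A c \<longleftrightarrow> c \<notin> A \<and> lin_indep (insert c A) \<and> (\<exists>\<Phi>. phi_family \<iota> \<GG> A c \<Phi>)"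

text \<open>
  The choices below are harmless: if \<open>\<GG>\<close> topologically generates the maximal pro-2 quotient, the
  family is unique on the Galois group.
\<close>

definition phi ::
  "('f::field \<Rightarrow> 'b::field) \<Rightarrow> ('b \<Rightarrow> 'b) set set \<Rightarrow> 'f set set \<Rightarrow> 'f set \<Rightarrow> 'b cochain" where
  "phi \<iota> \<GG> A c = (SOME \<Phi>. phi_family \<iota> \<GG> A c \<Phi>) A"

definition phi_hat_family ::
  "('f::field \<Rightarrow> 'b::field) \<Rightarrow> ('b \<Rightarrow> 'b) set set \<Rightarrow> 'f set set \<Rightarrow> 'f set set \<Rightarrow> 'f set \<Rightarrow> 'f set \<Rightarrow>
   ('f set set \<Rightarrow> 'f set set \<Rightarrow> 'b cochain) \<Rightarrow> bool" where
  "phi_hat_family \<iota> \<GG> A B c c' \<Psi> \<longleftrightarrow>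
     (\<forall>V\<^sub>1\<subseteq>A. \<forall>V\<^sub>2\<subseteq>B. cochain2 (range \<iota>) (\<Psi> V\<^sub>1 V\<^sub>2) \<and> vanishes_on \<GG> (\<Psi> V\<^sub>1 V\<^sub>2) \<and>
       (\<forall>g\<^sub>1\<in>carrier (abs_Gal (range \<iota>)). \<forall>g\<^sub>2\<in>carrier (abs_Gal (range \<iota>)).
          coboundary (\<Psi> V\<^sub>1 V\<^sub>2) g\<^sub>1 g\<^sub>2 =
            (\<Sum>(U\<^sub>1, U\<^sub>2) \<in> Pow V\<^sub>1 \<times> Pow V\<^sub>2 - {({}, {})}.
               chi_set \<iota> (U\<^sub>1 \<union> U\<^sub>2) g\<^sub>1 * \<Psi> (V\<^sub>1 - U\<^sub>1) (V\<^sub>2 - U\<^sub>2) g\<^sub>2) +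
            phi \<iota> \<GG> V\<^sub>1 c g\<^sub>1 * (\<Sum>U\<in>Pow V\<^sub>2. chi_set \<iota> U g\<^sub>1 * phi \<iota> \<GG> (V\<^sub>2 - U) c' g\<^sub>2)))"

definition phi_hat_exists ::
  "('f::field \<Rightarrow> 'b::field) \<Rightarrow> ('b \<Rightarrow> 'b) set set \<Rightarrow> 'f set set \<Rightarrow> 'f set set \<Rightarrow> 'f set \<Rightarrow> 'f set \<Rightarrow> bool" where
  "phi_hat_exists \<iota> \<GG> A B c c' \<longleftrightarrow>
     finite A \<and> finite B \<and> A \<inter> B = {} \<and>
     lin_indep (A \<union> B \<union> {c, c'}) \<and> card (A \<union> B \<union> {c, c'}) = card A + card B + 2 \<and>
     phi_exists \<iota> \<GG> A c \<and> phi_exists \<iota> \<GG> B c' \<and>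
     (\<exists>\<Psi>. phi_hat_family \<iota> \<GG> A B c c' \<Psi>)"

definition phi_hat ::
  "('f::field \<Rightarrow> 'b::field) \<Rightarrow> ('b \<Rightarrow> 'b) set set \<Rightarrow> 'f set set \<Rightarrow> 'f set set \<Rightarrow> 'f set \<Rightarrow> 'f set \<Rightarrow> 'b cochain" where
  "phi_hat \<iota> \<GG> A B c c' = (SOME \<Psi>. phi_hat_family \<iota> \<GG> A B c c' \<Psi>) A B"

definition field_of_definition :: "'b::field set \<Rightarrow> 'b cochain \<Rightarrow> 'b set" where
  "field_of_definition k f = fixed_field
     (GREATEST N. N \<lhd> abs_Gal k \<and> openin (krull k) N \<and> factors_through k N f)"

definition sqrt_field :: "('f::field \<Rightarrow> 'b::field) \<Rightarrow> 'f set set \<Rightarrow> 'b set" where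
  "sqrt_field \<iota> A = generate_field type_ring (range \<iota> \<union> {x. \<exists>c\<in>A. x\<^sup>2 \<in> \<iota> ` c})"

text \<open>Quadratic characters are continuous homomorphisms to \<^typ>\<open>bit\<close>, possibly trivial.\<close>

definition quadratic_character_on :: "'b::field set \<Rightarrow> 'b cochain \<Rightarrow> bool" where
  "quadratic_character_on M f \<longleftrightarrow> continuous_map (krull M) (discrete_topology UNIV) f \<and>
     (\<forall>\<sigma>\<in>carrier (abs_Gal M). \<forall>\<tau>\<in>carrier (abs_Gal M). f (\<sigma> \<circ> \<tau>) = f \<sigma> + f \<tau>)"

definition conj_char :: "'b::field set \<Rightarrow> 'b set \<Rightarrow> 'b cochain \<Rightarrow> ('b \<Rightarrow> 'b) \<Rightarrow> 'b cochain" where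
  "conj_char k M f g \<tau> =
     (let \<sigma> = (SOME \<sigma>. \<sigma> \<in> carrier (abs_Gal k) \<and> restrict \<sigma> M = g)
      in f (inv\<^bsub>abs_Gal k\<^esub> \<sigma> \<otimes>\<^bsub>abs_Gal k\<^esub> \<tau> \<otimes>\<^bsub>abs_Gal k\<^esub> \<sigma>))"

text \<open>
  Restriction of a cochain is extension by \<open>0\<close> outside the subgroup (rather than
  \<^const>\<open>restrict\<close>), so that it is additive.
\<close>

definition res :: "('b \<Rightarrow> 'b) set \<Rightarrow> 'b cochain \<Rightarrow> 'b cochain" where
  "res H f = (\<lambda>\<tau>. if \<tau> \<in> H then f \<tau> else 0)"

definition bit_scale :: "bit \<Rightarrow> ('x \<Rightarrow> bit) \<Rightarrow> 'x \<Rightarrow> bit" where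
  "bit_scale c f = (\<lambda>x. c * f x)"

lemma module_bit_scale: "Modules.module bit_scale"
  by unfold_locales (auto simp: bit_scale_def plus_fun_def fun_eq_iff algebra_simps)

abbreviation bit_span :: "('x \<Rightarrow> bit) set \<Rightarrow> ('x \<Rightarrow> bit) set" where
  "bit_span \<equiv> Modules.module.span bit_scale"

end

theory Submission
  imports "Jordan_Normal_Form.Char_Poly" Defs
begin

text \<open>
  Let \<open>t\<close> generate inertia at a prime dividing \<open>a\<^sub>s\<^sub>+\<^sub>1\<close>.  All normalized maps vanish at \<open>t\<close>, and so do
  the characters of \<open>a\<^sub>1, \<dots>, a\<^sub>s\<close>, which are unramified there; hence \<open>t \<in> \<H>\<close> and every element
  of the span vanishes at \<open>t\<close>.  On the other hand \<open>\<phi>\<^sup>g(t) = \<chi>\<^sub>1(g) \<cdots> \<chi>\<^sub>s(g)\<close>, because the only member of the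
  family of \<open>\<phi>\<close> that is non-zero at \<open>t\<close> is \<open>\<phi>\<^sub>\<emptyset> = \<chi>\<^sub>s\<^sub>+\<^sub>1\<close>; so the sum of the conjugates is \<open>1\<close> at \<open>t\<close>.

  The chosen expansion families are compatible because they are unique, that is, because a quadratic
  character vanishing on \<open>\<GG>\<close> is trivial: it is \<open>\<chi>\<^sub>d\<close> for some \<open>d\<close>, inertia at a prime of odd
  valuation moves \<open>\<surd>d\<close>, and Frobenius moves the square root of a non-square constant.  That inertia moves
  \<open>\<surd>d\<close> rests on Teichmueller representatives: an automorphism fixing the constants of the separable
  closure of the completion is in inertia, and \<open>\<surd>d\<close> is not generated by constants.
\<close>

subsection \<open>Extending partial homomorphisms of a separable closure\<close>

text \<open>Fields are types and subfields are sets, so a separable closure comes with neither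
  intermediate extensions nor degrees. Automorphisms are therefore built as graphs of partial
  homomorphisms and extended by Zorn's lemma; finite Galois groups appear as automorphisms up to
  agreement on a finite stable set; Kummer theory and the Galois correspondence for open subgroups
  both come from independence of characters. At a place the valuation lives on the completion only.
  In the separable closure, integrality over the valuation ring and divisibility by powers of the
  uniformizer replace it, and the roots of the equations \<open>X ^ (p ^ n) = X\<close> replace the
  residue field. Each normalized map is chosen separately for its own index set, so a smaller map is
  not by definition a member of the family of a larger one; uniqueness closes this gap. The group
  fixing each field \<open>L\<close> is described through the whole family: an automorphism lies in
  it exactly if all members and all characters vanish there. This one description shows both that
  the inertia element lies in \<open>\<H>\<close> and that the summands of the hat maps are additive
  on it.\<close>

lemma type_ring_simps [simp]:
  "carrier (type_ring :: 'f::field ring) = UNIV"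
  "(x::'f) \<otimes>\<^bsub>type_ring\<^esub> y = x * y" "\<one>\<^bsub>type_ring\<^esub> = (1::'f)"
  "\<zero>\<^bsub>type_ring\<^esub> = (0::'f)" "(x::'f) \<oplus>\<^bsub>type_ring\<^esub> y = x + y"
  by (auto simp: ring_of_type_algebra_def)

lemma field_type_ring: "field (type_ring :: 'f::field ring)"
  by (rule field_from_type_algebra)

lemma type_ring_inv:
  assumes "(x::'f::field) \<noteq> 0"
  shows "inv\<^bsub>type_ring\<^esub> x = inverse x"
proof -
  interpret field "type_ring :: 'f ring" by (rule field_type_ring)
  show ?thesis
    by (rule inv_char) (use assms in auto)
qed

lemma type_ring_a_inv: "\<ominus>\<^bsub>type_ring\<^esub> (x::'f::field) = - x"
proof -
  interpret field "type_ring :: 'f ring" by (rule field_type_ring)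
  show ?thesis
    by (rule minus_equality) auto
qed

text \<open>In a field type \<open>inverse 0 = 0\<close>, so the inverse clause can range over all
  of \<open>K\<close>, and \<open>0\<close> is obtained as \<open>1 + (- 1)\<close>. This trades the
  operations of the ring structure for those of the type class.\<close>

lemma subfield_type_ring_iff:
  "subfield (K :: 'f::field set) type_ring \<longleftrightarrow>
     1 \<in> K \<and> (\<forall>x\<in>K. \<forall>y\<in>K. x + y \<in> K \<and> x * y \<in> K) \<and> (\<forall>x\<in>K. - x \<in> K \<and> inverse x \<in> K)"
proof -
  interpret field "type_ring :: 'f ring" by (rule field_type_ring)
  show ?thesis
  proof
    assume K: "subfield K type_ring"
    have "0 \<in> K" using subfieldE(1)[OF K] subringE(2) by fastforce
    moreover have "inverse x \<in> K" if "x \<in> K" for x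
      using subfield_m_inv(1)[OF K, of x] that \<open>0 \<in> K\<close> by (cases "x = 0") (auto simp: type_ring_inv)
    ultimately show "1 \<in> K \<and> (\<forall>x\<in>K. \<forall>y\<in>K. x + y \<in> K \<and> x * y \<in> K) \<and> (\<forall>x\<in>K. - x \<in> K \<and> inverse x \<in> K)"
      using subringE(3,5,6,7)[OF subfieldE(1)[OF K]] by (auto simp: type_ring_a_inv)
  next
    assume *: "1 \<in> K \<and> (\<forall>x\<in>K. \<forall>y\<in>K. x + y \<in> K \<and> x * y \<in> K) \<and> (\<forall>x\<in>K. - x \<in> K \<and> inverse x \<in> K)"
    show "subfield K type_ring"
    proof (rule subfieldI')
      show "subring K type_ring"
        by (rule subringI) (use * in \<open>auto simp: type_ring_a_inv\<close>)
      show "inv\<^bsub>type_ring\<^esub> k \<in> K" if "k \<in> K - {\<zero>\<^bsub>type_ring\<^esub>}" for k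
        using that * by (auto simp: type_ring_inv)
    qed
  qed
qed

lemma subfieldD:
  assumes "subfield (K :: 'f::field set) type_ring"
  shows "0 \<in> K" "1 \<in> K" "x \<in> K \<Longrightarrow> y \<in> K \<Longrightarrow> x + y \<in> K" "x \<in> K \<Longrightarrow> y \<in> K \<Longrightarrow> x * y \<in> K"
    "x \<in> K \<Longrightarrow> - x \<in> K" "x \<in> K \<Longrightarrow> inverse x \<in> K" "x \<in> K \<Longrightarrow> y \<in> K \<Longrightarrow> x - y \<in> K"
proof -
  note K = assms[unfolded subfield_type_ring_iff]
  show "1 \<in> K" using K by auto
  show "0 \<in> K" using K by (metis add.right_inverse)
  show "x \<in> K \<Longrightarrow> y \<in> K \<Longrightarrow> x - y \<in> K" using K by (metis diff_conv_add_uminus)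
qed (use assms[unfolded subfield_type_ring_iff] in auto)

lemma generate_field_least:
  assumes "subfield K type_ring" "S \<subseteq> K"
  shows "generate_field (type_ring :: 'f::field ring) S \<subseteq> K"
  using field.generate_field_min_subfield1[OF field_type_ring _ assms] by simp

lemma generate_field_superset: "S \<subseteq> generate_field (type_ring :: 'f::field ring) S"
  by (auto intro: generate_field.incl)

lemma subfield_generate_field: "subfield (generate_field (type_ring :: 'f::field ring) S) type_ring"
  using field.generate_field_is_subfield[OF field_type_ring] by auto

text \<open>A partial homomorphism is represented by its graph. It is the identity on \<open>K\<close>, and its
  domain is a ring containing \<open>K\<close>.\<close>

definition phom :: "'f::field set \<Rightarrow> ('f \<times> 'f) set \<Rightarrow> bool" where
  "phom K G \<longleftrightarrow> (\<forall>x\<in>K. (x, x) \<in> G) \<and>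
     (\<forall>x y x' y'. (x, x') \<in> G \<longrightarrow> (y, y') \<in> G \<longrightarrow> (x + y, x' + y') \<in> G \<and> (x * y, x' * y') \<in> G) \<and>
     (\<forall>y. (0, y) \<in> G \<longrightarrow> y = 0)"

text \<open>The second polynomial is the image of the first under the partial homomorphism,
  coefficient by coefficient. The degree cannot grow, since \<open>0\<close> is related to
  \<open>0\<close> only.\<close>

definition polys_in :: "('f::field \<times> 'f) set \<Rightarrow> ('f poly \<times> 'f poly) set" where
  "polys_in G = {(p, q). \<forall>i. (Polynomial.coeff p i, Polynomial.coeff q i) \<in> G}"

text \<open>Formally the map on the ring generated by \<open>x\<close> over the domain that sends
  \<open>x\<close> to \<open>x'\<close>. For arbitrary \<open>x'\<close> it is only a relation; when
  it is well defined is the content of \<open>phom_phom_ext\<close>.\<close>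

definition phom_ext :: "('f::field \<times> 'f) set \<Rightarrow> 'f \<Rightarrow> 'f \<Rightarrow> ('f \<times> 'f) set" where
  "phom_ext G x x' = {(poly p x, poly q x') | p q. (p, q) \<in> polys_in G}"

section \<open>Adjunction of one element to the domain\<close>

context
  fixes K :: "'f::field set" and G :: "('f \<times> 'f) set"
  assumes K: "subfield K type_ring" and G: "phom K G"
begin

lemma phomD:
  shows "x \<in> K \<Longrightarrow> (x, x) \<in> G"
    "(x, x') \<in> G \<Longrightarrow> (y, y') \<in> G \<Longrightarrow> (x + y, x' + y') \<in> G"
    "(x, x') \<in> G \<Longrightarrow> (y, y') \<in> G \<Longrightarrow> (x * y, x' * y') \<in> G"
    "(0, y) \<in> G \<Longrightarrow> y = 0"
  using G unfolding phom_def by auto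

lemma phom_0: "(0, 0) \<in> G" and phom_1: "(1, 1) \<in> G"
  using phomD(1) subfieldD(1,2)[OF K] by auto

lemma phom_uminus: "(x, x') \<in> G \<Longrightarrow> (- x, - x') \<in> G"
  using phomD(3)[OF phomD(1)[OF subfieldD(5)[OF K subfieldD(2)[OF K]]], of x x'] by simp

lemma phom_diff: "(x, x') \<in> G \<Longrightarrow> (y, y') \<in> G \<Longrightarrow> (x - y, x' - y') \<in> G"
  using phomD(2)[OF _ phom_uminus] by fastforce

lemma phom_fun: "(x, y) \<in> G \<Longrightarrow> (x, y') \<in> G \<Longrightarrow> y = y'"
  using phom_diff[of x y x y'] phomD(4)[of "y - y'"] by auto

lemma phom_sum: "finite A \<Longrightarrow> (\<And>i. i \<in> A \<Longrightarrow> (f i, g i) \<in> G) \<Longrightarrow> (sum f A, sum g A) \<in> G"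
  by (induction A rule: finite_induct) (auto intro: phom_0 phomD(2))

lemma phom_power: "(x, x') \<in> G \<Longrightarrow> (x ^ n, x' ^ n) \<in> G"
  by (induction n) (auto intro: phom_1 phomD(3))

lemma polys_in_0: "(0, 0) \<in> polys_in G"
  by (auto simp: polys_in_def phom_0)

lemma polys_in_add: "(p, p') \<in> polys_in G \<Longrightarrow> (q, q') \<in> polys_in G \<Longrightarrow> (p + q, p' + q') \<in> polys_in G"
  by (auto simp: polys_in_def phomD(2))

lemma polys_in_diff: "(p, p') \<in> polys_in G \<Longrightarrow> (q, q') \<in> polys_in G \<Longrightarrow> (p - q, p' - q') \<in> polys_in G"
  by (auto simp: polys_in_def phom_diff)

lemma polys_in_mult: "(p, p') \<in> polys_in G \<Longrightarrow> (q, q') \<in> polys_in G \<Longrightarrow> (p * q, p' * q') \<in> polys_in G"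
  by (auto simp: polys_in_def coeff_mult intro!: phom_sum phomD(3))

lemma polys_in_monom: "(c, c') \<in> G \<Longrightarrow> (Polynomial.monom c n, Polynomial.monom c' n) \<in> polys_in G"
  by (auto simp: polys_in_def coeff_monom phom_0)

lemma polys_in_pCons: "(c, c') \<in> G \<Longrightarrow> (p, p') \<in> polys_in G \<Longrightarrow> (pCons c p, pCons c' p') \<in> polys_in G"
  by (auto simp: polys_in_def coeff_pCons split: nat.splits)

lemma polys_in_degree_le: "(p, p') \<in> polys_in G \<Longrightarrow> Polynomial.degree p' \<le> Polynomial.degree p"
  unfolding polys_in_def by (auto intro!: degree_le) (metis coeff_eq_0 phomD(4))

lemma polys_in_0_left: "(0, p') \<in> polys_in G \<Longrightarrow> p' = 0"
  unfolding polys_in_def by (auto intro!: poly_eqI) (metis phomD(4))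

text \<open>The domain of a partial homomorphism is only a ring, but division by a monic polynomial
  needs no inverses, so the same steps can be carried out on both components at once.\<close>

lemma polys_in_division:
  assumes m: "(m, m') \<in> polys_in G" "Polynomial.lead_coeff m = 1" "Polynomial.degree m > 0"
    and p: "(p, p') \<in> polys_in G"
  obtains q q' r r' where "(q, q') \<in> polys_in G" "(r, r') \<in> polys_in G" "p = q * m + r" "p' = q' * m' + r'"
    "Polynomial.degree r < Polynomial.degree m"
proof -
  have "\<exists>q q' r r'. (q, q') \<in> polys_in G \<and> (r, r') \<in> polys_in G \<and> p = q * m + r \<and> p' = q' * m' + r' \<and>
    Polynomial.degree r < Polynomial.degree m"
    using p
  proof (induction "Polynomial.degree p" arbitrary: p p' rule: less_induct)
    case less
    show ?case
    proof (cases "Polynomial.degree p < Polynomial.degree m")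
      case True
      then show ?thesis using less.prems polys_in_0 by (intro exI[of _ 0] exI[of _ p] exI[of _ p']) auto
    next
      case False
      define n where "n = Polynomial.degree p - Polynomial.degree m"
      define c where "c = Polynomial.monom (Polynomial.lead_coeff p) n"
      \<comment> \<open>The coefficient of \<open>p'\<close> in the degree of \<open>p\<close>: only
        coefficients in equal positions are related, and \<open>p'\<close> may have smaller
        degree.\<close>
      define c' where "c' = Polynomial.monom (Polynomial.coeff p' (Polynomial.degree p)) n"
      have cc: "(c, c') \<in> polys_in G"
        unfolding c_def c'_def by (rule polys_in_monom) (use less.prems in \<open>auto simp: polys_in_def\<close>)
      have pos: "Polynomial.degree p > 0" using False m(3) by linarith
      then have "p \<noteq> 0" by auto
      have "m \<noteq> 0" "c \<noteq> 0" using m(3) \<open>p \<noteq> 0\<close> by (auto simp: c_def monom_eq_0_iff)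
      moreover have "Polynomial.degree c = n" unfolding c_def by (rule degree_monom_eq) (use \<open>p \<noteq> 0\<close> in simp)
      ultimately have dc1: "Polynomial.degree (c * m) = Polynomial.degree p"
        using \<open>p \<noteq> 0\<close> False by (subst degree_mult_eq) (auto simp: n_def)
      moreover have "Polynomial.lead_coeff (c * m) = Polynomial.lead_coeff p"
        using m(2) lead_coeff_monom[of "Polynomial.lead_coeff p" n] by (simp add: lead_coeff_mult c_def[symmetric])
      ultimately have dc: "Polynomial.degree (c * m) = Polynomial.degree p"
        "Polynomial.coeff (c * m) (Polynomial.degree p) = Polynomial.lead_coeff p" by simp_all
      have "Polynomial.degree (p - c * m) < Polynomial.degree p"
      proof (cases "p - c * m = 0")
        case True
        then show ?thesis using pos by auto
      next
        case False
        have "Polynomial.degree (p - c * m) \<le> Polynomial.degree p"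
          using dc(1) degree_diff_le_max[of p "c * m"] by auto
        moreover have "Polynomial.coeff (p - c * m) (Polynomial.degree p) = 0"
          using dc by simp
        ultimately show ?thesis using False
          by (metis eq_zero_or_degree_less)
      qed
      from less.hyps[OF this polys_in_diff[OF less.prems polys_in_mult[OF cc m(1)]]]
      obtain q q' r r' where qr: "(q, q') \<in> polys_in G" "(r, r') \<in> polys_in G" "p - c * m = q * m + r"
        "p' - c' * m' = q' * m' + r'" "Polynomial.degree r < Polynomial.degree m"
        by blast
      show ?thesis
        by (rule exI[of _ "q + c"], rule exI[of _ "q' + c'"], rule exI[of _ r], rule exI[of _ r'])
          (use qr cc in \<open>auto simp: polys_in_add algebra_simps\<close>)
    qed
  qed
  then show ?thesis using that by blast
qed

lemma phom_ext_superset: "G \<subseteq> phom_ext G x x'"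
proof
  fix z assume "z \<in> G"
  then obtain a b where z: "z = (a, b)" "(a, b) \<in> G" by (cases z) auto
  have "([:a:], [:b:]) \<in> polys_in G" using polys_in_pCons[OF z(2) polys_in_0] by simp
  then show "z \<in> phom_ext G x x'" unfolding phom_ext_def z(1) mem_Collect_eq
    by (intro exI[of _ "[:a:]"] exI[of _ "[:b:]"]) simp
qed

lemma phom_ext_self: "(x, x') \<in> phom_ext G x x'"
proof -
  have "([:0, 1:], [:0, 1:]) \<in> polys_in G" by (intro polys_in_pCons polys_in_0 phom_0 phom_1)
  then show ?thesis unfolding phom_ext_def mem_Collect_eq
    by (intro exI[of _ "[:0, 1:]"]) simp
qed

text \<open>If \<open>p\<close> vanishes at \<open>x\<close>, so does its remainder modulo
  \<open>m\<close>, which is zero by minimality; hence \<open>p'\<close> is a multiple of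
  \<open>m'\<close> and vanishes at \<open>x'\<close>. So the value at \<open>x'\<close> depends on
  the value at \<open>x\<close> only.\<close>

lemma phom_phom_ext:
  assumes m: "(m, m') \<in> polys_in G" "Polynomial.lead_coeff m = 1" "Polynomial.degree m > 0"
    and root: "poly m' x' = 0"
    and least: "\<forall>g g'. (g, g') \<in> polys_in G \<longrightarrow> poly g x = 0 \<longrightarrow> Polynomial.degree g < Polynomial.degree m \<longrightarrow> g = 0"
    and mx: "poly m x = 0"
  shows "phom K (phom_ext G x x')"
proof -
  have 1: "(a, a) \<in> phom_ext G x x'" if "a \<in> K" for a
    using phom_ext_superset phomD(1)[OF that] by blast
  have 2: "(a + b, a' + b') \<in> phom_ext G x x' \<and> (a * b, a' * b') \<in> phom_ext G x x'"
    if ab: "(a, a') \<in> phom_ext G x x'" "(b, b') \<in> phom_ext G x x'" for a b a' b'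
  proof -
    obtain p p' where "(p, p') \<in> polys_in G" "a = poly p x" "a' = poly p' x'"
      using ab(1) unfolding phom_ext_def mem_Collect_eq prod.inject by blast
    moreover obtain q q' where "(q, q') \<in> polys_in G" "b = poly q x" "b' = poly q' x'"
      using ab(2) unfolding phom_ext_def mem_Collect_eq prod.inject by blast
    ultimately show ?thesis
      using polys_in_add[of p p' q q'] polys_in_mult[of p p' q q'] unfolding phom_ext_def mem_Collect_eq
      by (intro conjI exI[of _ "p + q"] exI[of _ "p' + q'"] exI[of _ "p * q"] exI[of _ "p' * q'"]) auto
  qed
  have 3: "y = 0" if y0: "(0, y) \<in> phom_ext G x x'" for y
  proof -
    obtain p p' where p: "(p, p') \<in> polys_in G" "poly p x = 0" "y = poly p' x'"
      using y0 unfolding phom_ext_def mem_Collect_eq prod.inject by metis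
    obtain q q' r r' where qr: "(q, q') \<in> polys_in G" "(r, r') \<in> polys_in G"
      "p = q * m + r" "p' = q' * m' + r'" "Polynomial.degree r < Polynomial.degree m"
      by (rule polys_in_division[OF m p(1)])
    have "poly r x = 0" using qr(3) mx p(2) by auto
    then have "r = 0" using least qr by blast
    then have "r' = 0" using polys_in_0_left qr(2) by blast
    then show ?thesis using p(3) qr(4) root by simp
  qed
  show ?thesis unfolding phom_def using 1 2 3 by blast
qed

end

lemma phom_Id_on: "subfield K type_ring \<Longrightarrow> phom K (Id_on K)"
  unfolding phom_def by (auto simp: subfieldD)

lemma polys_in_Id_on: "(p, q) \<in> polys_in (Id_on K) \<longleftrightarrow> p = q \<and> (\<forall>i. Polynomial.coeff p i \<in> K)"
  unfolding polys_in_def by (auto simp: Id_on_iff poly_eq_iff)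

text \<open>Factors \<open>X\<close> are stripped off \<open>p\<close> until the constant term
  \<open>c\<close> is non-zero; then \<open>c + x * r(x) = 0\<close> exhibits the inverse as a
  polynomial in \<open>x\<close>.\<close>

lemma algebraic_inverse_poly:
  assumes K: "subfield (K :: 'f::field set) type_ring" and p: "\<forall>i. Polynomial.coeff p i \<in> K" "p \<noteq> 0" "poly p x = 0" "x \<noteq> 0"
  shows "\<exists>q. (\<forall>i. Polynomial.coeff q i \<in> K) \<and> poly q x * x = 1"
  using p
proof (induction "Polynomial.degree p" arbitrary: p rule: less_induct)
  case less
  obtain c r where pr: "p = pCons c r" by (cases p)
  have r: "\<forall>i. Polynomial.coeff r i \<in> K" "c \<in> K"
    using less.prems(1) spec[OF less.prems(1), of 0] unfolding pr by (auto dest: spec[of _ "Suc _"])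
  show ?case
  proof (cases "c = 0")
    case True
    have "r \<noteq> 0" using less.prems pr True by auto
    then have "Polynomial.degree r < Polynomial.degree p" by (simp add: pr)
    moreover have "poly r x = 0" using less.prems pr True by auto
    ultimately show ?thesis using less.hyps[OF _ r(1) \<open>r \<noteq> 0\<close>] less.prems by blast
  next
    case False
    have "poly (Polynomial.smult (- inverse c) r) x * x = 1"
    proof -
      have "c + x * poly r x = 0" using less.prems(3) by (simp add: pr)
      then have "poly r x * x = - c" by (metis add_eq_0_iff mult.commute)
      then show ?thesis using False by (simp add: mult.assoc)
    qed
    then show ?thesis
      using r subfieldD[OF K] by (intro exI[of _ "Polynomial.smult (- inverse c) r"]) auto
  qed
qed

lemma separable_poly_dvd:
  assumes "separable_poly p" "m dvd p"
  shows "separable_poly m"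
proof -
  obtain h where h: "p = m * h" using assms(2) by (rule dvdE)
  show ?thesis unfolding separable_poly_def
  proof (rule coprimeI)
    fix d assume d: "d dvd m" "d dvd pderiv m"
    then have "d dvd p" "d dvd pderiv p" unfolding h by (auto simp: pderiv_mult)
    then show "is_unit d" using assms(1) unfolding separable_poly_def by (rule coprime_common_divisor[rotated])
  qed
qed

lemma separable_poly_nonzero: "separable_poly p \<Longrightarrow> p \<noteq> 0"
  by (auto simp: separable_poly_def)

lemma algebraic_over_closure:
  assumes "is_separable_closure_of K"
  obtains p where "separable_poly p" "\<forall>i. Polynomial.coeff p i \<in> K" "poly p x = 0" "p \<noteq> 0"
  using assms separable_poly_nonzero unfolding is_separable_closure_of_def separable_over_def by blast

section \<open>Extension to the whole separable closure\<close>

context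
  fixes K :: "'f::field set" and G :: "('f \<times> 'f) set"
  assumes cl: "is_separable_closure_of K" and G: "phom K G"
begin

lemma closure_subfield: "subfield K type_ring"
  using cl by (simp add: is_separable_closure_of_def)

lemma polys_in_same: "\<forall>i. Polynomial.coeff p i \<in> K \<Longrightarrow> (p, p) \<in> polys_in G"
  using phomD(1)[OF closure_subfield G] by (auto simp: polys_in_def)

lemma phom_poly:
  assumes "\<forall>i. Polynomial.coeff p i \<in> K" "(x, x') \<in> G"
  shows "(poly p x, poly p x') \<in> G"
  unfolding poly_altdef
  by (intro phom_sum[OF closure_subfield G] phomD(3)[OF closure_subfield G] phomD(1)[OF closure_subfield G]
      phom_power[OF closure_subfield G]) (use assms in auto)

text \<open>An element of the closure is algebraic over \<open>K\<close>, so its inverse is a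
  polynomial in it with coefficients in \<open>K\<close>. The domain, assumed to be a ring only, is
  thus closed under inverses.\<close>

lemma phom_inverse:
  assumes "(u, u') \<in> G"
  shows "(inverse u, inverse u') \<in> G"
proof (cases "u = 0")
  case True
  then show ?thesis using assms phomD(4)[OF closure_subfield G, of u'] phom_0[OF closure_subfield G] by simp
next
  case False
  obtain p where p: "\<forall>i. Polynomial.coeff p i \<in> K" "poly p u = 0" "p \<noteq> 0"
    by (rule algebraic_over_closure[OF cl, of u]) blast
  from algebraic_inverse_poly[OF closure_subfield p(1,3,2) False]
  obtain q where q: "\<forall>i. Polynomial.coeff q i \<in> K" "poly q u * u = 1" by blast
  have *: "(poly q u, poly q u') \<in> G" using phom_poly[OF q(1) assms] .
  have "(1, poly q u' * u') \<in> G" using phomD(3)[OF closure_subfield G * assms] q(2) by simp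
  then have "poly q u' * u' = 1"
    using phom_fun[OF closure_subfield G] phom_1[OF closure_subfield G] by blast
  then have "inverse u' = poly q u'" using inverse_unique[of u' "poly q u'"] by (simp add: mult.commute)
  moreover have "inverse u = poly q u" using q(2) inverse_unique[of u "poly q u"] by (simp add: mult.commute)
  ultimately show ?thesis using * by simp
qed

text \<open>\<open>m\<close> is the minimal polynomial of \<open>x\<close> over the domain. A
  separable polynomial over \<open>K\<close> with root \<open>x\<close> is divisible by
  \<open>m\<close> and is its own image, so \<open>m'\<close> divides it as well; this is what makes
  \<open>m'\<close> separable and gives it a root in the closure.\<close>

lemma minimal_polynomial:
  obtains m m' where "(m, m') \<in> polys_in G" "Polynomial.lead_coeff m = 1" "Polynomial.degree m > 0"
    "poly m x = 0" "\<forall>g g'. (g, g') \<in> polys_in G \<longrightarrow> poly g x = 0 \<longrightarrow> Polynomial.degree g < Polynomial.degree m \<longrightarrow> g = 0"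
    "separable_poly m'" "Polynomial.degree m' = Polynomial.degree m"
proof -
  note K = closure_subfield
  obtain p where p: "separable_poly p" "\<forall>i. Polynomial.coeff p i \<in> K" "poly p x = 0" "p \<noteq> 0"
    using algebraic_over_closure[OF cl] .
  define P where "P d \<longleftrightarrow> (\<exists>g g'. (g, g') \<in> polys_in G \<and> poly g x = 0 \<and> g \<noteq> 0 \<and> Polynomial.degree g = d)" for d
  have "P (Polynomial.degree p)" unfolding P_def using polys_in_same[OF p(2)] p by blast
  then have PL: "P (Least P)" and Pmin: "\<And>d. d < Least P \<Longrightarrow> \<not> P d"
    by (auto intro: LeastI dest: not_less_Least)
  obtain g g' where g: "(g, g') \<in> polys_in G" "poly g x = 0" "g \<noteq> 0" "Polynomial.degree g = Least P"
    using PL unfolding P_def by blast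
  define c where "c = inverse (Polynomial.lead_coeff g)"
  define c' where "c' = inverse (Polynomial.coeff g' (Polynomial.degree g))"
  have c: "(c, c') \<in> G" "c \<noteq> 0" unfolding c_def c'_def
    using g(1,3) by (auto intro!: phom_inverse simp: polys_in_def)
  define m where "m = Polynomial.smult c g"
  define m' where "m' = Polynomial.smult c' g'"
  have mm: "(m, m') \<in> polys_in G" using g(1) c(1) by (auto simp: m_def m'_def polys_in_def intro: phomD(3)[OF K G])
  have lm: "Polynomial.lead_coeff m = 1" "poly m x = 0" and dm: "Polynomial.degree m = Least P" using g c(2) by (auto simp: m_def c_def)
  have dpos: "Polynomial.degree m > 0"
  proof (rule ccontr)
    assume "\<not> ?thesis"
    then obtain b where "m = [:b:]" by (metis degree_eq_zeroE not_gr_zero)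
    then show False using lm by auto
  qed
  have least: "h = 0" if "(h, h') \<in> polys_in G" "poly h x = 0" "Polynomial.degree h < Polynomial.degree m" for h h'
    using that Pmin unfolding dm P_def by blast
  have "(1, Polynomial.coeff m' (Polynomial.degree m)) \<in> G" using mm lm(1) by (auto simp: polys_in_def dest: spec[of _ "Polynomial.degree m"])
  then have cm': "Polynomial.coeff m' (Polynomial.degree m) = 1"
    using phom_fun[OF K G] phom_1[OF K G] by blast
  then have dm': "Polynomial.degree m' = Polynomial.degree m"
    by (intro antisym polys_in_degree_le[OF K G mm] le_degree) simp
  obtain q q' r r' where qr0: "(q, q') \<in> polys_in G" and qr: "(r, r') \<in> polys_in G" "p = q * m + r" "p = q' * m' + r'"
      "Polynomial.degree r < Polynomial.degree m"
    by (rule polys_in_division[OF K G mm lm(1) dpos polys_in_same[OF p(2)]])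
  have "r = 0" using least[OF qr(1) _ qr(4)] qr(2) lm(2) p(3) by simp
  then have "r' = 0" using polys_in_0_left[OF K G] qr(1) by blast
  then have "m' dvd p" using qr(3) by simp
  then have "separable_poly m'" using separable_poly_dvd p(1) by blast
  with that[OF mm lm(1) dpos lm(2) _ _ dm'] show ?thesis using least by blast
qed

lemma phom_extend: "\<exists>x'. phom K (phom_ext G x x')"
proof -
  obtain m m' where m: "(m, m') \<in> polys_in G" "Polynomial.lead_coeff m = 1" "Polynomial.degree m > 0"
    "poly m x = 0" "\<forall>g g'. (g, g') \<in> polys_in G \<longrightarrow> poly g x = 0 \<longrightarrow> Polynomial.degree g < Polynomial.degree m \<longrightarrow> g = 0"
    "separable_poly m'" "Polynomial.degree m' = Polynomial.degree m"
    by (rule minimal_polynomial[of x])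
  have "\<exists>x'. poly m' x' = 0"
    using cl m(3,6,7) unfolding is_separable_closure_of_def by auto
  then obtain x' where x': "poly m' x' = 0" by blast
  have "phom K (phom_ext G x x')"
    by (rule phom_phom_ext[OF closure_subfield G m(1,2,3) x' m(5,4)])
  then show ?thesis ..
qed

end

text \<open>As \<open>x\<close> is not in \<open>K\<close>, its minimal polynomial over
  \<open>K\<close> has degree at least two. Being separable, it has \<open>x\<close> as a simple
  root, so the cofactor of \<open>X - x\<close> provides another root to which \<open>x\<close> can
  be sent.\<close>

lemma phom_move:
  assumes cl: "is_separable_closure_of K" and x: "x \<notin> K"
  shows "\<exists>x'. x' \<noteq> x \<and> phom K (phom_ext (Id_on K) x x')"
proof -
  have K: "subfield K type_ring" using cl by (simp add: is_separable_closure_of_def)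
  note G = phom_Id_on[OF K]
  obtain m m' where m: "(m, m') \<in> polys_in (Id_on K)" "Polynomial.lead_coeff m = 1" "Polynomial.degree m > 0"
    "poly m x = 0" "\<forall>g g'. (g, g') \<in> polys_in (Id_on K) \<longrightarrow> poly g x = 0 \<longrightarrow> Polynomial.degree g < Polynomial.degree m \<longrightarrow> g = 0"
    "separable_poly m'" "Polynomial.degree m' = Polynomial.degree m"
    by (rule minimal_polynomial[OF cl G, of x])
  have m': "m' = m" "\<forall>i. Polynomial.coeff m i \<in> K" using m(1) by (auto simp: polys_in_Id_on)
  obtain h where h: "m = [:- x, 1:] * h" using m(4) by (metis dvdE poly_eq_0_iff_dvd)
  have "h \<noteq> 0" using m(3) h by auto
  have dh: "Polynomial.degree m = Suc (Polynomial.degree h)"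
    unfolding h by (subst degree_mult_eq) (use \<open>h \<noteq> 0\<close> in auto)
  have "Polynomial.degree h > 0"
  proof (rule ccontr)
    assume "\<not> ?thesis"
    then obtain b where b: "h = [:b:]" by (metis degree_eq_zeroE not_gr_zero)
    have "b = 1" using m(2) \<open>h \<noteq> 0\<close> unfolding h b by (simp add: b)
    then have "Polynomial.coeff m 0 = - x" unfolding h b by simp
    then have "- (- x) \<in> K" using m'(2) subfieldD(5)[OF K] by metis
    then show False using x by simp
  qed
  moreover have "separable_poly h" using separable_poly_dvd[OF m(6), of h] unfolding m'(1) by (metis h dvd_triv_right)
  ultimately obtain x' where x': "poly h x' = 0"
    using cl unfolding is_separable_closure_of_def by blast
  have "x' \<noteq> x"
  proof
    assume "x' = x"
    then have *: "[:- x, 1:] dvd h" using x' by (simp add: poly_eq_0_iff_dvd)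
    then have "[:- x, 1:] dvd m" "[:- x, 1:] dvd pderiv m" unfolding h pderiv_mult by (simp_all only: dvd_triv_left dvd_add dvd_mult dvd_mult2)
    then have "is_unit [:- x, 1:]" using m(6) unfolding m'(1) separable_poly_def by (metis coprime_common_divisor)
    then show False by (simp add: is_unit_poly_iff)
  qed
  moreover have "poly m' x' = 0" unfolding m'(1) h using x' by simp
  moreover have "phom K (phom_ext (Id_on K) x x')" if "poly m' x' = 0"
    by (rule phom_phom_ext[OF K G m(1,2,3) that m(5,4)])
  ultimately show ?thesis by blast
qed

lemma carrier_abs_Gal:
  "\<sigma> \<in> carrier (abs_Gal K) \<longleftrightarrow> bij \<sigma> \<and> (\<forall>x y. \<sigma> (x + y) = \<sigma> x + \<sigma> y \<and> \<sigma> (x * y) = \<sigma> x * \<sigma> y) \<and> (\<forall>x\<in>K. \<sigma> x = x)"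
  by (auto simp: Gal_def)

lemma phom_total_abs_Gal:
  assumes cl: "is_separable_closure_of K" and G: "phom K G" and tot: "\<And>x. \<exists>y. (x, y) \<in> G"
  shows "\<exists>\<sigma>\<in>carrier (abs_Gal K). \<forall>x. (x, \<sigma> x) \<in> G"
proof -
  note K = closure_subfield[OF cl G]
  obtain \<sigma> where \<sigma>: "\<And>x. (x, \<sigma> x) \<in> G" using tot by metis
  note phf = phom_fun[OF K G]
  have add: "\<sigma> (x + y) = \<sigma> x + \<sigma> y" and mult: "\<sigma> (x * y) = \<sigma> x * \<sigma> y" for x y
    using phf[OF \<sigma> phomD(2)[OF K G \<sigma> \<sigma>]] phf[OF \<sigma> phomD(3)[OF K G \<sigma> \<sigma>]] by auto
  have fixK: "\<sigma> x = x" if "x \<in> K" for x using phf[OF \<sigma> phomD(1)[OF K G that]] .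
  have inj: "inj \<sigma>"
  proof (rule injI)
    fix x y assume "\<sigma> x = \<sigma> y"
    then have *: "(x - y, 0) \<in> G" using phom_diff[OF K G \<sigma>[of x] \<sigma>[of y]] by simp
    have "x - y = 0"
    proof (rule ccontr)
      assume "x - y \<noteq> 0"
      then have "(1, 0) \<in> G" using phomD(3)[OF K G * \<sigma>[of "inverse (x - y)"]] by simp
      then have "(1::'a) = 0" using phf[OF phom_1[OF K G]] by blast
      then show False by simp
    qed
    then show "x = y" by simp
  qed
  \<comment> \<open>The map permutes the finite root set of a polynomial over \<open>K\<close>,
    because it is injective there; every element is such a root.\<close>
  have "\<exists>x. y = \<sigma> x" for y
  proof -
    obtain p where p: "\<forall>i. Polynomial.coeff p i \<in> K" "poly p y = 0" "p \<noteq> 0"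
      by (rule algebraic_over_closure[OF cl, of y]) blast
    have "(poly p x, poly p (\<sigma> x)) \<in> G" for x using phom_poly[OF cl G p(1) \<sigma>] .
    then have "\<sigma> ` {x. poly p x = 0} \<subseteq> {x. poly p x = 0}"
      using phomD(4)[OF K G] by (metis (mono_tags, lifting) image_subsetI mem_Collect_eq)
    then have "\<sigma> ` {x. poly p x = 0} = {x. poly p x = 0}"
      by (intro endo_inj_surj) (use p(3) inj in \<open>auto simp: poly_roots_finite intro: inj_on_subset\<close>)
    then show ?thesis using p(2) by blast
  qed
  then have "bij \<sigma>" using inj by (auto simp: bij_def surj_def)
  then show ?thesis using add mult fixK \<sigma> unfolding Bex_def carrier_abs_Gal by blast
qed

text \<open>Zorn's lemma for graphs ordered by inclusion. A maximal graph is total, because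
  \<open>phom_extend\<close> would enlarge it otherwise, and a total one is an automorphism.\<close>

lemma phom_extends_to_abs_Gal:
  assumes cl: "is_separable_closure_of K" and G: "phom K G"
  shows "\<exists>\<sigma>\<in>carrier (abs_Gal K). \<forall>(x, y)\<in>G. \<sigma> x = y"
proof -
  note K = closure_subfield[OF cl G]
  let ?A = "{M. phom K M \<and> G \<subseteq> M}"
  have "\<Union>C \<in> ?A" if C: "C \<noteq> {}" "subset.chain ?A C" for C
  proof -
    have ph: "phom K M" "G \<subseteq> M" if "M \<in> C" for M using C(2) that by (auto simp: subset_chain_def)
    have ex: "\<exists>M\<in>C. z \<in> M \<and> w \<in> M" if zw: "z \<in> \<Union>C" "w \<in> \<Union>C" for z w
    proof -
      obtain M1 M2 where M: "M1 \<in> C" "z \<in> M1" "M2 \<in> C" "w \<in> M2" using zw by blast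
      then have "M1 \<subseteq> M2 \<or> M2 \<subseteq> M1" using C(2) unfolding subset_chain_def by blast
      then show ?thesis using M by blast
    qed
    have "phom K (\<Union>C)" unfolding phom_def
    proof (intro conjI allI impI ballI)
      fix x assume "x \<in> K"
      then show "(x, x) \<in> \<Union>C" using C(1) phomD(1)[OF K ph(1)] by blast
    next
      fix x y x' y' assume "(x, x') \<in> \<Union>C" "(y, y') \<in> \<Union>C"
      then obtain M where M: "M \<in> C" "(x, x') \<in> M" "(y, y') \<in> M" using ex by blast
      show "(x + y, x' + y') \<in> \<Union>C" "(x * y, x' * y') \<in> \<Union>C"
        using phomD(2,3)[OF K ph(1)[OF M(1)] M(2,3)] M(1) by blast+
    next
      fix y assume "(0, y) \<in> \<Union>C"
      then show "y = 0" using phomD(4)[OF K ph(1)] by blast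
    qed
    then show ?thesis using C(1) ph(2) by blast
  qed
  moreover have "?A \<noteq> {}" using G by blast
  ultimately obtain M where M: "phom K M" "G \<subseteq> M" "\<forall>Y. phom K Y \<longrightarrow> G \<subseteq> Y \<longrightarrow> M \<subseteq> Y \<longrightarrow> Y = M"
    using subset_Zorn_nonempty[of ?A] by auto
  have "\<exists>y. (x, y) \<in> M" for x
  proof -
    obtain x' where x': "phom K (phom_ext M x x')" using phom_extend[OF cl M(1)] by blast
    then have "phom_ext M x x' = M"
      using M(2,3) phom_ext_superset[OF K M(1), of x x'] by blast
    then show ?thesis using phom_ext_self[OF K M(1), of x x'] by blast
  qed
  then obtain \<sigma> where \<sigma>: "\<sigma> \<in> carrier (abs_Gal K)" "\<And>x. (x, \<sigma> x) \<in> M"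
    using phom_total_abs_Gal[OF cl M(1)] by metis
  then show ?thesis using M(2) phom_fun[OF K M(1)] by blast
qed

text \<open>The purpose of the graphs: the fixed field of the absolute Galois group of
  \<open>K\<close> is \<open>K\<close> itself. Both Kummer theory and the ramification argument draw
  on it.\<close>

theorem abs_Gal_moves:
  assumes cl: "is_separable_closure_of K" and x: "x \<notin> K"
  shows "\<exists>\<sigma>\<in>carrier (abs_Gal K). \<sigma> x \<noteq> x"
proof -
  have K: "subfield K type_ring" using cl by (simp add: is_separable_closure_of_def)
  obtain x' where x': "x' \<noteq> x" "phom K (phom_ext (Id_on K) x x')"
    using phom_move[OF cl x] by blast
  then obtain \<sigma> where \<sigma>: "\<sigma> \<in> carrier (abs_Gal K)" "\<forall>(a, b)\<in>phom_ext (Id_on K) x x'. \<sigma> a = b"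
    using phom_extends_to_abs_Gal[OF cl] by blast
  then have "\<sigma> x = x'" using phom_ext_self[OF K phom_Id_on[OF K], of x x'] by fastforce
  then show ?thesis using \<sigma>(1) x'(1) by blast
qed

subsection \<open>Krull topology\<close>

lemma Gal_mult [simp]: "g \<otimes>\<^bsub>abs_Gal K\<^esub> h = g \<circ> h"
  by (auto simp: Gal_def compose_def fun_eq_iff)

lemma Gal_one [simp]: "\<one>\<^bsub>abs_Gal K\<^esub> = id"
  by (auto simp: Gal_def fun_eq_iff)

lemma id_in_abs_Gal [simp]: "id \<in> carrier (abs_Gal K)"
  by (simp add: carrier_abs_Gal)

lemma comp_in_abs_Gal: "\<sigma> \<in> carrier (abs_Gal K) \<Longrightarrow> \<tau> \<in> carrier (abs_Gal K) \<Longrightarrow> \<sigma> \<circ> \<tau> \<in> carrier (abs_Gal K)"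
  by (auto simp: carrier_abs_Gal intro: bij_comp)

lemma inv_in_abs_Gal:
  assumes "\<sigma> \<in> carrier (abs_Gal K)"
  shows "inv_into UNIV \<sigma> \<in> carrier (abs_Gal K)"
proof -
  have s: "bij \<sigma>" "\<And>x y. \<sigma> (x + y) = \<sigma> x + \<sigma> y" "\<And>x y. \<sigma> (x * y) = \<sigma> x * \<sigma> y" "\<And>x. x \<in> K \<Longrightarrow> \<sigma> x = x"
    using assms by (auto simp: carrier_abs_Gal)
  have i: "\<sigma> (inv_into UNIV \<sigma> y) = y" "inv_into UNIV \<sigma> (\<sigma> x) = x" for x y
    using s(1) by (auto simp: bij_is_inj bij_is_surj surj_f_inv_f)
  show ?thesis unfolding carrier_abs_Gal
    using s(1) i s(2-4) by (auto intro: bij_imp_bij_inv) (metis i s(2,3,4))+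
qed

lemma group_abs_Gal: "group (abs_Gal K)"
proof (rule groupI)
  fix \<sigma> assume s: "\<sigma> \<in> carrier (abs_Gal K)"
  then have "inv_into UNIV \<sigma> \<circ> \<sigma> = id" by (auto simp: carrier_abs_Gal bij_is_inj)
  then show "\<exists>\<tau>\<in>carrier (abs_Gal K). \<tau> \<otimes>\<^bsub>abs_Gal K\<^esub> \<sigma> = \<one>\<^bsub>abs_Gal K\<^esub>"
    using inv_in_abs_Gal[OF s] by auto
qed (auto simp: comp_in_abs_Gal comp_assoc)

lemma abs_Gal_inv:
  assumes s: "\<sigma> \<in> carrier (abs_Gal K)"
  shows "inv\<^bsub>abs_Gal K\<^esub> \<sigma> = inv_into UNIV \<sigma>"
proof -
  interpret group "abs_Gal K" by (rule group_abs_Gal)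
  have "inv_into UNIV \<sigma> \<circ> \<sigma> = id" using s by (auto simp: carrier_abs_Gal bij_is_inj)
  then show ?thesis by (intro inv_equality) (auto simp: s inv_in_abs_Gal)
qed

lemma abs_Gal_anti_mono: "K \<subseteq> L \<Longrightarrow> carrier (abs_Gal L) \<subseteq> carrier (abs_Gal K)"
  by (auto simp: carrier_abs_Gal subset_iff)

context
  fixes K :: "'f::field set" and \<sigma>
  assumes s: "\<sigma> \<in> carrier (abs_Gal K)"
begin

lemma abs_Gal_add: "\<sigma> (x + y) = \<sigma> x + \<sigma> y" and abs_Gal_mult: "\<sigma> (x * y) = \<sigma> x * \<sigma> y"
  and abs_Gal_fix: "x \<in> K \<Longrightarrow> \<sigma> x = x" and abs_Gal_bij: "bij \<sigma>"
  using s by (auto simp: carrier_abs_Gal)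

lemma abs_Gal_inj: "\<sigma> x = \<sigma> y \<longleftrightarrow> x = y"
  using abs_Gal_bij by (simp add: bij_is_inj inj_eq)

lemma abs_Gal_0: "\<sigma> 0 = 0"
  using abs_Gal_add[of 0 0] by (metis add.right_neutral add_left_cancel)

lemma abs_Gal_1: "\<sigma> 1 = 1"
proof -
  have "\<sigma> 1 \<noteq> 0" using abs_Gal_inj[of 1 0] abs_Gal_0 by simp
  moreover have "\<sigma> 1 * \<sigma> 1 = \<sigma> 1 * 1" using abs_Gal_mult[of 1 1] by simp
  ultimately show ?thesis using mult_left_cancel by blast
qed

lemma abs_Gal_uminus: "\<sigma> (- x) = - \<sigma> x"
  using abs_Gal_add[of x "- x"] abs_Gal_0 by (metis add.right_inverse minus_unique)

lemma abs_Gal_diff: "\<sigma> (x - y) = \<sigma> x - \<sigma> y"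
  using abs_Gal_add[of x "- y"] abs_Gal_uminus by simp

lemma abs_Gal_inverse: "\<sigma> (inverse x) = inverse (\<sigma> x)"
proof (cases "x = 0")
  case False
  then have "\<sigma> x * \<sigma> (inverse x) = 1" using abs_Gal_mult[of x "inverse x"] abs_Gal_1 by simp
  then show ?thesis using inverse_unique by metis
qed (simp add: abs_Gal_0)

lemma abs_Gal_power: "\<sigma> (x ^ n) = \<sigma> x ^ n"
  by (induction n) (auto simp: abs_Gal_1 abs_Gal_mult)

lemma abs_Gal_sum: "\<sigma> (sum g A) = (\<Sum>i\<in>A. \<sigma> (g i))"
  by (induction A rule: infinite_finite_induct) (auto simp: abs_Gal_0 abs_Gal_add)

lemma abs_Gal_poly: "\<forall>i. Polynomial.coeff p i \<in> K \<Longrightarrow> \<sigma> (poly p x) = poly p (\<sigma> x)"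
  by (simp add: poly_altdef abs_Gal_sum abs_Gal_mult abs_Gal_power abs_Gal_fix)

lemma subfield_fixed: "subfield {x. \<sigma> x = x} type_ring"
  unfolding subfield_type_ring_iff by (auto simp: abs_Gal_1 abs_Gal_add abs_Gal_mult abs_Gal_uminus abs_Gal_inverse)

end

section \<open>Open sets and continuous functions\<close>

lemma topspace_krull [simp]: "topspace (krull K) = carrier (abs_Gal K)"
  by (auto simp: krull_def)

text \<open>Neighbourhoods in a product of discrete spaces constrain finitely many coordinates. Here
  a coordinate is an element of the field, so a neighbourhood of an automorphism contains all those
  agreeing with it on some finite set.\<close>

lemma openin_krull_iff:
  "openin (krull K) U \<longleftrightarrow> U \<subseteq> carrier (abs_Gal K) \<and>
     (\<forall>\<sigma>\<in>U. \<exists>A. finite A \<and> (\<forall>\<tau>\<in>carrier (abs_Gal K). (\<forall>x\<in>A. \<tau> x = \<sigma> x) \<longrightarrow> \<tau> \<in> U))"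
  (is "?L \<longleftrightarrow> ?R")
proof
  assume ?L
  then obtain V where V: "openin (product_topology (\<lambda>_. discrete_topology UNIV) UNIV) V" "U = V \<inter> carrier (abs_Gal K)"
    unfolding krull_def openin_subtopology by blast
  have "\<exists>A. finite A \<and> (\<forall>\<tau>\<in>carrier (abs_Gal K). (\<forall>x\<in>A. \<tau> x = \<sigma> x) \<longrightarrow> \<tau> \<in> U)" if "\<sigma> \<in> U" for \<sigma>
  proof -
    have "\<sigma> \<in> V" using that V(2) by blast
    then obtain W where W: "finite {i. W i \<noteq> UNIV}" "\<sigma> \<in> Pi\<^sub>E UNIV W" "Pi\<^sub>E UNIV W \<subseteq> V"
      using V(1) unfolding openin_product_topology_alt by fastforce
    have "\<tau> \<in> U" if "\<tau> \<in> carrier (abs_Gal K)" "\<forall>x\<in>{i. W i \<noteq> UNIV}. \<tau> x = \<sigma> x" for \<tau>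
    proof -
      have "\<tau> x \<in> W x" for x
        using W(2) that(2) by (cases "W x = UNIV") (auto simp: PiE_iff)
      then have "\<tau> \<in> Pi\<^sub>E UNIV W" by auto
      then show ?thesis using W(3) V(2) that(1) by blast
    qed
    then show ?thesis using W(1) by blast
  qed
  then show ?R using V(2) by blast
next
  assume R: ?R
  show ?L
  proof (subst openin_subopen, intro ballI)
    fix \<sigma> assume s: "\<sigma> \<in> U"
    then obtain A where A: "finite A" "\<forall>\<tau>\<in>carrier (abs_Gal K). (\<forall>x\<in>A. \<tau> x = \<sigma> x) \<longrightarrow> \<tau> \<in> U" using R by blast
    define W where "W x = (if x \<in> A then {\<sigma> x} else UNIV)" for x
    have "finite {i. W i \<noteq> UNIV}" by (rule finite_subset[OF _ A(1)]) (auto simp: W_def)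
    then have "openin (product_topology (\<lambda>_. discrete_topology UNIV) UNIV) (Pi\<^sub>E UNIV W)"
      by (intro product_topology_basis) auto
    then have "openin (krull K) (Pi\<^sub>E UNIV W \<inter> carrier (abs_Gal K))"
      unfolding krull_def by (rule openin_subtopology_Int)
    moreover have "\<sigma> \<in> Pi\<^sub>E UNIV W \<inter> carrier (abs_Gal K)" using s R by (auto simp: W_def)
    moreover have "Pi\<^sub>E UNIV W \<inter> carrier (abs_Gal K) \<subseteq> U"
    proof
      fix \<tau> assume t: "\<tau> \<in> Pi\<^sub>E UNIV W \<inter> carrier (abs_Gal K)"
      then have "\<tau> x \<in> W x" for x by (auto simp: PiE_iff)
      then have "\<tau> x = \<sigma> x" if "x \<in> A" for x using that by (metis W_def singletonD)
      then show "\<tau> \<in> U" using A(2) t by blast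
    qed
    ultimately show "\<exists>T. openin (krull K) T \<and> \<sigma> \<in> T \<and> T \<subseteq> U" by blast
  qed
qed

lemma continuous_krull_discrete:
  "continuous_map (krull K) (discrete_topology UNIV) f \<longleftrightarrow> (\<forall>b. openin (krull K) {\<sigma> \<in> carrier (abs_Gal K). f \<sigma> = b})"
proof
  assume "continuous_map (krull K) (discrete_topology UNIV) f"
  then have "openin (krull K) {\<sigma> \<in> topspace (krull K). f \<sigma> \<in> {b}}" for b
    by (rule openin_continuous_map_preimage) auto
  then show "\<forall>b. openin (krull K) {\<sigma> \<in> carrier (abs_Gal K). f \<sigma> = b}" by simp
next
  assume *: "\<forall>b. openin (krull K) {\<sigma> \<in> carrier (abs_Gal K). f \<sigma> = b}"
  have "openin (krull K) {\<sigma> \<in> topspace (krull K). f \<sigma> \<in> U}" for U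
  proof -
    have "{\<sigma> \<in> topspace (krull K). f \<sigma> \<in> U} = (\<Union>b\<in>U. {\<sigma> \<in> carrier (abs_Gal K). f \<sigma> = b})" by auto
    then show ?thesis using * by auto
  qed
  then show "continuous_map (krull K) (discrete_topology UNIV) f" by (auto simp: continuous_map)
qed

lemma openin_krull_determined:
  assumes "finite A" "\<And>\<sigma> \<tau>. \<sigma> \<in> carrier (abs_Gal K) \<Longrightarrow> \<tau> \<in> carrier (abs_Gal K) \<Longrightarrow> (\<forall>x\<in>A. \<tau> x = \<sigma> x) \<Longrightarrow> P \<sigma> \<Longrightarrow> P \<tau>"
  shows "openin (krull K) {\<sigma> \<in> carrier (abs_Gal K). P \<sigma>}"
  unfolding openin_krull_iff using assms by blast

subsection \<open>Artin's lemma\<close>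

text \<open>Dedekind's argument: the relation at \<open>z * y\<close> minus
  \<open>\<delta> z\<close> times the relation at \<open>y\<close> loses the term of
  \<open>\<delta>\<close>. The maps are compared on the multiplicative set \<open>L\<close> only,
  since automorphisms of the whole closure will be counted by their action on a finite
  extension.\<close>

lemma dedekind_independence:
  fixes L :: "'f::field set"
  assumes "finite \<Gamma>" "1 \<in> L" "\<And>x y. x \<in> L \<Longrightarrow> y \<in> L \<Longrightarrow> x * y \<in> L"
    and "\<And>\<gamma>. \<gamma> \<in> \<Gamma> \<Longrightarrow> \<gamma> 1 = 1 \<and> (\<forall>x\<in>L. \<forall>y\<in>L. \<gamma> (x * y) = \<gamma> x * \<gamma> y)"
    and "\<And>\<gamma> \<delta>. \<gamma> \<in> \<Gamma> \<Longrightarrow> \<delta> \<in> \<Gamma> \<Longrightarrow> \<gamma> \<noteq> \<delta> \<Longrightarrow> \<exists>x\<in>L. \<gamma> x \<noteq> (\<delta> x :: 'f)"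
    and "\<forall>y\<in>L. (\<Sum>\<gamma>\<in>\<Gamma>. c \<gamma> * \<gamma> y) = 0"
  shows "\<forall>\<gamma>\<in>\<Gamma>. c \<gamma> = 0"
  using assms
proof (induction \<Gamma> arbitrary: c rule: finite_induct)
  case empty
  then show ?case by simp
next
  case (insert \<delta> \<Gamma>)
  have mult: "\<gamma> (x * y) = \<gamma> x * \<gamma> y" if "\<gamma> \<in> insert \<delta> \<Gamma>" "x \<in> L" "y \<in> L" for \<gamma> x y
    using insert.prems(3)[OF that(1)] that(2,3) by blast
  have rel: "c \<delta> * \<delta> y + (\<Sum>\<gamma>\<in>\<Gamma>. c \<gamma> * \<gamma> y) = 0" if "y \<in> L" for y
    using insert.prems(5) that insert.hyps by auto
  have "\<forall>\<gamma>\<in>\<Gamma>. c \<gamma> * (\<gamma> z - \<delta> z) = 0" if z: "z \<in> L" for z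
  proof (rule insert.IH)
    show "\<forall>y\<in>L. (\<Sum>\<gamma>\<in>\<Gamma>. c \<gamma> * (\<gamma> z - \<delta> z) * \<gamma> y) = 0"
    proof
      fix y assume y: "y \<in> L"
      have "(\<Sum>\<gamma>\<in>\<Gamma>. c \<gamma> * (\<gamma> z - \<delta> z) * \<gamma> y) = (\<Sum>\<gamma>\<in>\<Gamma>. c \<gamma> * \<gamma> (z * y)) - \<delta> z * (\<Sum>\<gamma>\<in>\<Gamma>. c \<gamma> * \<gamma> y)"
        unfolding sum_distrib_left sum_subtractf[symmetric]
        by (rule sum.cong) (auto simp: mult y z algebra_simps)
      also have "\<dots> = - (c \<delta> * \<delta> (z * y)) + \<delta> z * (c \<delta> * \<delta> y)"
        using rel[OF y] rel[OF insert.prems(2)[OF z y]] by (simp add: add_eq_0_iff)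
      also have "\<dots> = 0" by (simp add: mult y z)
      finally show "(\<Sum>\<gamma>\<in>\<Gamma>. c \<gamma> * (\<gamma> z - \<delta> z) * \<gamma> y) = 0" .
    qed
  qed (use insert.prems in auto)
  then have c: "c \<gamma> = 0" if "\<gamma> \<in> \<Gamma>" for \<gamma>
    using insert.prems(4)[of \<gamma> \<delta>] insert.hyps(2) that by force
  then have "c \<delta> * \<delta> 1 = 0" using rel[OF insert.prems(1)] by simp
  then have "c \<delta> = 0" using insert.prems(3)[of \<delta>] by simp
  then show ?case using c by blast
qed

text \<open>A finite Galois extension in disguise: the elements of \<open>A\<close> generate it, and
  an automorphism acts on it through one of the finitely many self-maps of \<open>A\<close>.\<close>

locale galois_orbit =
  fixes K :: "'f::field set" and A :: "'f set"
  assumes fin: "finite A" and stable: "\<And>\<sigma> x. \<sigma> \<in> carrier (abs_Gal K) \<Longrightarrow> x \<in> A \<Longrightarrow> \<sigma> x \<in> A"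
begin

abbreviation "G \<equiv> carrier (abs_Gal K)"

text \<open>The fixed field of the pointwise stabiliser of \<open>A\<close>, which stands for the
  extension generated by \<open>A\<close>. In this form automorphisms that agree on \<open>A\<close>
  agree on \<open>L\<close> almost by definition.\<close>

definition L where "L = {y. \<forall>\<sigma>\<in>G. (\<forall>x\<in>A. \<sigma> x = x) \<longrightarrow> \<sigma> y = y}"

lemma L_mult: "x \<in> L \<Longrightarrow> y \<in> L \<Longrightarrow> x * y \<in> L" and L_1: "1 \<in> L" and A_L: "A \<subseteq> L"
  by (auto simp: L_def abs_Gal_mult abs_Gal_1)

lemma agree_L:
  assumes "\<sigma> \<in> G" "\<tau> \<in> G" "\<forall>x\<in>A. \<sigma> x = \<tau> x" "y \<in> L"
  shows "\<sigma> y = \<tau> y"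
proof -
  have i: "inv_into UNIV \<tau> (\<tau> x) = x" "\<tau> (inv_into UNIV \<tau> x) = x" for x
    using abs_Gal_bij[OF assms(2)] by (auto simp: bij_is_inj bij_is_surj surj_f_inv_f)
  have "inv_into UNIV \<tau> \<circ> \<sigma> \<in> G" by (intro comp_in_abs_Gal inv_in_abs_Gal assms)
  moreover have "\<forall>x\<in>A. (inv_into UNIV \<tau> \<circ> \<sigma>) x = x" using assms(3) i by simp
  ultimately have "(inv_into UNIV \<tau> \<circ> \<sigma>) y = y" using assms(4) unfolding L_def by blast
  then show ?thesis using i(2)[of "\<sigma> y"] by simp
qed

lemma finite_restrictions: "finite ((\<lambda>\<sigma>. restrict \<sigma> A) ` G)"
  by (rule finite_subset[OF _ finite_PiE[OF fin, of "\<lambda>_. A"]]) (use fin stable in auto)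

text \<open>\<open>\<Gamma>\<close> replaces the image of \<open>N\<close> in the finite Galois
  group of the extension, so that sums over it play the role of traces.\<close>

lemma representatives:
  assumes "N \<subseteq> G"
  obtains \<Gamma> where "finite \<Gamma>" "\<Gamma> \<subseteq> N" "\<And>\<gamma> \<delta>. \<gamma> \<in> \<Gamma> \<Longrightarrow> \<delta> \<in> \<Gamma> \<Longrightarrow> \<forall>x\<in>A. \<gamma> x = \<delta> x \<Longrightarrow> \<gamma> = \<delta>"
    "\<And>\<sigma>. \<sigma> \<in> N \<Longrightarrow> \<exists>\<gamma>\<in>\<Gamma>. \<forall>x\<in>A. \<gamma> x = \<sigma> x"
proof -
  let ?r = "\<lambda>\<sigma>. restrict \<sigma> A"
  obtain \<Gamma> where \<Gamma>: "\<Gamma> \<subseteq> N" "inj_on ?r \<Gamma>" "?r ` N = ?r ` \<Gamma>"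
    using subset_image_inj[of "?r ` N" ?r N] by blast
  have iff: "?r \<sigma> = ?r \<tau> \<longleftrightarrow> (\<forall>x\<in>A. \<sigma> x = \<tau> x)" for \<sigma> \<tau>
    by (auto simp: fun_eq_iff restrict_def)
  have "finite (?r ` \<Gamma>)" by (rule finite_subset[OF _ finite_restrictions]) (use \<Gamma>(1) assms in auto)
  then have "finite \<Gamma>" using \<Gamma>(2) finite_imageD by blast
  moreover have "\<gamma> = \<delta>" if "\<gamma> \<in> \<Gamma>" "\<delta> \<in> \<Gamma>" "\<forall>x\<in>A. \<gamma> x = \<delta> x" for \<gamma> \<delta>
    using \<Gamma>(2) that iff unfolding inj_on_def by blast
  moreover have "\<exists>\<gamma>\<in>\<Gamma>. \<forall>x\<in>A. \<gamma> x = \<sigma> x" if "\<sigma> \<in> N" for \<sigma>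
  proof -
    have "?r \<sigma> \<in> ?r ` \<Gamma>" using \<Gamma>(3) that by blast
    then obtain \<gamma> where "\<gamma> \<in> \<Gamma>" "?r \<sigma> = ?r \<gamma>" by blast
    then show ?thesis using iff[of \<sigma> \<gamma>] by (intro bexI[of _ \<gamma>]) simp_all
  qed
  ultimately show ?thesis using that \<Gamma>(1) by blast
qed

text \<open>Translation by \<open>\<sigma>\<close> need not map \<open>\<Gamma>\<close> to itself,
  but it permutes the classes of agreement on \<open>A\<close>; \<open>t\<close> follows it by the
  choice of representatives.\<close>

lemma sum_reindex_translate:
  assumes N: "N \<subseteq> G" and \<Gamma>: "finite \<Gamma>" "\<Gamma> \<subseteq> N" "\<And>\<gamma> \<delta>. \<gamma> \<in> \<Gamma> \<Longrightarrow> \<delta> \<in> \<Gamma> \<Longrightarrow> \<forall>x\<in>A. \<gamma> x = \<delta> x \<Longrightarrow> \<gamma> = \<delta>"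
    "\<And>\<sigma>. \<sigma> \<in> N \<Longrightarrow> \<exists>\<gamma>\<in>\<Gamma>. \<forall>x\<in>A. \<gamma> x = \<sigma> x"
    and \<sigma>: "\<sigma> \<in> G" "\<And>\<tau>. \<tau> \<in> N \<Longrightarrow> \<sigma> \<circ> \<tau> \<in> N"
    and h: "\<And>\<gamma> \<delta>. \<gamma> \<in> N \<Longrightarrow> \<delta> \<in> N \<Longrightarrow> \<forall>x\<in>A. \<gamma> x = \<delta> x \<Longrightarrow> h \<gamma> = h \<delta>"
  shows "(\<Sum>\<gamma>\<in>\<Gamma>. h (\<sigma> \<circ> \<gamma>)) = (\<Sum>\<gamma>\<in>\<Gamma>. h \<gamma>)"
proof -
  have "\<exists>\<delta>. \<delta> \<in> \<Gamma> \<and> (\<forall>x\<in>A. \<delta> x = (\<sigma> \<circ> \<gamma>) x)" if "\<gamma> \<in> \<Gamma>" for \<gamma>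
    using \<Gamma>(4)[of "\<sigma> \<circ> \<gamma>"] \<sigma>(2)[of \<gamma>] \<Gamma>(2) that by blast
  then obtain t where t: "\<And>\<gamma>. \<gamma> \<in> \<Gamma> \<Longrightarrow> t \<gamma> \<in> \<Gamma>" "\<And>\<gamma>. \<gamma> \<in> \<Gamma> \<Longrightarrow> \<forall>x\<in>A. t \<gamma> x = (\<sigma> \<circ> \<gamma>) x"
    by metis
  have inj: "inj_on t \<Gamma>"
  proof (rule inj_onI)
    fix \<gamma> \<delta> assume gd: "\<gamma> \<in> \<Gamma>" "\<delta> \<in> \<Gamma>" "t \<gamma> = t \<delta>"
    then have "\<forall>x\<in>A. \<sigma> (\<gamma> x) = \<sigma> (\<delta> x)" using t(2)[of \<gamma>] t(2)[of \<delta>] by simp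
    then show "\<gamma> = \<delta>" using \<Gamma>(3)[OF gd(1,2)] abs_Gal_inj[OF \<sigma>(1)] by blast
  qed
  have "t ` \<Gamma> \<subseteq> \<Gamma>" using t(1) by blast
  then have bij: "bij_betw t \<Gamma> \<Gamma>" using inj endo_inj_surj[OF \<Gamma>(1)] by (auto simp: bij_betw_def)
  have "(\<Sum>\<gamma>\<in>\<Gamma>. h (\<sigma> \<circ> \<gamma>)) = (\<Sum>\<gamma>\<in>\<Gamma>. h (t \<gamma>))"
  proof (rule sum.cong)
    fix \<gamma> assume g: "\<gamma> \<in> \<Gamma>"
    then have "\<gamma> \<in> N" "t \<gamma> \<in> N" using t(1)[OF g] \<Gamma>(2) by auto
    then show "h (\<sigma> \<circ> \<gamma>) = h (t \<gamma>)" using h[OF \<open>t \<gamma> \<in> N\<close> \<sigma>(2)] t(2)[OF g] by simp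
  qed simp
  also have "\<dots> = (\<Sum>\<gamma>\<in>\<Gamma>. h \<gamma>)" using sum.reindex_bij_betw[OF bij] .
  finally show ?thesis .
qed

end

lemma finite_orbit:
  assumes "is_separable_closure_of K"
  shows "finite {\<sigma> x | \<sigma>. \<sigma> \<in> carrier (abs_Gal K)}"
proof -
  obtain p where p: "\<forall>i. Polynomial.coeff p i \<in> K" "poly p x = 0" "p \<noteq> 0"
    by (rule algebraic_over_closure[OF assms, of x]) blast
  have "poly p (\<sigma> x) = 0" if "\<sigma> \<in> carrier (abs_Gal K)" for \<sigma>
    using abs_Gal_poly[OF that p(1), of x] p(2) abs_Gal_0[OF that] by simp
  then show ?thesis by (intro finite_subset[OF _ poly_roots_finite[OF p(3)]]) auto
qed

text \<open>The finite set of a basic neighbourhood is enlarged to the union of its Galois orbits,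
  which are finite because they consist of roots of polynomials over \<open>K\<close>.\<close>

lemma open_neighbourhood_orbit:
  assumes cl: "is_separable_closure_of K" and U: "openin (krull K) U" "id \<in> U"
  obtains A where "galois_orbit K A" "\<And>\<sigma>. \<sigma> \<in> carrier (abs_Gal K) \<Longrightarrow> \<forall>x\<in>A. \<sigma> x = x \<Longrightarrow> \<sigma> \<in> U"
proof -
  obtain B where B: "finite B" "\<forall>\<tau>\<in>carrier (abs_Gal K). (\<forall>x\<in>B. \<tau> x = id x) \<longrightarrow> \<tau> \<in> U"
    using U unfolding openin_krull_iff by blast
  define A where "A = (\<Union>b\<in>B. {\<sigma> b | \<sigma>. \<sigma> \<in> carrier (abs_Gal K)})"
  have "galois_orbit K A"
  proof
    show "finite A" unfolding A_def using B(1) finite_orbit[OF cl] by blast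
    fix \<sigma> x assume s: "\<sigma> \<in> carrier (abs_Gal K)" "x \<in> A"
    then obtain b \<tau> where b: "b \<in> B" "\<tau> \<in> carrier (abs_Gal K)" "x = \<tau> b" unfolding A_def by blast
    then have "\<sigma> x = (\<sigma> \<circ> \<tau>) b" by simp
    then show "\<sigma> x \<in> A" using b comp_in_abs_Gal[OF s(1) b(2)] unfolding A_def by blast
  qed
  moreover have "B \<subseteq> A" unfolding A_def by (auto intro!: bexI exI[of _ id])
  then have "\<sigma> \<in> U" if "\<sigma> \<in> carrier (abs_Gal K)" "\<forall>x\<in>A. \<sigma> x = x" for \<sigma>
    using B(2) that by (metis id_apply subsetD)
  ultimately show ?thesis using that by blast
qed

text \<open>If \<open>\<tau>\<close> were outside \<open>N\<close>, the classes of \<open>N\<close>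
  and of \<open>\<tau> N\<close> on \<open>A\<close> would be disjoint, and independence would give
  a \<open>y\<close> at which the sum over the former differs from the sum over the latter. The
  trace of \<open>y\<close> over \<open>N\<close> is then fixed by \<open>N\<close> and moved by
  \<open>\<tau>\<close>.\<close>

theorem fixed_field_open_subgroup:
  assumes cl: "is_separable_closure_of K" and N: "subgroup N (abs_Gal K)" "openin (krull K) N"
    and \<tau>: "\<tau> \<in> carrier (abs_Gal K)" "\<And>x. x \<in> fixed_field N \<Longrightarrow> \<tau> x = x"
  shows "\<tau> \<in> N"
proof (rule ccontr)
  assume "\<tau> \<notin> N"
  interpret N: subgroup N "abs_Gal K" by fact
  have idN: "id \<in> N" using N.one_closed by simp
  obtain A where A: "galois_orbit K A" "\<And>\<sigma>. \<sigma> \<in> carrier (abs_Gal K) \<Longrightarrow> \<forall>x\<in>A. \<sigma> x = x \<Longrightarrow> \<sigma> \<in> N"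
    using open_neighbourhood_orbit[OF cl N(2) idN] by blast
  interpret galois_orbit K A by fact
  have NG: "N \<subseteq> G" by (rule N.subset)
  have comp: "\<sigma> \<circ> \<rho> \<in> N" if "\<sigma> \<in> N" "\<rho> \<in> N" for \<sigma> \<rho> using N.m_closed[OF that] by simp
  have inv: "inv_into UNIV \<sigma> \<in> N" if "\<sigma> \<in> N" for \<sigma>
    using N.m_inv_closed[OF that] abs_Gal_inv[of \<sigma> K] that NG by auto
  obtain \<Gamma> where \<Gamma>: "finite \<Gamma>" "\<Gamma> \<subseteq> N" "\<And>\<gamma> \<delta>. \<gamma> \<in> \<Gamma> \<Longrightarrow> \<delta> \<in> \<Gamma> \<Longrightarrow> \<forall>x\<in>A. \<gamma> x = \<delta> x \<Longrightarrow> \<gamma> = \<delta>"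
    "\<And>\<sigma>. \<sigma> \<in> N \<Longrightarrow> \<exists>\<gamma>\<in>\<Gamma>. \<forall>x\<in>A. \<gamma> x = \<sigma> x"
    using representatives[OF NG] by blast
  define \<Gamma>' where "\<Gamma>' = (\<lambda>\<gamma>. \<tau> \<circ> \<gamma>) ` \<Gamma>"
  have inj\<tau>: "inj_on (\<lambda>\<gamma>. \<tau> \<circ> \<gamma>) \<Gamma>" by (auto simp: inj_on_def fun_eq_iff abs_Gal_inj[OF \<tau>(1)])
  \<comment> \<open>Agreement on \<open>A\<close> would put the inverse of \<open>\<gamma>\<close>
    times \<open>\<tau> \<circ> \<delta>\<close> into \<open>N\<close>, and with it
    \<open>\<tau>\<close>.\<close>
  have diff: "\<exists>x\<in>A. \<gamma> x \<noteq> (\<tau> \<circ> \<delta>) x" if "\<gamma> \<in> \<Gamma>" "\<delta> \<in> \<Gamma>" for \<gamma> \<delta>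
  proof (rule ccontr)
    assume "\<not> ?thesis"
    then have e: "\<forall>x\<in>A. (\<tau> \<circ> \<delta>) x = \<gamma> x" by simp
    have gd: "\<gamma> \<in> N" "\<delta> \<in> N" using that \<Gamma>(2) by auto
    have i: "inv_into UNIV \<gamma> (\<gamma> x) = x" "\<gamma> (inv_into UNIV \<gamma> x) = x" "\<delta> (inv_into UNIV \<delta> x) = x" for x
      using abs_Gal_bij[of \<gamma> K] abs_Gal_bij[of \<delta> K] gd NG by (auto simp: bij_is_inj bij_is_surj surj_f_inv_f)
    have "inv_into UNIV \<gamma> \<circ> (\<tau> \<circ> \<delta>) \<in> N"
      by (rule A(2)) (use e i gd NG \<tau>(1) in \<open>auto intro!: comp_in_abs_Gal inv_in_abs_Gal\<close>)
    from comp[OF gd(1) comp[OF this inv[OF gd(2)]]]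
    have "\<gamma> \<circ> (inv_into UNIV \<gamma> \<circ> (\<tau> \<circ> \<delta>) \<circ> inv_into UNIV \<delta>) \<in> N" .
    also have "\<gamma> \<circ> (inv_into UNIV \<gamma> \<circ> (\<tau> \<circ> \<delta>) \<circ> inv_into UNIV \<delta>) = \<tau>" by (auto simp: fun_eq_iff i)
    finally show False using \<open>\<tau> \<notin> N\<close> by blast
  qed
  have disj: "\<Gamma> \<inter> \<Gamma>' = {}" using diff unfolding \<Gamma>'_def by fastforce
  have sub: "\<Gamma> \<union> \<Gamma>' \<subseteq> G" using \<Gamma>(2) NG \<tau>(1) unfolding \<Gamma>'_def by (auto intro: comp_in_abs_Gal)
  \<comment> \<open>With these signs the combination is the trace over \<open>N\<close> minus its
    image under \<open>\<tau>\<close>.\<close>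
  define c :: "('a \<Rightarrow> 'a) \<Rightarrow> 'a" where "c \<gamma> = (if \<gamma> \<in> \<Gamma> then 1 else - 1)" for \<gamma>
  have "\<exists>y\<in>L. (\<Sum>\<gamma>\<in>\<Gamma> \<union> \<Gamma>'. c \<gamma> * \<gamma> y) \<noteq> 0"
  proof (rule ccontr)
    assume "\<not> ?thesis"
    then have "\<forall>y\<in>L. (\<Sum>\<gamma>\<in>\<Gamma> \<union> \<Gamma>'. c \<gamma> * \<gamma> y) = 0" by blast
    moreover have "\<exists>x\<in>L. \<gamma> x \<noteq> \<delta> x" if gd: "\<gamma> \<in> \<Gamma> \<union> \<Gamma>'" "\<delta> \<in> \<Gamma> \<union> \<Gamma>'" "\<gamma> \<noteq> \<delta>" for \<gamma> \<delta>
    proof -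
      have "\<exists>x\<in>A. \<gamma> x \<noteq> \<delta> x"
      proof -
        consider "\<gamma> \<in> \<Gamma>" "\<delta> \<in> \<Gamma>" | \<delta>' where "\<gamma> \<in> \<Gamma>" "\<delta>' \<in> \<Gamma>" "\<delta> = \<tau> \<circ> \<delta>'" | \<gamma>' where "\<delta> \<in> \<Gamma>" "\<gamma>' \<in> \<Gamma>" "\<gamma> = \<tau> \<circ> \<gamma>'"
          | \<gamma>' \<delta>' where "\<gamma>' \<in> \<Gamma>" "\<delta>' \<in> \<Gamma>" "\<gamma> = \<tau> \<circ> \<gamma>'" "\<delta> = \<tau> \<circ> \<delta>'"
          using gd(1,2) unfolding \<Gamma>'_def by blast
        then show ?thesis
        proof cases
          case 1
          then show ?thesis using \<Gamma>(3) gd(3) by blast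
        next
          case 2
          then show ?thesis using diff by blast
        next
          case 3
          then show ?thesis using diff by metis
        next
          case 4
          then have "\<gamma>' \<noteq> \<delta>'" using gd(3) by blast
          then have "\<exists>x\<in>A. \<gamma>' x \<noteq> \<delta>' x" using \<Gamma>(3) 4(1,2) by blast
          then show ?thesis unfolding 4(3,4) using abs_Gal_inj[OF \<tau>(1)] by simp
        qed
      qed
      then show ?thesis using A_L by blast
    qed
    moreover have "\<gamma> 1 = 1 \<and> (\<forall>x\<in>L. \<forall>y\<in>L. \<gamma> (x * y) = \<gamma> x * \<gamma> y)" if "\<gamma> \<in> \<Gamma> \<union> \<Gamma>'" for \<gamma>
      using sub that abs_Gal_1 abs_Gal_mult by blast
    moreover have "finite (\<Gamma> \<union> \<Gamma>')" using \<Gamma>(1) by (simp add: \<Gamma>'_def)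
    ultimately have "\<forall>\<gamma>\<in>\<Gamma> \<union> \<Gamma>'. c \<gamma> = 0"
      by (intro dedekind_independence[where L = L] L_1 L_mult) blast+
    moreover obtain \<gamma> where "\<gamma> \<in> \<Gamma>" using \<Gamma>(4)[OF idN] by blast
    moreover from this have "c \<gamma> = 1" by (simp add: c_def)
    ultimately show False by (metis UnI1 zero_neq_one)
  qed
  then obtain y where y: "y \<in> L" "(\<Sum>\<gamma>\<in>\<Gamma> \<union> \<Gamma>'. c \<gamma> * \<gamma> y) \<noteq> 0" by blast
  define x where "x = (\<Sum>\<gamma>\<in>\<Gamma>. \<gamma> y)"
  have "\<tau> x = (\<Sum>\<gamma>\<in>\<Gamma>'. \<gamma> y)"
    unfolding x_def \<Gamma>'_def abs_Gal_sum[OF \<tau>(1)] sum.reindex[OF inj\<tau>] by simp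
  moreover have "(\<Sum>\<gamma>\<in>\<Gamma> \<union> \<Gamma>'. c \<gamma> * \<gamma> y) = x - (\<Sum>\<gamma>\<in>\<Gamma>'. \<gamma> y)"
  proof -
    have "(\<Sum>\<gamma>\<in>\<Gamma> \<union> \<Gamma>'. c \<gamma> * \<gamma> y) = (\<Sum>\<gamma>\<in>\<Gamma>. c \<gamma> * \<gamma> y) + (\<Sum>\<gamma>\<in>\<Gamma>'. c \<gamma> * \<gamma> y)"
      by (rule sum.union_disjoint) (use \<Gamma>(1) disj in \<open>auto simp: \<Gamma>'_def\<close>)
    also have "(\<Sum>\<gamma>\<in>\<Gamma>. c \<gamma> * \<gamma> y) = x" unfolding x_def c_def by simp
    also have "(\<Sum>\<gamma>\<in>\<Gamma>'. c \<gamma> * \<gamma> y) = (\<Sum>\<gamma>\<in>\<Gamma>'. - \<gamma> y)" by (rule sum.cong) (use disj in \<open>auto simp: c_def\<close>)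
    finally show ?thesis by (simp add: sum_negf)
  qed
  ultimately have "\<tau> x \<noteq> x" using y(2) by auto
  moreover have "x \<in> fixed_field N" unfolding fixed_field_def
  proof (intro CollectI ballI)
    fix \<sigma> assume s: "\<sigma> \<in> N"
    then have sG: "\<sigma> \<in> G" using NG by blast
    have "\<sigma> x = (\<Sum>\<gamma>\<in>\<Gamma>. (\<sigma> \<circ> \<gamma>) y)" unfolding x_def abs_Gal_sum[OF sG] by simp
    also have "\<dots> = (\<Sum>\<gamma>\<in>\<Gamma>. \<gamma> y)"
      by (rule sum_reindex_translate[OF NG \<Gamma> sG, where h = "\<lambda>\<gamma>. \<gamma> y"]) (use s comp NG y(1) agree_L in auto)
    finally show "\<sigma> x = x" unfolding x_def .
  qed
  ultimately show False using \<tau>(2) by blast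
qed

text \<open>Kummer theory in degree two. The Lagrange resolvent, the sum of the
  \<open>\<gamma> y\<close> with the signs prescribed by the character, is an eigenvector for every
  automorphism; independence provides a \<open>y\<close> for which it is non-zero.\<close>

theorem quadratic_character_root:
  assumes cl: "is_separable_closure_of K"
    and cont: "continuous_map (krull K) (discrete_topology UNIV) ch"
    and hom: "\<And>\<sigma> \<tau>. \<sigma> \<in> carrier (abs_Gal K) \<Longrightarrow> \<tau> \<in> carrier (abs_Gal K) \<Longrightarrow> ch (\<sigma> \<circ> \<tau>) = ch \<sigma> + (ch \<tau> :: bit)"
  shows "\<exists>x. x \<noteq> 0 \<and> x\<^sup>2 \<in> K \<and> (\<forall>\<sigma>\<in>carrier (abs_Gal K). \<sigma> x = (if ch \<sigma> = 0 then x else - x))"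
proof -
  have chi_id: "ch id = 0" using hom[of id id] by simp
  define U where "U = {\<sigma> \<in> carrier (abs_Gal K). ch \<sigma> = 0}"
  have "openin (krull K) U" using cont unfolding continuous_krull_discrete U_def by blast
  moreover have "id \<in> U" using chi_id by (simp add: U_def)
  ultimately obtain A where A': "galois_orbit K A" "\<And>\<sigma>. \<sigma> \<in> carrier (abs_Gal K) \<Longrightarrow> \<forall>x\<in>A. \<sigma> x = x \<Longrightarrow> \<sigma> \<in> U"
    using open_neighbourhood_orbit[OF cl] by blast
  have A: "galois_orbit K A" "\<And>\<sigma>. \<sigma> \<in> carrier (abs_Gal K) \<Longrightarrow> \<forall>x\<in>A. \<sigma> x = x \<Longrightarrow> ch \<sigma> = 0"
    using A' unfolding U_def by auto
  interpret galois_orbit K A by fact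
  obtain \<Gamma> where \<Gamma>: "finite \<Gamma>" "\<Gamma> \<subseteq> G" "\<And>\<gamma> \<delta>. \<gamma> \<in> \<Gamma> \<Longrightarrow> \<delta> \<in> \<Gamma> \<Longrightarrow> \<forall>x\<in>A. \<gamma> x = \<delta> x \<Longrightarrow> \<gamma> = \<delta>"
    "\<And>\<sigma>. \<sigma> \<in> G \<Longrightarrow> \<exists>\<gamma>\<in>\<Gamma>. \<forall>x\<in>A. \<gamma> x = \<sigma> x"
    using representatives[of G] by blast
  \<comment> \<open>The sign turns the additive values of the character into multiplicative
    ones.\<close>
  define s :: "bit \<Rightarrow> 'a" where "s b = (if b = 0 then 1 else - 1)" for b
  have s_add: "s (a + b) = s a * s b" for a b unfolding s_def by (cases a; cases b) auto
  have s2: "s b * s b = 1" for b by (simp add: s_def)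
  \<comment> \<open>The kernel contains the pointwise stabiliser of \<open>A\<close>, so the
    character depends on the action on \<open>A\<close> only.\<close>
  have chi_agree: "ch \<gamma> = ch \<delta>" if gd: "\<gamma> \<in> G" "\<delta> \<in> G" "\<forall>x\<in>A. \<gamma> x = \<delta> x" for \<gamma> \<delta>
  proof -
    have i: "inv_into UNIV \<delta> (\<delta> x) = x" "\<delta> (inv_into UNIV \<delta> x) = x" for x
      using abs_Gal_bij[OF gd(2)] by (auto simp: bij_is_inj bij_is_surj surj_f_inv_f)
    have G: "inv_into UNIV \<delta> \<circ> \<gamma> \<in> G" by (intro comp_in_abs_Gal inv_in_abs_Gal gd)
    then have "ch (inv_into UNIV \<delta> \<circ> \<gamma>) = 0" by (rule A(2)) (use gd(3) i in simp)
    moreover have "\<delta> \<circ> (inv_into UNIV \<delta> \<circ> \<gamma>) = \<gamma>" by (auto simp: fun_eq_iff i)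
    ultimately show ?thesis using hom[OF gd(2) G] by simp
  qed
  have "\<exists>y\<in>L. (\<Sum>\<gamma>\<in>\<Gamma>. s (ch \<gamma>) * \<gamma> y) \<noteq> 0"
  proof (rule ccontr)
    assume "\<not> ?thesis"
    then have "\<forall>y\<in>L. (\<Sum>\<gamma>\<in>\<Gamma>. s (ch \<gamma>) * \<gamma> y) = 0" by blast
    moreover have "\<exists>x\<in>L. \<gamma> x \<noteq> \<delta> x" if "\<gamma> \<in> \<Gamma>" "\<delta> \<in> \<Gamma>" "\<gamma> \<noteq> \<delta>" for \<gamma> \<delta>
      using \<Gamma>(3) A_L that by blast
    moreover have "\<gamma> 1 = 1 \<and> (\<forall>x\<in>L. \<forall>y\<in>L. \<gamma> (x * y) = \<gamma> x * \<gamma> y)" if "\<gamma> \<in> \<Gamma>" for \<gamma>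
      using \<Gamma>(2) that abs_Gal_1 abs_Gal_mult by blast
    ultimately have "\<forall>\<gamma>\<in>\<Gamma>. s (ch \<gamma>) = 0"
      using \<Gamma>(1) by (intro dedekind_independence[where L = L] L_1 L_mult) blast+
    moreover obtain \<gamma> where "\<gamma> \<in> \<Gamma>" using \<Gamma>(4)[OF id_in_abs_Gal] by blast
    moreover have "s (ch \<gamma>) \<noteq> 0" by (simp add: s_def)
    ultimately show False by blast
  qed
  then obtain y where y: "y \<in> L" "(\<Sum>\<gamma>\<in>\<Gamma>. s (ch \<gamma>) * \<gamma> y) \<noteq> 0" by blast
  define x where "x = (\<Sum>\<gamma>\<in>\<Gamma>. s (ch \<gamma>) * \<gamma> y)"
  have x: "\<sigma> x = s (ch \<sigma>) * x" if sG: "\<sigma> \<in> G" for \<sigma>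
  proof -
    have s_fix: "\<sigma> (s b) = s b" for b unfolding s_def by (simp add: abs_Gal_1[OF sG] abs_Gal_uminus[OF sG])
    have "\<sigma> x = (\<Sum>\<gamma>\<in>\<Gamma>. s (ch \<gamma>) * (\<sigma> \<circ> \<gamma>) y)" unfolding x_def abs_Gal_sum[OF sG] abs_Gal_mult[OF sG] s_fix by simp
    also have "\<dots> = (\<Sum>\<gamma>\<in>\<Gamma>. s (ch \<sigma>) * (s (ch (\<sigma> \<circ> \<gamma>)) * (\<sigma> \<circ> \<gamma>) y))"
    proof (rule sum.cong)
      fix \<gamma> assume "\<gamma> \<in> \<Gamma>"
      then have "ch (\<sigma> \<circ> \<gamma>) = ch \<sigma> + ch \<gamma>" using \<Gamma>(2) hom sG by blast
      then have "s (ch (\<sigma> \<circ> \<gamma>)) = s (ch \<sigma>) * s (ch \<gamma>)" by (simp only: s_add)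
      then show "s (ch \<gamma>) * (\<sigma> \<circ> \<gamma>) y = s (ch \<sigma>) * (s (ch (\<sigma> \<circ> \<gamma>)) * (\<sigma> \<circ> \<gamma>) y)"
        by (simp only: mult.assoc[symmetric] s2 mult_1_left)
    qed simp
    also have "\<dots> = s (ch \<sigma>) * (\<Sum>\<gamma>\<in>\<Gamma>. s (ch (\<sigma> \<circ> \<gamma>)) * (\<sigma> \<circ> \<gamma>) y)" by (simp add: sum_distrib_left)
    also have "(\<Sum>\<gamma>\<in>\<Gamma>. s (ch (\<sigma> \<circ> \<gamma>)) * (\<sigma> \<circ> \<gamma>) y) = (\<Sum>\<gamma>\<in>\<Gamma>. s (ch \<gamma>) * \<gamma> y)"
    proof (rule sum_reindex_translate[OF order.refl \<Gamma> sG, where h = "\<lambda>\<gamma>. s (ch \<gamma>) * \<gamma> y"])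
      show "\<sigma> \<circ> \<tau> \<in> G" if "\<tau> \<in> G" for \<tau> using comp_in_abs_Gal[OF sG that] .
      show "s (ch \<gamma>) * \<gamma> y = s (ch \<delta>) * \<delta> y" if "\<gamma> \<in> G" "\<delta> \<in> G" "\<forall>x\<in>A. \<gamma> x = \<delta> x" for \<gamma> \<delta>
        using chi_agree[OF that] agree_L[OF that y(1)] by simp
    qed
    finally show ?thesis unfolding x_def .
  qed
  \<comment> \<open>The signs square to \<open>1\<close>, so the square is fixed by the whole group
    and hence lies in \<open>K\<close>.\<close>
  have "\<sigma> (x\<^sup>2) = x\<^sup>2" if "\<sigma> \<in> G" for \<sigma>
    using x[OF that] s2[of "ch \<sigma>"] abs_Gal_power[OF that, of x 2] by (simp add: power2_eq_square algebra_simps mult.assoc[symmetric])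
  then have "x\<^sup>2 \<in> K" using abs_Gal_moves[OF cl] by blast
  moreover have "x \<noteq> 0" using y(2) unfolding x_def .
  moreover have "\<forall>\<sigma>\<in>G. \<sigma> x = (if ch \<sigma> = 0 then x else - x)"
  proof
    fix \<sigma> assume "\<sigma> \<in> G"
    from x[OF this] show "\<sigma> x = (if ch \<sigma> = 0 then x else - x)" by (simp add: s_def split: if_splits)
  qed
  ultimately show ?thesis by blast
qed

subsection \<open>Integral elements\<close>

definition ring_set :: "'c::field set \<Rightarrow> bool" where
  "ring_set R \<longleftrightarrow> 1 \<in> R \<and> - 1 \<in> R \<and> (\<forall>x\<in>R. \<forall>y\<in>R. x + y \<in> R \<and> x * y \<in> R)"

definition integral_over :: "'c::field set \<Rightarrow> 'c \<Rightarrow> bool" where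
  "integral_over R x \<longleftrightarrow> (\<exists>p. Polynomial.lead_coeff p = 1 \<and> (\<forall>i. Polynomial.coeff p i \<in> R) \<and> poly p x = 0)"

definition span_over :: "'c::field set \<Rightarrow> ('i \<Rightarrow> 'c) \<Rightarrow> 'i set \<Rightarrow> 'c set" where
  "span_over R v I = {\<Sum>i\<in>I. c i * v i | c. \<forall>i\<in>I. c i \<in> R}"

lemma span_overI: "(\<And>i. i \<in> I \<Longrightarrow> c i \<in> R) \<Longrightarrow> x = (\<Sum>i\<in>I. c i * v i) \<Longrightarrow> x \<in> span_over R v I"
  unfolding span_over_def by blast

section \<open>Rings as sets and the modules they span\<close>

context
  fixes R :: "'c::field set"
  assumes R: "ring_set R"
begin

lemma ring_setD: "1 \<in> R" "x \<in> R \<Longrightarrow> y \<in> R \<Longrightarrow> x + y \<in> R" "x \<in> R \<Longrightarrow> y \<in> R \<Longrightarrow> x * y \<in> R"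
  "x \<in> R \<Longrightarrow> - x \<in> R" "0 \<in> R" "x \<in> R \<Longrightarrow> y \<in> R \<Longrightarrow> x - y \<in> R" "x \<in> R \<Longrightarrow> x ^ n \<in> R"
proof -
  have *: "1 \<in> R" "- 1 \<in> R" and add: "\<And>x y. x \<in> R \<Longrightarrow> y \<in> R \<Longrightarrow> x + y \<in> R"
    and mult: "\<And>x y. x \<in> R \<Longrightarrow> y \<in> R \<Longrightarrow> x * y \<in> R"
    using R by (auto simp: ring_set_def)
  show "1 \<in> R" by fact
  show m: "- x \<in> R" if "x \<in> R" for x using mult[OF *(2) that] by simp
  show "0 \<in> R" using add[OF *] by simp
  show "x + y \<in> R" if "x \<in> R" "y \<in> R" for x y using add that .
  show "x * y \<in> R" if "x \<in> R" "y \<in> R" for x y using mult that .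
  show "x - y \<in> R" if "x \<in> R" "y \<in> R" for x y using add[OF that(1) m[OF that(2)]] by simp
  show "x ^ n \<in> R" if "x \<in> R" for x n by (induction n) (auto intro: mult * that)
qed

lemma ring_set_sum: "(\<And>i. i \<in> A \<Longrightarrow> h i \<in> R) \<Longrightarrow> sum h A \<in> R"
  by (induction A rule: infinite_finite_induct) (auto intro: ring_setD)

lemma coeffs_in_mult:
  "\<forall>i. Polynomial.coeff p i \<in> R \<Longrightarrow> \<forall>i. Polynomial.coeff q i \<in> R \<Longrightarrow> \<forall>i. Polynomial.coeff (p * q) i \<in> R"
  by (auto simp: coeff_mult intro!: ring_set_sum ring_setD(3))

lemma coeffs_in_prod:
  "(\<And>a. a \<in> A \<Longrightarrow> \<forall>i. Polynomial.coeff (h a) i \<in> R) \<Longrightarrow> \<forall>i. Polynomial.coeff (prod h A) i \<in> R"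
proof (induction A rule: infinite_finite_induct)
  case (insert x F)
  then show ?case using coeffs_in_mult[of "h x" "prod h F"] by simp
qed (auto simp: coeff_1 ring_setD)

lemma span_over_subset: "(\<And>i. i \<in> I \<Longrightarrow> v i \<in> R) \<Longrightarrow> span_over R v I \<subseteq> R"
  unfolding span_over_def by (auto intro!: ring_set_sum ring_setD(3))

lemma span_over_0: "0 \<in> span_over R v I"
  by (rule span_overI[where c = "\<lambda>_. 0"]) (auto simp: ring_setD)

lemma span_over_add:
  assumes "x \<in> span_over R v I" "y \<in> span_over R v I"
  shows "x + y \<in> span_over R v I"
proof -
  obtain c d where cd: "\<forall>i\<in>I. c i \<in> R" "\<forall>i\<in>I. d i \<in> R" "x = (\<Sum>i\<in>I. c i * v i)" "y = (\<Sum>i\<in>I. d i * v i)"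
    using assms unfolding span_over_def by blast
  have "x + y = (\<Sum>i\<in>I. (c i + d i) * v i)" unfolding cd(3,4) by (simp add: sum.distrib algebra_simps)
  then show ?thesis by (rule span_overI[rotated]) (use cd(1,2) ring_setD(2) in auto)
qed

lemma span_over_smult:
  assumes "a \<in> R" "x \<in> span_over R v I"
  shows "a * x \<in> span_over R v I"
proof -
  obtain c where c: "\<forall>i\<in>I. c i \<in> R" "x = (\<Sum>i\<in>I. c i * v i)"
    using assms(2) unfolding span_over_def by blast
  have "a * x = (\<Sum>i\<in>I. (a * c i) * v i)" unfolding c(2) by (simp add: sum_distrib_left mult.assoc)
  then show ?thesis by (rule span_overI[rotated]) (use c(1) ring_setD(3)[OF assms(1)] in auto)
qed

lemma span_over_base:
  assumes "finite I" "i \<in> I"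
  shows "v i \<in> span_over R v I"
proof -
  have "(\<Sum>j\<in>I. (if j = i then 1 else 0) * v j) = (\<Sum>j\<in>I. if j = i then v j else 0)" by (rule sum.cong) auto
  also have "\<dots> = v i" using assms by (simp add: sum.delta)
  finally have "v i = (\<Sum>j\<in>I. (if j = i then 1 else 0) * v j)" by simp
  then show ?thesis by (rule span_overI[rotated]) (use ring_setD(1,5) in auto)
qed

lemma span_over_sum: "(\<And>a. a \<in> A \<Longrightarrow> h a \<in> span_over R v I) \<Longrightarrow> sum h A \<in> span_over R v I"
  by (induction A rule: infinite_finite_induct) (auto intro: span_over_0 span_over_add)

lemma span_over_stable:
  assumes "\<And>i. i \<in> I \<Longrightarrow> x * v i \<in> span_over R v I" "z \<in> span_over R v I"
  shows "x * z \<in> span_over R v I"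
proof -
  obtain c where c: "\<forall>i\<in>I. c i \<in> R" "z = (\<Sum>i\<in>I. c i * v i)"
    using assms(2) unfolding span_over_def by blast
  have "x * z = (\<Sum>i\<in>I. c i * (x * v i))" unfolding c(2) by (simp add: sum_distrib_left algebra_simps)
  also have "\<dots> \<in> span_over R v I" by (rule span_over_sum, rule span_over_smult) (use assms(1) c(1) in auto)
  finally show ?thesis .
qed

text \<open>Cayley--Hamilton: \<open>x\<close> is an eigenvalue of the matrix of multiplication by \<open>x\<close>.\<close>

lemma integral_over_eigenvalue:
  fixes v :: "nat \<Rightarrow> 'c"
  assumes st: "\<And>i. i < n \<Longrightarrow> x * v i \<in> span_over R v {..<n}" and nz: "\<exists>i<n. v i \<noteq> 0"
  shows "integral_over R x"
proof -
  have "\<exists>c. (\<forall>j<n. c j \<in> R) \<and> x * v i = (\<Sum>j<n. c j * v j)" if "i < n" for i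
    using st[OF that] unfolding span_over_def by auto
  then obtain a where a: "\<And>i j. i < n \<Longrightarrow> j < n \<Longrightarrow> a i j \<in> R" "\<And>i. i < n \<Longrightarrow> x * v i = (\<Sum>j<n. a i j * v j)"
    by metis
  define A where "A = Matrix.mat n n (\<lambda>(i, j). a i j)"
  define V where "V = Matrix.vec n v"
  have A: "A \<in> carrier_mat n n" by (simp add: A_def)
  have "A *\<^sub>v V = x \<cdot>\<^sub>v V"
  proof (rule eq_vecI)
    show "dim_vec (A *\<^sub>v V) = dim_vec (x \<cdot>\<^sub>v V)" by (simp add: A_def V_def)
    fix i assume "i < dim_vec (x \<cdot>\<^sub>v V)"
    then have i: "i < n" by (simp add: V_def)
    then have "(A *\<^sub>v V) $ i = (\<Sum>j<n. a i j * v j)"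
      by (simp add: A_def V_def scalar_prod_def atLeast0LessThan)
    then show "(A *\<^sub>v V) $ i = (x \<cdot>\<^sub>v V) $ i" using a(2)[OF i] i by (simp add: V_def)
  qed
  moreover have "V \<noteq> 0\<^sub>v n"
  proof
    assume "V = 0\<^sub>v n"
    then have "V $ i = 0" if "i < n" for i using that by simp
    then show False using nz by (auto simp: V_def)
  qed
  ultimately have "eigenvalue A x" unfolding eigenvalue_def eigenvector_def using A by (auto simp: V_def intro!: exI[of _ V])
  then have root: "poly (char_poly A) x = 0" using eigenvalue_root_char_poly[OF A] by simp
  have monic: "Polynomial.lead_coeff (char_poly A) = 1" using degree_monic_char_poly[OF A] by simp
  have C: "char_poly_matrix A \<in> carrier_mat n n" using A by simp
  have entry: "\<forall>k. Polynomial.coeff (char_poly_matrix A $$ (i, j)) k \<in> R" if "i < n" "j < n" for i j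
    using that a(1)[OF that] by (auto simp: char_poly_matrix_def A_def coeff_pCons ring_setD split: nat.splits)
  \<comment> \<open>The Leibniz formula writes the characteristic polynomial as a signed sum of
    products of entries, so its coefficients stay in \<open>R\<close>.\<close>
  have "\<forall>k. Polynomial.coeff (char_poly A) k \<in> R"
    unfolding char_poly_def det_def'[OF C] coeff_sum
  proof (intro allI ring_set_sum)
    fix k \<pi> assume "\<pi> \<in> {p. p permutes {0..<n}}"
    then have p: "\<pi> i < n" if "i < n" for i using that permutes_in_image[of \<pi> "{0..<n}" i] by auto
    have *: "\<forall>k. Polynomial.coeff (\<Prod>i = 0..<n. char_poly_matrix A $$ (i, \<pi> i)) k \<in> R"
      by (rule coeffs_in_prod) (use entry p in auto)
    show "Polynomial.coeff (signof \<pi> * (\<Prod>i = 0..<n. char_poly_matrix A $$ (i, \<pi> i))) k \<in> R"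
      using * by (cases "sign \<pi> = 1") (auto simp: sign_def ring_setD)
  qed
  then show ?thesis unfolding integral_over_def using monic root by blast
qed

text \<open>The index set is arbitrary because products of powers are naturally indexed by pairs; a
  bijection with an initial segment turns this into a statement on matrices.\<close>

lemma integral_over_stable:
  assumes "finite I" and st: "\<And>i. i \<in> I \<Longrightarrow> x * v i \<in> span_over R v I" and nz: "\<exists>i\<in>I. v i \<noteq> 0"
  shows "integral_over R x"
proof -
  obtain h where h: "bij_betw h {..<card I} I"
    using ex_bij_betw_nat_finite[OF assms(1)] by (auto simp: atLeast0LessThan)
  have "span_over R v I \<subseteq> span_over R (v \<circ> h) {..<card I}"
  proof
    fix z assume "z \<in> span_over R v I"
    then obtain c where c: "\<forall>i\<in>I. c i \<in> R" "z = (\<Sum>i\<in>I. c i * v i)" unfolding span_over_def by blast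
    have "z = (\<Sum>i<card I. (c \<circ> h) i * (v \<circ> h) i)"
      unfolding c(2) using sum.reindex_bij_betw[OF h, of "\<lambda>i. c i * v i"] by simp
    then show "z \<in> span_over R (v \<circ> h) {..<card I}"
      by (rule span_overI[rotated]) (use c(1) bij_betwE[OF h] in auto)
  qed
  moreover have "h i \<in> I" if "i < card I" for i using bij_betwE[OF h] that by auto
  ultimately have "x * (v \<circ> h) i \<in> span_over R (v \<circ> h) {..<card I}" if "i < card I" for i
    using st that by auto
  moreover have "\<exists>i<card I. (v \<circ> h) i \<noteq> 0"
  proof -
    obtain i where i: "i \<in> I" "v i \<noteq> 0" using nz by blast
    then obtain j where "j < card I" "i = h j" using h unfolding bij_betw_def by blast
    then show ?thesis using i(2) by auto
  qed
  ultimately show ?thesis by (rule integral_over_eigenvalue)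
qed

lemma integral_over_self: "x \<in> R \<Longrightarrow> integral_over R x"
  unfolding integral_over_def by (intro exI[of _ "[:- x, 1:]"]) (auto simp: coeff_pCons ring_setD split: nat.splits)

lemma integral_over_degree:
  assumes "integral_over R x"
  obtains m a where "m > 0" "\<And>i. a i \<in> R" "x ^ m = (\<Sum>i<m. a i * x ^ i)"
proof -
  obtain p where p: "Polynomial.lead_coeff p = 1" "\<forall>i. Polynomial.coeff p i \<in> R" "poly p x = 0"
    using assms unfolding integral_over_def by blast
  define m where "m = Polynomial.degree p"
  have "m > 0"
  proof (rule ccontr)
    assume "\<not> ?thesis"
    then obtain b where "p = [:b:]" unfolding m_def by (metis degree_eq_zeroE not_gr_zero)
    then show False using p by auto
  qed
  moreover have "(\<Sum>i<m. Polynomial.coeff p i * x ^ i) + x ^ m = 0"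
    using p(1,3) unfolding poly_altdef m_def[symmetric] by (simp add: lessThan_Suc_atMost[symmetric])
  then have "x ^ m = (\<Sum>i<m. - Polynomial.coeff p i * x ^ i)"
    by (simp add: sum_negf add_eq_0_iff)
  ultimately show ?thesis using that[of m "\<lambda>i. - Polynomial.coeff p i"] p(2) ring_setD(4) by blast
qed

text \<open>The products \<open>x ^ i * y ^ j\<close> below the degrees of the two integral
  equations span a module stable under multiplication by \<open>x\<close> and by \<open>y\<close>,
  hence under \<open>x + y\<close> and \<open>x * y\<close>.\<close>

lemma integral_over_binary:
  assumes "integral_over R x" "integral_over R y"
  shows "integral_over R (x + y) \<and> integral_over R (x * y)"
proof -
  obtain m a where a: "m > 0" "\<And>i. a i \<in> R" "x ^ m = (\<Sum>i<m. a i * x ^ i)" using integral_over_degree[OF assms(1)] by blast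
  obtain n b where b: "n > 0" "\<And>i. b i \<in> R" "y ^ n = (\<Sum>i<n. b i * y ^ i)" using integral_over_degree[OF assms(2)] by blast
  define I where "I = {..<m} \<times> {..<n}"
  define v where "v = (\<lambda>(i, j). x ^ i * y ^ j)"
  have fin: "finite I" by (simp add: I_def)
  have base: "x ^ i * y ^ j \<in> span_over R v I" if "i < m" "j < n" for i j
    using span_over_base[OF fin, of "(i, j)" v] that by (simp add: I_def v_def)
  have xs: "x * v k \<in> span_over R v I" if kI: "k \<in> I" for k
  proof -
    obtain i j where k: "k = (i, j)" "i < m" "j < n" using kI by (auto simp: I_def)
    show ?thesis
    proof (cases "Suc i < m")
      case True
      then show ?thesis using base[OF True k(3)] by (simp add: k v_def mult.assoc)
    next
      case False
      then have "Suc i = m" using k(2) by simp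
      then have "x * v k = x ^ m * y ^ j" by (simp add: k v_def flip: \<open>Suc i = m\<close>)
      also have "\<dots> = (\<Sum>i<m. a i * (x ^ i * y ^ j))" unfolding a(3) by (simp add: sum_distrib_right mult.assoc)
      also have "\<dots> \<in> span_over R v I" by (intro span_over_sum span_over_smult a(2) base) (use k in auto)
      finally show ?thesis .
    qed
  qed
  have ys: "y * v k \<in> span_over R v I" if kI: "k \<in> I" for k
  proof -
    obtain i j where k: "k = (i, j)" "i < m" "j < n" using kI by (auto simp: I_def)
    show ?thesis
    proof (cases "Suc j < n")
      case True
      then show ?thesis using base[OF k(2) True] by (simp add: k v_def mult.assoc mult.left_commute)
    next
      case False
      then have "Suc j = n" using k(3) by simp
      then have "y * v k = x ^ i * y ^ n" by (simp add: k v_def mult.left_commute flip: \<open>Suc j = n\<close>)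
      also have "\<dots> = (\<Sum>j<n. b j * (x ^ i * y ^ j))" unfolding b(3) by (simp add: sum_distrib_left mult.left_commute)
      also have "\<dots> \<in> span_over R v I" by (intro span_over_sum span_over_smult b(2) base) (use k in auto)
      finally show ?thesis .
    qed
  qed
  have nz: "\<exists>k\<in>I. v k \<noteq> 0" using a(1) b(1) by (intro bexI[of _ "(0, 0)"]) (auto simp: I_def v_def)
  have "(x + y) * v k \<in> span_over R v I" if "k \<in> I" for k
    using span_over_add[OF xs[OF that] ys[OF that]] by (simp add: distrib_right)
  moreover have "x * y * v k \<in> span_over R v I" if "k \<in> I" for k
    using span_over_stable[OF xs ys[OF that]] by (simp add: mult.assoc)
  ultimately show ?thesis using integral_over_stable[OF fin _ nz] by blast
qed

lemma ring_set_integral: "ring_set {x. integral_over R x}"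
  unfolding ring_set_def using integral_over_binary integral_over_self ring_setD(1,4) by auto

text \<open>The span of the powers below \<open>m\<close> is the ring generated by \<open>x\<close>
  over \<open>R\<close>. Being finitely generated as a module, it is finite modulo a uniformizer
  when the residue field is finite, and complete when \<open>R\<close> is.\<close>

lemma integral_adjoin:
  assumes "integral_over R x"
  obtains m where "m > 0" "\<And>n. x ^ n \<in> span_over R (\<lambda>i. x ^ i) {..<m}"
    "\<And>y z. y \<in> span_over R (\<lambda>i. x ^ i) {..<m} \<Longrightarrow> z \<in> span_over R (\<lambda>i. x ^ i) {..<m} \<Longrightarrow> y * z \<in> span_over R (\<lambda>i. x ^ i) {..<m}"
proof -
  obtain m a where a: "m > 0" "\<And>i. a i \<in> R" "x ^ m = (\<Sum>i<m. a i * x ^ i)" using integral_over_degree[OF assms] by blast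
  let ?S = "span_over R (\<lambda>i. x ^ i) {..<m}"
  have base: "x ^ i \<in> ?S" if "i < m" for i using span_over_base[of "{..<m}" i "\<lambda>i. x ^ i"] that by simp
  have xm: "x ^ m \<in> ?S" unfolding a(3) by (intro span_over_sum span_over_smult a(2) base) auto
  have st: "x * z \<in> ?S" if "z \<in> ?S" for z
  proof (rule span_over_stable[OF _ that])
    fix i assume "i \<in> {..<m}"
    then consider "Suc i < m" | "Suc i = m" by fastforce
    then show "x * x ^ i \<in> ?S" using base[of "Suc i"] xm by cases auto
  qed
  have pow: "x ^ n * z \<in> ?S" if "z \<in> ?S" for n z
    by (induction n) (use st that in \<open>auto simp: mult.assoc\<close>)
  have pow': "x ^ n \<in> ?S" for n using pow[OF base[OF a(1)]] by simp
  have "y * z \<in> ?S" if yz: "y \<in> ?S" "z \<in> ?S" for y z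
  proof -
    obtain c where c: "\<forall>i<m. c i \<in> R" "y = (\<Sum>i<m. c i * x ^ i)" using yz(1) unfolding span_over_def by auto
    have "y * z = (\<Sum>i<m. c i * (x ^ i * z))" unfolding c(2) by (simp add: sum_distrib_right mult.assoc)
    also have "\<dots> \<in> ?S" by (rule span_over_sum, rule span_over_smult) (use c(1) pow yz(2) in auto)
    finally show ?thesis .
  qed
  then show ?thesis using that[OF a(1) pow'] by blast
qed

end

subsection \<open>Complete discretely valued fields with finite residue field\<close>

text \<open>\<open>t\<close> is a uniformizer, and \<open>Rep\<close> meets every residue class, so
  that its finiteness expresses that of the residue field. The valuation axioms concern
  \<open>F\<close> alone.\<close>

locale complete_dvf =
  fixes F :: "'c::field set" and w :: "'c \<Rightarrow> int" and t :: 'c and Rep :: "'c set"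
  assumes cl: "is_separable_closure_of F" and w: "valuation_on F w"
    and t: "t \<in> F" "t \<noteq> 0" "w t = 1"
    and complete: "\<And>u :: nat \<Rightarrow> 'c. range u \<subseteq> F \<Longrightarrow> (\<forall>N. \<exists>M. \<forall>m\<ge>M. \<forall>n\<ge>M. val_ge w (u m - u n) N) \<Longrightarrow>
        (\<exists>y\<in>F. \<forall>N. \<exists>M. \<forall>n\<ge>M. val_ge w (u n - y) N)"
    and Rep: "finite Rep" "Rep \<subseteq> F" "\<And>r. r \<in> Rep \<Longrightarrow> val_ge w r 0"
      "\<And>y. y \<in> F \<Longrightarrow> val_ge w y 0 \<Longrightarrow> \<exists>r\<in>Rep. val_ge w (y - r) 1"
    and char: "Factorial_Ring.prime CHAR('c)"
begin

section \<open>The valuation ring and its integral closure\<close>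

lemma F: "subfield F type_ring"
  using cl by (simp add: is_separable_closure_of_def)

lemmas FD = subfieldD[OF F]

lemma w_mult: "x \<in> F \<Longrightarrow> y \<in> F \<Longrightarrow> x \<noteq> 0 \<Longrightarrow> y \<noteq> 0 \<Longrightarrow> w (x * y) = w x + w y"
  and w_add: "x \<in> F \<Longrightarrow> y \<in> F \<Longrightarrow> x \<noteq> 0 \<Longrightarrow> y \<noteq> 0 \<Longrightarrow> x + y \<noteq> 0 \<Longrightarrow> min (w x) (w y) \<le> w (x + y)"
  using w unfolding valuation_on_def by auto

lemma w_1: "w 1 = 0"
  using w_mult[of 1 1] FD(2) by simp

lemma w_uminus: assumes "x \<in> F" "x \<noteq> 0" shows "w (- x) = w x"
proof -
  have "w (- 1) = 0" using w_mult[of "- 1" "- 1"] FD(2,5) w_1 by auto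
  then show ?thesis using w_mult[of "- 1" x] FD(2,5) assms by simp
qed

lemma w_inverse: assumes "x \<in> F" "x \<noteq> 0" shows "w (inverse x) = - w x"
  using w_mult[of x "inverse x"] FD(6) assms w_1 by simp

lemma F_power: "x \<in> F \<Longrightarrow> x ^ n \<in> F"
  by (induction n) (auto intro: FD)

lemma F_sum: "(\<And>i. i \<in> A \<Longrightarrow> h i \<in> F) \<Longrightarrow> sum h A \<in> F"
  by (induction A rule: infinite_finite_induct) (auto intro: FD)

lemma w_power: "x \<in> F \<Longrightarrow> x \<noteq> 0 \<Longrightarrow> w (x ^ n) = int n * w x"
proof (induction n)
  case (Suc n)
  then show ?case using w_mult[OF Suc.prems(1) F_power[OF Suc.prems(1), of n]] by (simp add: algebra_simps)
qed (simp add: w_1)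

lemma val_ge_add: "x \<in> F \<Longrightarrow> y \<in> F \<Longrightarrow> val_ge w x n \<Longrightarrow> val_ge w y n \<Longrightarrow> val_ge w (x + y) n"
  using w_add[of x y] unfolding val_ge_def by fastforce

lemma val_ge_uminus: "x \<in> F \<Longrightarrow> val_ge w x n \<Longrightarrow> val_ge w (- x) n"
  using w_uminus[of x] unfolding val_ge_def by auto

lemma val_ge_mult: "x \<in> F \<Longrightarrow> y \<in> F \<Longrightarrow> val_ge w x m \<Longrightarrow> val_ge w y n \<Longrightarrow> val_ge w (x * y) (m + n)"
  using w_mult[of x y] unfolding val_ge_def by fastforce

lemma val_ge_sum: "(\<And>i. i \<in> A \<Longrightarrow> h i \<in> F \<and> val_ge w (h i) n) \<Longrightarrow> val_ge w (sum h A) n"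
proof (induction A rule: infinite_finite_induct)
  case (insert x A)
  then show ?case using val_ge_add[of "h x" "sum h A"] F_sum[of A h] by auto
qed (auto simp: val_ge_def)

definition OF where "OF = {x \<in> F. val_ge w x 0}"

lemma ring_OF: "ring_set OF"
  unfolding ring_set_def OF_def
  using FD val_ge_add val_ge_mult[of _ _ 0 0] w_uminus[of 1] by (auto simp: val_ge_def w_1)

lemmas OFD = ring_setD[OF ring_OF]

lemma OF_F: "x \<in> OF \<Longrightarrow> x \<in> F"
  by (simp add: OF_def)

lemma t_OF: "t \<in> OF"
  using t by (simp add: OF_def val_ge_def)

text \<open>Divisibility by a power of \<open>t\<close> still makes sense for integral elements of
  the separable closure, to which \<open>w\<close> is not extended; estimates there are phrased in
  this way.\<close>

lemma val_ge_iff_dvd: "x \<in> F \<Longrightarrow> val_ge w x (int k) \<longleftrightarrow> (\<exists>e\<in>OF. x = t ^ k * e)"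
proof
  assume x: "x \<in> F" "val_ge w x (int k)"
  have "w (inverse (t ^ k)) = - int k" using w_inverse[OF F_power[OF t(1)]] t w_power[OF t(1,2)] by simp
  then have "val_ge w (inverse (t ^ k)) (- int k)" by (simp add: val_ge_def)
  then have "val_ge w (inverse (t ^ k) * x) 0"
    using val_ge_mult[OF FD(6)[OF F_power[OF t(1), of k]] x(1) _ x(2)] by fastforce
  then have "inverse (t ^ k) * x \<in> OF" using FD(4)[OF FD(6)[OF F_power[OF t(1)]] x(1)] by (simp add: OF_def)
  moreover have "x = t ^ k * (inverse (t ^ k) * x)" using t(2) by simp
  ultimately show "\<exists>e\<in>OF. x = t ^ k * e" by blast
next
  assume "x \<in> F" "\<exists>e\<in>OF. x = t ^ k * e"
  then obtain e where e: "e \<in> F" "val_ge w e 0" "x = t ^ k * e" by (auto simp: OF_def)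
  have "val_ge w (t ^ k) (int k)" using w_power[OF t(1,2)] t(3) by (simp add: val_ge_def)
  then show "val_ge w x (int k)" using val_ge_mult[OF F_power[OF t(1)] e(1) _ e(2)] e(3) by fastforce
qed

abbreviation int_cl where "int_cl \<equiv> integral_over OF"

lemma local_integers_eq: "local_integers F w = {x. int_cl x}"
  unfolding local_integers_def integral_over_def OF_def by simp

lemmas int_cl_ring = ring_setD[OF ring_set_integral[OF ring_OF], simplified]

lemma int_cl_self: "x \<in> OF \<Longrightarrow> int_cl x"
  using integral_over_self[OF ring_OF] .

lemma int_cl_sum: "(\<And>i. i \<in> A \<Longrightarrow> int_cl (h i)) \<Longrightarrow> int_cl (sum h A)"
  using ring_set_sum[OF ring_set_integral[OF ring_OF], of A h] by simp

text \<open>In an integral equation for an element of negative valuation the top power would have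
  strictly smaller valuation than every other term.\<close>

lemma integrally_closed:
  assumes "x \<in> F" "int_cl x"
  shows "x \<in> OF"
proof (rule ccontr)
  assume "x \<notin> OF"
  then have x: "x \<noteq> 0" "w x < 0" using assms(1) by (auto simp: OF_def val_ge_def)
  obtain m a where a: "m > 0" "\<And>i. a i \<in> OF" "x ^ m = (\<Sum>i<m. a i * x ^ i)"
    using integral_over_degree[OF ring_OF assms(2)] by blast
  have "val_ge w (a i * x ^ i) (int (m - 1) * w x)" if "i < m" for i
  proof -
    have "val_ge w (x ^ i) (int i * w x)" using w_power[OF assms(1) x(1)] by (simp add: val_ge_def)
    then have "val_ge w (a i * x ^ i) (0 + int i * w x)"
      using a(2)[of i] by (intro val_ge_mult F_power assms(1)) (auto simp: OF_def)
    moreover have "int (m - 1) * w x \<le> int i * w x"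
      using x(2) that by (intro mult_right_mono_neg) auto
    ultimately show ?thesis by (auto simp: val_ge_def)
  qed
  then have "val_ge w (x ^ m) (int (m - 1) * w x)"
    unfolding a(3) using a(2) OF_F assms(1) by (intro val_ge_sum) (auto intro: FD F_power)
  then have "int (m - 1) * w x \<le> int m * w x"
    using w_power[OF assms(1) x(1)] x(1) by (simp add: val_ge_def)
  then show False using x(2) a(1) by (simp add: of_nat_diff algebra_simps)
qed

lemma t_inverse_not_integral: "\<not> int_cl (inverse t)"
proof
  assume "int_cl (inverse t)"
  then have "inverse t \<in> OF" using integrally_closed t FD(6) by blast
  then show False using w_inverse[OF t(1,2)] t by (simp add: OF_def val_ge_def)
qed

text \<open>The inverse of a non-zero \<open>z\<close> is a polynomial in \<open>z\<close>, and some
  power \<open>t ^ C\<close> clears the denominators of its coefficients. If \<open>z\<close> were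
  divisible by \<open>t ^ Suc C\<close>, the inverse of \<open>t\<close> would be integral.\<close>

lemma no_infinitely_divisible:
  assumes "\<And>k. \<exists>e. int_cl e \<and> z = t ^ k * e"
  shows "z = 0"
proof (rule ccontr)
  assume "z \<noteq> 0"
  obtain p where p: "\<forall>i. Polynomial.coeff p i \<in> F" "poly p z = 0" "p \<noteq> 0"
    by (rule algebraic_over_closure[OF cl, of z]) blast
  obtain q where q: "\<forall>i. Polynomial.coeff q i \<in> F" "poly q z * z = 1"
    using algebraic_inverse_poly[OF F p(1,3,2) \<open>z \<noteq> 0\<close>] by blast
  have iz: "int_cl z" using assms[of 0] by auto
  \<comment> \<open>The sum of the absolute values bounds each single valuation, which gives one
    exponent for all coefficients.\<close>
  define C where "C = nat (\<Sum>i\<le>Polynomial.degree q. \<bar>w (Polynomial.coeff q i)\<bar>)"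
  have C: "t ^ C * Polynomial.coeff q i \<in> OF" if i: "i \<le> Polynomial.degree q" for i
  proof (cases "Polynomial.coeff q i = 0")
    case True
    then show ?thesis using OFD(5) by simp
  next
    case False
    have "\<bar>w (Polynomial.coeff q i)\<bar> \<le> (\<Sum>i\<le>Polynomial.degree q. \<bar>w (Polynomial.coeff q i)\<bar>)"
      using i by (intro member_le_sum) auto
    then have "0 \<le> int C + w (Polynomial.coeff q i)" unfolding C_def by simp
    moreover have "w (t ^ C * Polynomial.coeff q i) = int C + w (Polynomial.coeff q i)"
      using w_mult[OF F_power[OF t(1)]] q(1) False t w_power[OF t(1,2)] by simp
    ultimately show ?thesis using q(1) t(1) by (auto simp: OF_def val_ge_def intro: FD F_power)
  qed
  have "t ^ C * poly q z = (\<Sum>i\<le>Polynomial.degree q. (t ^ C * Polynomial.coeff q i) * z ^ i)"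
    unfolding poly_altdef by (simp add: sum_distrib_left mult.assoc)
  also have "int_cl \<dots>" by (intro int_cl_sum int_cl_ring int_cl_self C iz) auto
  finally have *: "int_cl (t ^ C * poly q z)" .
  obtain e where e: "int_cl e" "z = t ^ Suc C * e" using assms by blast
  have "1 = (t ^ C * poly q z * e) * t" using q(2) unfolding e(2) by (simp add: algebra_simps)
  then have "inverse t = t ^ C * poly q z * e" using t(2) by (metis inverse_unique mult.commute)
  then show False using t_inverse_not_integral int_cl_ring(3)[OF * e(1)] by simp
qed

text \<open>The limit is described by its remainders: after \<open>K\<close> terms what is left is
  divisible by \<open>t ^ K\<close> in the valuation ring. This form survives the passage to modules
  over that ring.\<close>

lemma complete_series:
  assumes d: "\<And>k. d k \<in> OF"
  shows "\<exists>c\<in>OF. \<forall>K. \<exists>e\<in>OF. c - (\<Sum>k<K. t ^ k * d k) = t ^ K * e"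
proof -
  define u where "u n = (\<Sum>k<n. t ^ k * d k)" for n
  have uF: "u n \<in> F" for n unfolding u_def by (intro F_sum FD(4) F_power t(1) OF_F d)
  have diff: "val_ge w (u n - u m) (int K)" if "K \<le> m" "m \<le> n" for m n K
  proof -
    have "u n - u m = (\<Sum>k\<in>{m..<n}. t ^ k * d k)"
      unfolding u_def using that(2) sum_diff_nat_ivl[of 0 m n "\<lambda>k. t ^ k * d k"] by (simp add: atLeast0LessThan)
    also have "val_ge w \<dots> (int K)"
    proof (intro val_ge_sum conjI)
      fix k assume k: "k \<in> {m..<n}"
      show F': "t ^ k * d k \<in> F" by (intro FD(4) F_power t(1) OF_F d)
      have "t ^ k * d k = t ^ K * (t ^ (k - K) * d k)" using k that(1) by (simp add: mult.assoc[symmetric] power_add[symmetric])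
      then show "val_ge w (t ^ k * d k) (int K)" using val_ge_iff_dvd[OF F'] d t_OF by (blast intro: OFD)
    qed
    finally show ?thesis .
  qed
  have diff': "val_ge w (u n - u m) (int K)" if "K \<le> m" "K \<le> n" for m n K
  proof (cases "m \<le> n")
    case True
    then show ?thesis using diff that(1) by blast
  next
    case False
    then have "val_ge w (- (u m - u n)) (int K)" using that(2) by (intro val_ge_uminus FD(7) uF diff) auto
    then show ?thesis by simp
  qed
  have "\<forall>N. \<exists>M. \<forall>m\<ge>M. \<forall>n\<ge>M. val_ge w (u m - u n) N"
  proof
    fix N
    have "val_ge w (u m - u n) N" if "m \<ge> nat N" "n \<ge> nat N" for m n
    proof -
      have "val_ge w (u m - u n) (int (nat N))" using that by (rule diff'[rotated])
      moreover have "N \<le> int (nat N)" by simp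
      ultimately show ?thesis unfolding val_ge_def by linarith
    qed
    then show "\<exists>M. \<forall>m\<ge>M. \<forall>n\<ge>M. val_ge w (u m - u n) N" by blast
  qed
  moreover have "range u \<subseteq> F" using uF by blast
  ultimately obtain y where y: "y \<in> F" "\<forall>N. \<exists>M. \<forall>n\<ge>M. val_ge w (u n - y) N"
    using complete[of u] by blast
  have *: "\<exists>e\<in>OF. y - u K = t ^ K * e" for K
  proof -
    obtain M where M: "\<forall>n\<ge>M. val_ge w (u n - y) (int K)" using y(2) by blast
    define n where "n = max M K"
    have "val_ge w (- (u n - y)) (int K)" using M y(1) uF by (intro val_ge_uminus FD) (auto simp: n_def)
    then have "val_ge w (- (u n - y) + (u n - u K)) (int K)"
      using diff'[of K K n] uF y(1) by (intro val_ge_add FD) (auto simp: n_def)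
    then have "val_ge w (y - u K) (int K)" by simp
    then show ?thesis using val_ge_iff_dvd[of "y - u K" K] y(1) uF FD(7) by blast
  qed
  have "y \<in> OF" using *[of 0] by (auto simp: u_def)
  then show ?thesis using * unfolding u_def by blast
qed

text \<open>A finitely generated module over a complete ring is complete: once coefficients are
  chosen for every term, the series is summed in each coefficient separately.\<close>

lemma complete_series_span:
  assumes z: "\<And>k. z k \<in> span_over OF v {..<m::nat}"
  shows "\<exists>\<zeta>\<in>span_over OF v {..<m}. \<forall>K. \<exists>e\<in>span_over OF v {..<m}. \<zeta> - (\<Sum>k<K. t ^ k * z k) = t ^ K * e"
proof -
  have "\<exists>c. (\<forall>i<m. c i \<in> OF) \<and> z k = (\<Sum>i<m. c i * v i)" for k
    using z[of k] unfolding span_over_def by auto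
  then obtain d where d: "\<And>k i. i < m \<Longrightarrow> d k i \<in> OF" "\<And>k. z k = (\<Sum>i<m. d k i * v i)" by metis
  define d' where "d' i k = (if i < m then d k i else 0)" for i k
  have "\<exists>c\<in>OF. \<forall>K. \<exists>e\<in>OF. c - (\<Sum>k<K. t ^ k * d' i k) = t ^ K * e" for i
    by (rule complete_series) (auto simp: d'_def d OFD)
  then obtain c e where c: "\<And>i. c i \<in> OF" "\<And>i K. e i K \<in> OF" "\<And>i K. c i - (\<Sum>k<K. t ^ k * d' i k) = t ^ K * e i K"
    by metis
  define \<zeta> where "\<zeta> = (\<Sum>i<m. c i * v i)"
  have "\<zeta> - (\<Sum>k<K. t ^ k * z k) = t ^ K * (\<Sum>i<m. e i K * v i)" for K
  proof -
    have "(\<Sum>k<K. t ^ k * z k) = (\<Sum>k<K. \<Sum>i<m. t ^ k * d' i k * v i)"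
      unfolding d(2) d'_def by (simp add: sum_distrib_left mult.assoc)
    also have "\<dots> = (\<Sum>i<m. (\<Sum>k<K. t ^ k * d' i k) * v i)"
      by (subst sum.swap) (simp add: sum_distrib_right)
    finally have "\<zeta> - (\<Sum>k<K. t ^ k * z k) = (\<Sum>i<m. (c i - (\<Sum>k<K. t ^ k * d' i k)) * v i)"
      unfolding \<zeta>_def by (simp add: sum_subtractf left_diff_distrib)
    also have "\<dots> = t ^ K * (\<Sum>i<m. e i K * v i)" unfolding c(3) by (simp add: sum_distrib_left mult.assoc)
    finally show ?thesis .
  qed
  moreover have "(\<Sum>i<m. e i K * v i) \<in> span_over OF v {..<m}" for K
    by (rule span_overI[where c = "\<lambda>i. e i K"]) (auto simp: c)
  moreover have "\<zeta> \<in> span_over OF v {..<m}" unfolding \<zeta>_def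
    by (rule span_overI[where c = c]) (auto simp: c)
  ultimately show ?thesis by blast
qed

section \<open>Constants and Teichmueller representatives\<close>

lemma frob_add: "(x + y :: 'c) ^ (CHAR('c) ^ n) = x ^ (CHAR('c) ^ n) + y ^ (CHAR('c) ^ n)"
  using freshmans_dream'[OF char] by blast

lemma frob_diff: "(x - y :: 'c) ^ (CHAR('c) ^ n) = x ^ (CHAR('c) ^ n) - y ^ (CHAR('c) ^ n)"
  using frob_add[of "x - y" y n] by (simp add: algebra_simps)

text \<open>The union of all finite subfields, that is, the algebraic closure of the prime field
  inside the separable closure. These are its constants.\<close>

definition croots where "croots = {\<zeta> :: 'c. \<exists>n>0. \<zeta> ^ (CHAR('c) ^ n) = \<zeta>}"

text \<open>Membership in the maximal ideal of the integral closure, expressed without a valuation: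
  some power is divisible by \<open>t\<close>. Exponents that are powers of the characteristic
  suffice, and for them taking powers is additive.\<close>

definition nil where "nil z \<longleftrightarrow> int_cl z \<and> (\<exists>i e. int_cl e \<and> z ^ (CHAR('c) ^ i) = t * e)"

text \<open>Teichmueller representatives: the powers \<open>x ^ (p ^ i)\<close> become periodic modulo \<open>t\<close>,
  as \<open>OF[x] / t OF[x]\<close> is finite.\<close>

lemma teichmuller:
  assumes x: "int_cl x"
  shows "\<exists>\<eta>\<in>croots. nil (x - \<eta>) \<and> (x \<in> F \<longrightarrow> \<eta> \<in> F)"
proof -
  obtain m where m: "m > 0" "\<And>n. x ^ n \<in> span_over OF (\<lambda>i. x ^ i) {..<m}"
    "\<And>y z. y \<in> span_over OF (\<lambda>i. x ^ i) {..<m} \<Longrightarrow> z \<in> span_over OF (\<lambda>i. x ^ i) {..<m} \<Longrightarrow> y * z \<in> span_over OF (\<lambda>i. x ^ i) {..<m}"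
    using integral_adjoin[OF ring_OF x] by metis
  define S where "S = span_over OF (\<lambda>i. x ^ i) {..<m}"
  define p where "p = CHAR('c)"
  have p2: "p \<ge> 2" using char prime_ge_2_nat unfolding p_def by blast
  have S1: "1 \<in> S" using m(2)[of 0] by (simp add: S_def)
  have Smult: "\<And>y z. y \<in> S \<Longrightarrow> z \<in> S \<Longrightarrow> y * z \<in> S" using m(3) unfolding S_def by blast
  have Sadd: "\<And>y z. y \<in> S \<Longrightarrow> z \<in> S \<Longrightarrow> y + z \<in> S" unfolding S_def by (rule span_over_add[OF ring_OF])
  have Ssm: "\<And>a z. a \<in> OF \<Longrightarrow> z \<in> S \<Longrightarrow> a * z \<in> S" unfolding S_def by (rule span_over_smult[OF ring_OF])
  have Spow: "\<And>y n. y \<in> S \<Longrightarrow> y ^ n \<in> S"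
  proof -
    fix y n assume "y \<in> S" then show "y ^ n \<in> S" by (induction n) (auto intro: S1 Smult)
  qed
  have Suminus: "\<And>y. y \<in> S \<Longrightarrow> - y \<in> S" using Ssm[of "- 1"] OFD(1,4) by fastforce
  have S_int: "int_cl y" if "y \<in> S" for y
    using that span_over_subset[OF ring_set_integral[OF ring_OF], of "{..<m}" "\<lambda>i. x ^ i"] int_cl_self x int_cl_ring(7)
    unfolding S_def span_over_def by (auto intro!: int_cl_sum int_cl_ring)
  have S_F: "y \<in> F" if yx: "y \<in> S" "x \<in> F" for y
  proof -
    obtain c where c: "\<forall>i<m. c i \<in> OF" "y = (\<Sum>i<m. c i * x ^ i)" using yx(1) unfolding S_def span_over_def by auto
    show ?thesis unfolding c(2) by (intro F_sum FD(4) F_power yx(2)) (use c(1) OF_F in auto)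
  qed
  \<comment> \<open>Reduction modulo \<open>t\<close>: coefficients are replaced by members of
    \<open>Rep\<close>, so only finitely many remainders \<open>r\<close> occur.\<close>
  have red: "\<exists>r\<in>{..<m} \<rightarrow>\<^sub>E Rep. \<exists>z'\<in>S. z - (\<Sum>i<m. r i * x ^ i) = t * z'" if zin: "z \<in> S" for z
  proof -
    obtain c where c: "\<forall>i<m. c i \<in> OF" "z = (\<Sum>i<m. c i * x ^ i)" using zin unfolding S_def span_over_def by auto
    have "\<exists>r\<in>Rep. \<exists>e\<in>OF. c i - r = t * e" if "i < m" for i
    proof -
      have ci: "c i \<in> F" "val_ge w (c i) 0" using c(1) that by (auto simp: OF_def)
      then obtain r where r: "r \<in> Rep" "val_ge w (c i - r) (int 1)" using Rep(4) by force
      moreover have "c i - r \<in> F" using r(1) ci(1) Rep(2) FD(7) by blast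
      ultimately have "\<exists>e\<in>OF. c i - r = t * e" using val_ge_iff_dvd[of "c i - r" 1] by simp
      then show ?thesis using r(1) by blast
    qed
    then obtain r e where r: "\<And>i. i < m \<Longrightarrow> r i \<in> Rep" "\<And>i. i < m \<Longrightarrow> e i \<in> OF" "\<And>i. i < m \<Longrightarrow> c i - r i = t * e i" by metis
    define r' where "r' = restrict r {..<m}"
    have "z - (\<Sum>i<m. r' i * x ^ i) = (\<Sum>i<m. (c i - r i) * x ^ i)"
      unfolding c(2) by (simp add: r'_def sum_subtractf left_diff_distrib)
    also have "\<dots> = t * (\<Sum>i<m. e i * x ^ i)" using r(3) by (simp add: sum_distrib_left mult.assoc)
    finally have "z - (\<Sum>i<m. r' i * x ^ i) = t * (\<Sum>i<m. e i * x ^ i)" .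
    moreover have "(\<Sum>i<m. e i * x ^ i) \<in> S" unfolding S_def by (rule span_overI[where c = e]) (use r in auto)
    moreover have "r' \<in> {..<m} \<rightarrow>\<^sub>E Rep" using r(1) by (auto simp: r'_def)
    ultimately show ?thesis by blast
  qed
  have xS: "x ^ n \<in> S" for n using m(2) by (simp add: S_def)
  have "\<forall>i. \<exists>r. r \<in> {..<m} \<rightarrow>\<^sub>E Rep \<and> (\<exists>z'\<in>S. x ^ (p ^ i) - (\<Sum>l<m. r l * x ^ l) = t * z')"
    using red xS by blast
  then obtain r where r: "\<And>i. r i \<in> {..<m} \<rightarrow>\<^sub>E Rep" "\<And>i. \<exists>z'\<in>S. x ^ (p ^ i) - (\<Sum>l<m. r i l * x ^ l) = t * z'" by metis
  \<comment> \<open>Pigeonhole: two powers \<open>x ^ (p ^ i)\<close> and \<open>x ^ (p ^ j)\<close>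
    have the same remainder, so their difference is a multiple \<open>t * b\<close>.\<close>
  have "finite ({..<m} \<rightarrow>\<^sub>E Rep)" using Rep(1) by (intro finite_PiE) auto
  then have "finite (range r)" using r(1) by (meson finite_subset image_subsetI)
  then have "\<not> inj r" using finite_imageD infinite_UNIV_nat by blast
  then obtain i j where ij: "i < j" "r i = r j" unfolding inj_def by (metis linorder_neqE_nat)
  obtain z1 z2 where z12: "z1 \<in> S" "z2 \<in> S" "x ^ (p ^ i) - (\<Sum>l<m. r i l * x ^ l) = t * z1"
      "x ^ (p ^ j) - (\<Sum>l<m. r i l * x ^ l) = t * z2" using r(2)[of i] r(2)[of j] ij(2) by auto
  define b where "b = z2 - z1"
  have b: "b \<in> S" "x ^ (p ^ j) - x ^ (p ^ i) = t * b"
    using z12 Sadd[OF z12(2) Suminus[OF z12(1)]] by (auto simp: b_def algebra_simps)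
  define n where "n = j - i"
  have n: "n > 0" "j = i + n" using ij(1) by (auto simp: n_def)
  \<comment> \<open>Raising \<open>a\<close> to the power \<open>p ^ n\<close> moves it by a
    multiple of \<open>t\<close> only, so the sequence \<open>y\<close> of iterates converges; its
    limit is the representative of \<open>a\<close>.\<close>
  define a where "a = x ^ (p ^ i)"
  define y where "y k = a ^ (p ^ (n * k))" for k
  \<comment> \<open>The \<open>k\<close>-th difference of the sequence is \<open>t * b\<close> to
    the power \<open>p ^ (n * k)\<close>. The factor \<open>t ^ k\<close> is split off as the weight
    of a series; \<open>gek\<close> ensures that the subtraction in the exponent is genuine.\<close>
  define z where "z k = t ^ (p ^ (n * k) - k) * b ^ (p ^ (n * k))" for k
  have gek: "k \<le> p ^ (n * k)" for k
  proof -
    have "k < 2 ^ k" by (rule less_exp)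
    also have "\<dots> \<le> p ^ k" using p2 by (rule power_mono) simp
    also have "\<dots> \<le> p ^ (n * k)" using p2 n(1) by (intro power_increasing) auto
    finally show ?thesis by simp
  qed
  have step: "y (Suc k) - y k = t ^ k * z k" for k
  proof -
    have "y (Suc k) = (x ^ (p ^ j)) ^ (p ^ (n * k))"
      unfolding y_def a_def n(2) by (simp add: power_mult[symmetric] power_add algebra_simps)
    then have "y (Suc k) - y k = (x ^ (p ^ j) - x ^ (p ^ i)) ^ (p ^ (n * k))"
      unfolding y_def a_def p_def frob_diff by simp
    also have "\<dots> = t ^ (p ^ (n * k)) * b ^ (p ^ (n * k))" unfolding b(2) by (simp add: power_mult_distrib)
    also have "t ^ (p ^ (n * k)) = t ^ k * t ^ (p ^ (n * k) - k)" using gek[of k] by (simp add: power_add[symmetric])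
    finally show ?thesis by (simp add: z_def mult.assoc)
  qed
  have zS: "z k \<in> S" for k unfolding z_def by (intro Ssm Spow b(1) OFD(7) t_OF)
  have "\<exists>\<zeta>\<in>S. \<forall>K. \<exists>e\<in>S. \<zeta> - (\<Sum>k<K. t ^ k * z k) = t ^ K * e"
    using complete_series_span[of z "\<lambda>i. x ^ i" m] zS unfolding S_def by blast
  then obtain Z where Z: "Z \<in> S" "\<forall>K. \<exists>e\<in>S. Z - (\<Sum>k<K. t ^ k * z k) = t ^ K * e" by blast
  have tele: "(\<Sum>k<K. t ^ k * z k) = y K - y 0" for K
    by (induction K) (auto simp: step[symmetric])
  define \<zeta> where "\<zeta> = y 0 + Z"
  have aS: "a \<in> S" unfolding a_def by (rule xS)
  have y0: "y 0 = a" by (simp add: y_def)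
  have \<zeta>S: "\<zeta> \<in> S" unfolding \<zeta>_def y0 using Z(1) aS Sadd by blast
  have approx: "\<exists>e\<in>S. \<zeta> - y K = t ^ K * e" for K
    using Z(2)[rule_format, of K] unfolding tele \<zeta>_def by (simp add: algebra_simps)
  \<comment> \<open>The limit is exactly periodic, because the error is divisible by every power of
    \<open>t\<close>.\<close>
  have per: "\<zeta> ^ (p ^ n) = \<zeta>"
  proof -
    have "\<exists>e. int_cl e \<and> \<zeta> ^ (p ^ n) - \<zeta> = t ^ K * e" for K
    proof -
      obtain e1 where e1: "e1 \<in> S" "\<zeta> - y K = t ^ K * e1" using approx by blast
      obtain e2 where e2: "e2 \<in> S" "\<zeta> - y (Suc K) = t ^ Suc K * e2" using approx by blast
      have "\<zeta> ^ (p ^ n) - y K ^ (p ^ n) = (t ^ K * e1) ^ (p ^ n)"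
        unfolding e1(2)[symmetric] p_def frob_diff ..
      moreover have "y K ^ (p ^ n) = y (Suc K)" unfolding y_def by (simp add: power_mult[symmetric] power_add algebra_simps)
      ultimately have "\<zeta> ^ (p ^ n) - \<zeta> = (t ^ K * e1) ^ (p ^ n) - t ^ Suc K * e2"
        using e2(2) by (simp add: algebra_simps)
      also have "(t ^ K * e1) ^ (p ^ n) = t ^ K * (e1 * (t ^ K * e1) ^ (p ^ n - 1))"
        using p2 by (cases "p ^ n") (auto simp: mult.assoc)
      finally have eq: "\<zeta> ^ (p ^ n) - \<zeta> = t ^ K * (e1 * (t ^ K * e1) ^ (p ^ n - 1) - t * e2)"
        by (simp add: algebra_simps)
      have "int_cl (e1 * (t ^ K * e1) ^ (p ^ n - 1) - t * e2)"
        using S_int[OF e1(1)] S_int[OF e2(1)] int_cl_self[OF t_OF] by (intro int_cl_ring)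
      then show ?thesis using eq by blast
    qed
    then have "\<zeta> ^ (p ^ n) - \<zeta> = 0" by (rule no_infinitely_divisible)
    then show ?thesis by simp
  qed
  have per': "\<zeta> ^ (p ^ (n * k)) = \<zeta>" for k
  proof (induction k)
    case (Suc k)
    have "\<zeta> ^ (p ^ (n * Suc k)) = (\<zeta> ^ (p ^ n)) ^ (p ^ (n * k))" by (simp add: power_mult[symmetric] power_add)
    then show ?case using per Suc by simp
  qed simp
  \<comment> \<open>\<open>\<zeta>\<close> represents \<open>x ^ (p ^ i)\<close> rather than
    \<open>x\<close>. Since \<open>\<zeta>\<close> is periodic, a root of order \<open>p ^ i\<close>
    is found among its own powers.\<close>
  define \<eta> where "\<eta> = \<zeta> ^ (p ^ (n * i - i))"
  have ni: "i \<le> n * i" using n(1) by simp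
  have \<eta>i: "\<eta> ^ (p ^ i) = \<zeta>"
    unfolding \<eta>_def power_mult[symmetric] power_add[symmetric] using ni per'[of i] by simp
  have "\<eta> ^ (p ^ n) = (\<zeta> ^ (p ^ n)) ^ (p ^ (n * i - i))"
    unfolding \<eta>_def by (simp add: power_mult[symmetric] mult.commute)
  then have "\<eta> ^ (p ^ n) = \<eta>" unfolding per by (simp add: \<eta>_def)
  then have "\<eta> \<in> croots" unfolding croots_def using n(1) p_def by blast
  moreover have "nil (x - \<eta>)"
  proof -
    obtain e where e: "e \<in> S" "\<zeta> - y 1 = t * e" using approx[of 1] by auto
    \<comment> \<open>Congruence modulo \<open>t\<close> is visible only after raising to the power
      \<open>p ^ i\<close>; hence the exponent in the definition of \<open>nil\<close>.\<close>
    have "(x - \<eta>) ^ (p ^ i) = a - \<zeta>" unfolding p_def frob_diff using \<eta>i by (simp add: a_def p_def)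
    also have "\<dots> = t * (- e - b)" using e(2) step[of 0] y0 by (simp add: z_def algebra_simps)
    finally have "(x - \<eta>) ^ (p ^ i) = t * (- e - b)" .
    moreover have "int_cl (- e - b)" using S_int[OF e(1)] S_int[OF b(1)] by (intro int_cl_ring)
    moreover have "int_cl (x - \<eta>)" unfolding \<eta>_def using x S_int[OF \<zeta>S] by (intro int_cl_ring)
    ultimately show ?thesis unfolding nil_def p_def by blast
  qed
  moreover have "\<eta> \<in> F" if "x \<in> F" unfolding \<eta>_def using S_F[OF \<zeta>S that] by (rule F_power)
  ultimately show ?thesis by blast
qed

lemma pge2: "CHAR('c) \<ge> 2"
  using char prime_ge_2_nat by blast

lemma croots_period:
  assumes "\<zeta> ^ (CHAR('c) ^ n) = (\<zeta> :: 'c)"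
  shows "\<zeta> ^ (CHAR('c) ^ (n * k)) = \<zeta>"
proof (induction k)
  case (Suc k)
  have "\<zeta> ^ (CHAR('c) ^ (n * Suc k)) = (\<zeta> ^ (CHAR('c) ^ n)) ^ (CHAR('c) ^ (n * k))"
    by (simp only: mult_Suc_right power_add power_mult)
  then show ?case using assms Suc by simp
qed simp

lemma croots_common:
  assumes "x \<in> croots" "y \<in> croots"
  obtains n where "n > 0" "x ^ (CHAR('c) ^ n) = x" "y ^ (CHAR('c) ^ n) = y"
proof -
  obtain m n where mn: "m > 0" "n > 0" "x ^ (CHAR('c) ^ m) = x" "y ^ (CHAR('c) ^ n) = y"
    using assms unfolding croots_def by blast
  show ?thesis using that[of "m * n"] mn croots_period[OF mn(3), of n] croots_period[OF mn(4), of m]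
    by (simp add: mult.commute)
qed

lemma subfield_croots: "subfield croots type_ring"
  unfolding subfield_type_ring_iff
proof (intro conjI ballI)
  show "1 \<in> croots" unfolding croots_def by (auto intro!: exI[of _ 1])
  fix x assume x: "x \<in> croots"
  then obtain n where n: "n > 0" "x ^ (CHAR('c) ^ n) = x" unfolding croots_def by blast
  have "(- x) ^ (CHAR('c) ^ n) = - x"
    using frob_diff[of 0 x n] n pge2 by (simp add: power_0_left)
  then show "- x \<in> croots" unfolding croots_def using n(1) by blast
  show "inverse x \<in> croots" unfolding croots_def using n by (auto simp: power_inverse)
  fix y assume y: "y \<in> croots"
  obtain n where n: "n > 0" "x ^ (CHAR('c) ^ n) = x" "y ^ (CHAR('c) ^ n) = y"
    using croots_common[OF x y] .
  show "x + y \<in> croots" unfolding croots_def using n frob_add[of x y n] by auto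
  show "x * y \<in> croots" unfolding croots_def using n by (auto simp: power_mult_distrib)
qed

lemmas croots_field = subfieldD[OF subfield_croots]

lemma croots_sum: "(\<And>z. z \<in> A \<Longrightarrow> h z \<in> croots) \<Longrightarrow> sum h A \<in> croots"
  by (induction A rule: infinite_finite_induct) (auto intro: croots_field)

lemma croots_integral:
  assumes "x \<in> croots"
  shows "int_cl x"
proof -
  obtain n where n: "n > 0" "x ^ (CHAR('c) ^ n) = x" using assms unfolding croots_def by blast
  define N where "N = CHAR('c) ^ n"
  have N: "N > 1" unfolding N_def using pge2 n(1) by (intro one_less_power) auto
  define q where "q = Polynomial.monom (1::'c) N + (- Polynomial.monom 1 1)"
  have c: "Polynomial.coeff q i = (if i = N then 1 else if i = 1 then - 1 else 0)" for i
    using N by (auto simp: q_def coeff_monom)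
  have "Polynomial.degree q = N"
    unfolding q_def by (subst degree_add_eq_left) (use N in \<open>auto simp: degree_monom_eq\<close>)
  then have "Polynomial.lead_coeff q = 1" using c by simp
  moreover have "poly q x = 0" using n(2) by (simp add: q_def poly_monom N_def)
  moreover have "\<forall>i. Polynomial.coeff q i \<in> OF" using c OFD(1,4,5) by auto
  ultimately show ?thesis unfolding integral_over_def by blast
qed

text \<open>Otherwise a power of this inverse would turn the equation expressing
  \<open>nil z\<close> into an integral inverse of \<open>t\<close>.\<close>

lemma nil_not_unit:
  assumes "nil z" "z \<noteq> 0"
  shows "\<not> int_cl (inverse z)"
proof
  assume *: "int_cl (inverse z)"
  obtain i e where e: "int_cl e" "z ^ (CHAR('c) ^ i) = t * e" using assms(1) unfolding nil_def by blast
  have "t * (e * inverse z ^ (CHAR('c) ^ i)) = 1"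
    using assms(2) unfolding mult.assoc[symmetric] e(2)[symmetric] by (simp add: power_inverse)
  then have "inverse t = e * inverse z ^ (CHAR('c) ^ i)" by (rule inverse_unique)
  then show False using t_inverse_not_integral int_cl_ring(3)[OF e(1) int_cl_ring(7)[OF *]] by metis
qed

text \<open>Both equations are raised to the common exponent \<open>p ^ (i + j)\<close>, where
  subtraction commutes with the power; one factor \<open>t\<close> is kept and the others are
  absorbed.\<close>

lemma nil_diff:
  assumes "nil x" "nil y"
  shows "nil (x - y)"
proof -
  obtain i e where e: "int_cl e" "x ^ (CHAR('c) ^ i) = t * e" using assms(1) unfolding nil_def by blast
  obtain j d where d: "int_cl d" "y ^ (CHAR('c) ^ j) = t * d" using assms(2) unfolding nil_def by blast
  have "(t * e) ^ N = t * (t ^ (N - 1) * e ^ N)" if "N > 0" for N and e :: 'c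
    using that by (cases N) (auto simp: power_mult_distrib mult.assoc)
  note * = this
  have pos: "CHAR('c) ^ k > 0" for k using pge2 by simp
  have "x ^ (CHAR('c) ^ (i + j)) = (t * e) ^ (CHAR('c) ^ j)" "y ^ (CHAR('c) ^ (i + j)) = (t * d) ^ (CHAR('c) ^ i)"
    unfolding e(2)[symmetric] d(2)[symmetric] power_mult[symmetric] by (simp_all add: power_add mult.commute)
  then have "(x - y) ^ (CHAR('c) ^ (i + j)) = t * (t ^ (CHAR('c) ^ j - 1) * e ^ (CHAR('c) ^ j) - t ^ (CHAR('c) ^ i - 1) * d ^ (CHAR('c) ^ i))"
    unfolding frob_diff *[OF pos] by (simp add: algebra_simps)
  moreover have "int_cl (t ^ (CHAR('c) ^ j - 1) * e ^ (CHAR('c) ^ j) - t ^ (CHAR('c) ^ i - 1) * d ^ (CHAR('c) ^ i))"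
    using int_cl_self[OF t_OF] e(1) d(1) by (intro int_cl_ring)
  moreover have "int_cl (x - y)" using assms int_cl_ring(6) unfolding nil_def by blast
  ultimately show ?thesis unfolding nil_def by blast
qed

lemma nil_mult:
  assumes "nil x" "int_cl y"
  shows "nil (x * y)"
proof -
  obtain i e where e: "int_cl e" "x ^ (CHAR('c) ^ i) = t * e" using assms(1) unfolding nil_def by blast
  have "(x * y) ^ (CHAR('c) ^ i) = t * (e * y ^ (CHAR('c) ^ i))" by (simp add: power_mult_distrib e(2) mult.assoc)
  moreover have "int_cl (e * y ^ (CHAR('c) ^ i))" by (intro int_cl_ring e(1) assms(2))
  moreover have "int_cl (x * y)" using assms int_cl_ring(3) unfolding nil_def by blast
  ultimately show ?thesis unfolding nil_def by blast
qed

lemma nil_0: "nil 0"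
  unfolding nil_def using int_cl_ring(5) pge2 by (auto intro!: exI[of _ 0])

lemma nil_sum: "(\<And>i. i \<in> A \<Longrightarrow> nil (h i)) \<Longrightarrow> nil (sum h A)"
proof (induction A rule: infinite_finite_induct)
  case (insert x A)
  then have "nil (h x - (0 - sum h A))" by (intro nil_diff nil_0) auto
  then show ?case using insert by simp
qed (auto simp: nil_0)

section \<open>Galois action and inertia\<close>

lemma Gal_integral:
  assumes "\<sigma> \<in> carrier (abs_Gal F)" "int_cl x"
  shows "int_cl (\<sigma> x)"
proof -
  obtain q where q: "Polynomial.lead_coeff q = 1" "\<forall>i. Polynomial.coeff q i \<in> OF" "poly q x = 0"
    using assms(2) unfolding integral_over_def by blast
  have "poly q (\<sigma> x) = \<sigma> (poly q x)" using abs_Gal_poly[OF assms(1)] q(2) OF_F by metis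
  then have "poly q (\<sigma> x) = 0" using q(3) abs_Gal_0[OF assms(1)] by simp
  then show ?thesis unfolding integral_over_def using q by blast
qed

lemma Gal_nil:
  assumes s: "\<sigma> \<in> carrier (abs_Gal F)" and "nil x"
  shows "nil (\<sigma> x)"
proof -
  obtain i e where e: "int_cl e" "x ^ (CHAR('c) ^ i) = t * e" using assms(2) unfolding nil_def by blast
  have "\<sigma> x ^ (CHAR('c) ^ i) = t * \<sigma> e"
    using abs_Gal_power[OF s, of x] e(2) abs_Gal_mult[OF s] abs_Gal_fix[OF s t(1)] by metis
  moreover have "int_cl (\<sigma> e)" "int_cl (\<sigma> x)" using Gal_integral[OF s] e(1) assms(2) by (auto simp: nil_def)
  ultimately show ?thesis unfolding nil_def by blast
qed

text \<open>An integral \<open>x\<close> is a Teichmueller representative plus an element of the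
  maximal ideal. The former is fixed and the latter stays in that ideal, so
  \<open>\<sigma> x - x\<close> lies there and has no integral inverse.\<close>

lemma inertia_criterion:
  assumes s: "\<sigma> \<in> carrier (abs_Gal F)" and fixC: "\<And>\<zeta>. \<zeta> \<in> croots \<Longrightarrow> \<sigma> \<zeta> = \<zeta>"
  shows "\<sigma> \<in> local_inertia F w"
  unfolding local_inertia_def
proof (intro CollectI conjI ballI s)
  fix x assume "x \<in> local_integers F w"
  then have x: "int_cl x" by (simp add: local_integers_eq)
  obtain \<eta> where e: "\<eta> \<in> croots" "nil (x - \<eta>)" using teichmuller[OF x] by blast
  have "nil (\<sigma> (x - \<eta>) - (x - \<eta>))" by (rule nil_diff[OF Gal_nil[OF s e(2)] e(2)])
  then have "nil (\<sigma> x - x)" by (simp add: abs_Gal_diff[OF s] fixC[OF e(1)])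
  then show "\<sigma> x - x = 0 \<or> inverse (\<sigma> x - x) \<notin> local_integers F w"
    using nil_not_unit by (auto simp: local_integers_eq)
qed

text \<open>The compositum of \<open>F\<close> with the algebraic closure of its constant field; it is the maximal
  unramified extension of \<open>F\<close>.\<close>

definition unram where
  "unram = {\<Sum>z\<in>Z. c z * z | Z c. finite Z \<and> Z \<subseteq> croots \<and> (\<forall>z\<in>Z. c z \<in> F)}"

lemma unramI: "finite Z \<Longrightarrow> Z \<subseteq> croots \<Longrightarrow> (\<And>z. z \<in> Z \<Longrightarrow> c z \<in> F) \<Longrightarrow> x = (\<Sum>z\<in>Z. c z * z) \<Longrightarrow> x \<in> unram"
  unfolding unram_def by blast

lemma unramE:
  assumes "x \<in> unram"
  obtains Z c where "finite Z" "Z \<subseteq> croots" "\<forall>z\<in>Z. c z \<in> F" "x = (\<Sum>z\<in>Z. c z * z)"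
  using assms unfolding unram_def by blast

lemma unram_monom: "c \<in> F \<Longrightarrow> z \<in> croots \<Longrightarrow> c * z \<in> unram"
  by (rule unramI[of "{z}" "\<lambda>_. c"]) auto

lemma unram_add:
  assumes "x \<in> unram" "y \<in> unram"
  shows "x + y \<in> unram"
proof -
  obtain Z1 c where Z1: "finite Z1" "Z1 \<subseteq> croots" "\<forall>z\<in>Z1. c z \<in> F" "x = (\<Sum>z\<in>Z1. c z * z)" using unramE[OF assms(1)] .
  obtain Z2 d where Z2: "finite Z2" "Z2 \<subseteq> croots" "\<forall>z\<in>Z2. d z \<in> F" "y = (\<Sum>z\<in>Z2. d z * z)" using unramE[OF assms(2)] .
  define c' where "c' z = (if z \<in> Z1 then c z else 0)" for z
  define d' where "d' z = (if z \<in> Z2 then d z else 0)" for z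
  have "x = (\<Sum>z\<in>Z1 \<union> Z2. c' z * z)" unfolding Z1(4)
    by (rule sum.mono_neutral_cong_left) (use Z1(1) Z2(1) in \<open>auto simp: c'_def\<close>)
  moreover have "y = (\<Sum>z\<in>Z1 \<union> Z2. d' z * z)" unfolding Z2(4)
    by (rule sum.mono_neutral_cong_left) (use Z1(1) Z2(1) in \<open>auto simp: d'_def\<close>)
  ultimately have "x + y = (\<Sum>z\<in>Z1 \<union> Z2. (c' z + d' z) * z)" by (simp add: sum.distrib distrib_right)
  then show ?thesis
    by (rule unramI[rotated 3]) (use Z1 Z2 in \<open>auto simp: c'_def d'_def intro: FD\<close>)
qed

lemma unram_0: "0 \<in> unram"
  by (rule unramI[of "{}"]) auto

lemma unram_sum: "(\<And>i. i \<in> A \<Longrightarrow> h i \<in> unram) \<Longrightarrow> sum h A \<in> unram"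
  by (induction A rule: infinite_finite_induct) (auto intro: unram_0 unram_add)

lemma unram_mult:
  assumes "x \<in> unram" "y \<in> unram"
  shows "x * y \<in> unram"
proof -
  obtain Z1 c where Z1: "finite Z1" "Z1 \<subseteq> croots" "\<forall>z\<in>Z1. c z \<in> F" "x = (\<Sum>z\<in>Z1. c z * z)" using unramE[OF assms(1)] .
  obtain Z2 d where Z2: "finite Z2" "Z2 \<subseteq> croots" "\<forall>z\<in>Z2. d z \<in> F" "y = (\<Sum>z\<in>Z2. d z * z)" using unramE[OF assms(2)] .
  have "x * y = (\<Sum>z\<in>Z1. \<Sum>z'\<in>Z2. (c z * d z') * (z * z'))"
    unfolding Z1(4) Z2(4) sum_product by (simp add: mult_ac)
  also have "\<dots> \<in> unram"
    by (intro unram_sum unram_monom FD(4) croots_field(4)) (use Z1 Z2 in auto)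
  finally show ?thesis .
qed

lemma F_unram: "x \<in> F \<Longrightarrow> x \<in> unram"
  using unram_monom[of x 1] croots_field(2) by simp

lemma croots_unram: "x \<in> croots \<Longrightarrow> x \<in> unram"
  using unram_monom[of 1 x] FD(2) by simp

lemma unram_poly: "\<forall>i. Polynomial.coeff p i \<in> F \<Longrightarrow> x \<in> unram \<Longrightarrow> poly p x \<in> unram"
proof -
  assume p: "\<forall>i. Polynomial.coeff p i \<in> F" and x: "x \<in> unram"
  have "x ^ n \<in> unram" for n by (induction n) (auto intro: unram_mult x F_unram FD)
  then show ?thesis unfolding poly_altdef using p by (intro unram_sum unram_mult) (auto intro: F_unram)
qed

lemma subfield_unram: "subfield unram type_ring"
  unfolding subfield_type_ring_iff
proof (intro conjI ballI)
  show "1 \<in> unram" by (intro F_unram FD)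
  fix x assume x: "x \<in> unram"
  show "- x \<in> unram" using unram_mult[OF F_unram[OF FD(5)[OF FD(2)]] x] by simp
  show "inverse x \<in> unram"
  proof (cases "x = 0")
    case False
    obtain p where p: "\<forall>i. Polynomial.coeff p i \<in> F" "poly p x = 0" "p \<noteq> 0"
      by (rule algebraic_over_closure[OF cl, of x]) blast
    obtain q where q: "\<forall>i. Polynomial.coeff q i \<in> F" "poly q x * x = 1"
      using algebraic_inverse_poly[OF F p(1,3,2) False] by blast
    have "inverse x = poly q x" using q(2) inverse_unique[of x "poly q x"] by (simp add: mult.commute)
    then show ?thesis using unram_poly[OF q(1) x] by simp
  qed (use x in simp)
  fix y assume y: "y \<in> unram"
  show "x + y \<in> unram" "x * y \<in> unram" using unram_add unram_mult x y by auto
qed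

lemma closure_unram: "is_separable_closure_of unram"
  using cl subfield_unram F_unram unfolding is_separable_closure_of_def separable_over_def by blast

text \<open>In a shortest expression of \<open>y\<close> over \<open>F\<close> by constants, the
  constants are independent over \<open>F\<close>. Dividing by the coefficient of least valuation
  makes all coefficients integral and one of them \<open>1\<close>, while \<open>y\<close> moves
  into the maximal ideal because its square has odd valuation. Replacing the coefficients by
  Teichmueller representatives gives a combination that is itself a constant and lies in the maximal
  ideal; it is therefore zero, against independence.\<close>

lemma ramified_not_unram:
  assumes y: "y\<^sup>2 = \<delta>" "\<delta> \<in> F" "\<delta> \<noteq> 0" "odd (w \<delta>)"
  shows "y \<notin> unram"
proof
  assume "y \<in> unram"
  define P where "P n \<longleftrightarrow> (\<exists>Z c. finite Z \<and> Z \<subseteq> croots \<and> (\<forall>z\<in>Z. c z \<in> F) \<and> y = (\<Sum>z\<in>Z. c z * z) \<and> card Z = n)" for n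
  have "\<exists>n. P n" using \<open>y \<in> unram\<close> unfolding P_def by (auto elim!: unramE)
  then have PL: "P (Least P)" and Pmin: "\<And>d. d < Least P \<Longrightarrow> \<not> P d"
    by (auto intro: LeastI_ex dest: not_less_Least)
  obtain Z c where Z: "finite Z" "Z \<subseteq> croots" "\<forall>z\<in>Z. c z \<in> F" "y = (\<Sum>z\<in>Z. c z * z)" "card Z = Least P"
    using PL unfolding P_def by blast
  have y0: "y \<noteq> 0" using y(1,3) by auto
  \<comment> \<open>A relation involving \<open>z0\<close> would allow the term of \<open>z0\<close>
    to be eliminated from the expression of \<open>y\<close>.\<close>
  have indep: "\<eta> z0 = 0" if eta: "\<And>z. z \<in> Z \<Longrightarrow> \<eta> z \<in> F" "(\<Sum>z\<in>Z. \<eta> z * z) = 0" "z0 \<in> Z" for \<eta> z0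
  proof (rule ccontr)
    assume n0: "\<eta> z0 \<noteq> 0"
    define a where "a = c z0 * inverse (\<eta> z0)"
    have a: "a \<in> F" unfolding a_def using eta(1,3) Z(3) by (intro FD) auto
    have "y = (\<Sum>z\<in>Z. c z * z) - a * (\<Sum>z\<in>Z. \<eta> z * z)" using Z(4) eta(2) by simp
    also have "\<dots> = (\<Sum>z\<in>Z. (c z - a * \<eta> z) * z)"
      by (simp add: sum_distrib_left sum_subtractf left_diff_distrib mult.assoc)
    also have "\<dots> = (c z0 - a * \<eta> z0) * z0 + (\<Sum>z\<in>Z - {z0}. (c z - a * \<eta> z) * z)"
      using Z(1) eta(3) by (rule sum.remove)
    also have "c z0 - a * \<eta> z0 = 0" using n0 by (simp add: a_def)
    finally have "y = (\<Sum>z\<in>Z - {z0}. (c z - a * \<eta> z) * z)" by simp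
    moreover have "c z - a * \<eta> z \<in> F" if "z \<in> Z" for z
      by (intro FD(7) FD(4) a eta(1) that) (use Z(3) that in blast)
    ultimately have "P (card (Z - {z0}))" unfolding P_def using Z(1,2)
      by (intro exI[of _ "Z - {z0}"] exI[of _ "\<lambda>z. c z - a * \<eta> z"]) auto
    moreover have "card (Z - {z0}) < Least P" using card_Diff1_less[OF Z(1) eta(3)] Z(5) by simp
    ultimately show False using Pmin by blast
  qed
  \<comment> \<open>Only non-zero coefficients enter, since the value of \<open>w\<close> at
    \<open>0\<close> carries no meaning.\<close>
  define W where "W = w ` c ` {z\<in>Z. c z \<noteq> 0}"
  have "W \<noteq> {}"
  proof
    assume "W = {}"
    then have "\<forall>z\<in>Z. c z = 0" unfolding W_def by blast
    then have "y = 0" using Z(4) by simp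
    then show False using y0 by simp
  qed
  moreover have finW: "finite W" unfolding W_def using Z(1) by simp
  ultimately obtain mn where mn: "mn \<in> W" "mn = Min W" using Min_in[of W] by blast
  then obtain z0 where z0: "z0 \<in> Z" "c z0 \<noteq> 0" "w (c z0) = mn" unfolding W_def by auto
  define u where "u = c z0"
  have u: "u \<in> F" "u \<noteq> 0" using z0 Z(3) by (auto simp: u_def)
  define c' where "c' z = c z * inverse u" for z
  have c'F: "c' z \<in> F" if "z \<in> Z" for z using that Z(3) u by (auto simp: c'_def intro: FD)
  have c': "c' z \<in> OF" if "z \<in> Z" for z
  proof (cases "c z = 0")
    case True
    then show ?thesis by (simp add: c'_def OFD)
  next
    case False
    then have "w (c z0) \<le> w (c z)" unfolding z0(3) mn(2) using that finW by (intro Min_le) (auto simp: W_def)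
    then have "w (c' z) \<ge> 0" unfolding c'_def using w_mult[of "c z" "inverse u"] False u Z(3) that w_inverse[OF u] FD(6)
      by (simp add: u_def)
    then show ?thesis using c'F[OF that] by (simp add: OF_def val_ge_def)
  qed
  define y' where "y' = y * inverse u"
  have y': "y' = (\<Sum>z\<in>Z. c' z * z)" unfolding y'_def Z(4) c'_def by (simp add: sum_distrib_right mult.assoc mult.commute[of "inverse u"])
  have y'int: "int_cl y'" unfolding y' using c' Z(2) by (intro int_cl_sum int_cl_ring int_cl_self croots_integral) auto
  have "y'\<^sup>2 = \<delta> * inverse u * inverse u" unfolding y'_def power_mult_distrib y(1) by (simp add: power2_eq_square mult.assoc)
  then have y'2: "y'\<^sup>2 \<in> F" "w (y'\<^sup>2) = w \<delta> - 2 * w u" "y'\<^sup>2 \<noteq> 0"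
    using y u FD(4,6) w_mult w_inverse[OF u] by auto
  have "y'\<^sup>2 \<in> OF" using integrally_closed[OF y'2(1)] y'int int_cl_ring(7) by blast
  then have "w (y'\<^sup>2) \<ge> 0" using y'2(3) by (simp add: OF_def val_ge_def)
  \<comment> \<open>Scaling \<open>y\<close> changes the valuation of its square by an even number,
    so the value \<open>0\<close> is excluded.\<close>
  moreover have "odd (w (y'\<^sup>2))" using y'2(2) y(4) by simp
  then have "w (y'\<^sup>2) \<noteq> 0" by auto
  ultimately have "val_ge w (y'\<^sup>2) (int 1)" by (simp add: val_ge_def)
  then obtain e where e: "e \<in> OF" "y'\<^sup>2 = t * e" using val_ge_iff_dvd[OF y'2(1), of 1] by auto
  have "nil y'"
  proof -
    \<comment> \<open>The characteristic is at least two, so this power of \<open>y'\<close>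
      contains the square, which is divisible by \<open>t\<close>.\<close>
    have "y' ^ (CHAR('c) ^ 1) = y'\<^sup>2 * y' ^ (CHAR('c) - 2)"
      using pge2 by (metis le_add_diff_inverse power_add power_one_right)
    then have "y' ^ (CHAR('c) ^ 1) = t * (e * y' ^ (CHAR('c) - 2))" unfolding e(2) by (simp add: mult.assoc)
    moreover have "int_cl (e * y' ^ (CHAR('c) - 2))" by (intro int_cl_ring int_cl_self e y'int)
    ultimately show ?thesis unfolding nil_def using y'int by blast
  qed
  \<comment> \<open>Elements of \<open>F\<close> have representatives in \<open>F\<close>; this
    keeps the relation one with coefficients in \<open>F\<close>.\<close>
  have "\<exists>\<eta>. \<eta> \<in> croots \<and> nil (c' z - \<eta>) \<and> \<eta> \<in> F" if "z \<in> Z" for z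
    using teichmuller[OF int_cl_self[OF c'[OF that]]] c'F[OF that] by blast
  then obtain \<eta> where eta: "\<And>z. z \<in> Z \<Longrightarrow> \<eta> z \<in> croots" "\<And>z. z \<in> Z \<Longrightarrow> nil (c' z - \<eta> z)" "\<And>z. z \<in> Z \<Longrightarrow> \<eta> z \<in> F"
    by metis
  define \<theta> where "\<theta> = (\<Sum>z\<in>Z. \<eta> z * z)"
  have "nil (y' - (\<Sum>z\<in>Z. (c' z - \<eta> z) * z))"
    by (rule nil_diff[OF \<open>nil y'\<close>], rule nil_sum, rule nil_mult) (use Z(2) eta(2) croots_integral in auto)
  then have "nil \<theta>" unfolding y' \<theta>_def by (simp add: left_diff_distrib sum_subtractf)
  moreover have "\<theta> \<in> croots"
    unfolding \<theta>_def
  proof (rule croots_sum)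
    fix z assume "z \<in> Z"
    then show "\<eta> z * z \<in> croots" using eta(1) Z(2) croots_field(4) by blast
  qed
  \<comment> \<open>The inverse of a non-zero constant is again a constant and so integral; hence no
    such constant lies in the maximal ideal.\<close>
  ultimately have "\<theta> = 0" using nil_not_unit croots_integral croots_field(6) by blast
  then have "\<eta> z0 = 0" using indep[of \<eta> z0] eta(3) z0(1) unfolding \<theta>_def by blast
  \<comment> \<open>The coefficient of \<open>z0\<close> was scaled to \<open>1\<close>, which
    cannot be represented by \<open>0\<close>.\<close>
  then have "nil 1" using eta(2)[OF z0(1)] z0(2) by (simp add: c'_def u_def)
  then show False using nil_not_unit[of 1] int_cl_ring(1) by simp
qed

text \<open>The type is a separable closure of \<open>unram\<close> as well, so
  \<open>abs_Gal_moves\<close> applies over this larger field; an automorphism fixing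
  \<open>unram\<close> fixes all constants and hence is in inertia.\<close>

theorem inertia_moves_ramified:
  assumes y: "y\<^sup>2 = \<delta>" "\<delta> \<in> F" "\<delta> \<noteq> 0" "odd (w \<delta>)"
  shows "\<exists>\<sigma>\<in>local_inertia F w. \<sigma> y = - y"
proof -
  obtain \<sigma> where s: "\<sigma> \<in> carrier (abs_Gal unram)" "\<sigma> y \<noteq> y"
    using abs_Gal_moves[OF closure_unram ramified_not_unram[OF y]] by blast
  have sF: "\<sigma> \<in> carrier (abs_Gal F)" using s(1) F_unram unfolding carrier_abs_Gal by blast
  have "(\<sigma> y)\<^sup>2 = y\<^sup>2" using abs_Gal_power[OF s(1), of y 2] abs_Gal_fix[OF sF y(2)] y(1) by simp
  then have "\<sigma> y = - y" using s(2) by (simp add: power2_eq_iff)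
  moreover have "\<sigma> \<in> local_inertia F w"
    by (rule inertia_criterion[OF sF]) (use abs_Gal_fix[OF s(1)] croots_unram in blast)
  ultimately show ?thesis by blast
qed

text \<open>Otherwise the automorphism negates \<open>y\<close> and the difference is
  \<open>- (2 * y)\<close>, a unit of the integral closure: \<open>y\<close> and its inverse are
  square roots of units of the valuation ring, and \<open>2\<close> is a non-zero constant.\<close>

theorem inertia_fixes_unramified:
  assumes y: "y\<^sup>2 = \<delta>" "\<delta> \<in> F" "\<delta> \<noteq> 0" "w \<delta> = 0" and two: "(2::'c) \<noteq> 0" and s: "\<sigma> \<in> local_inertia F w"
  shows "\<sigma> y = y"
proof (rule ccontr)
  assume ne: "\<sigma> y \<noteq> y"
  have sF: "\<sigma> \<in> carrier (abs_Gal F)" using s by (simp add: local_inertia_def)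
  have y0: "y \<noteq> 0" using y(1,3) by auto
  have "(\<sigma> y)\<^sup>2 = y\<^sup>2" using abs_Gal_power[OF sF, of y 2] abs_Gal_fix[OF sF y(2)] y(1) by simp
  then have sy: "\<sigma> y - y = - (2 * y)" using ne by (auto simp: power2_eq_iff)
  have sqrt_int: "int_cl z" if "z\<^sup>2 \<in> OF" for z
    unfolding integral_over_def
    by (rule exI[of _ "[:- (z\<^sup>2), 0, 1:]"]) (use that OFD in \<open>auto simp: coeff_pCons power2_eq_square split: nat.splits\<close>)
  have "int_cl y" by (rule sqrt_int) (use y in \<open>auto simp: OF_def val_ge_def\<close>)
  have "(inverse y)\<^sup>2 = inverse \<delta>" using y(1) by (simp add: power_inverse)
  then have "int_cl (inverse y)" by (intro sqrt_int) (use y w_inverse[of \<delta>] FD(6) in \<open>auto simp: OF_def val_ge_def\<close>)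
  moreover have "int_cl (inverse 2)" using croots_integral croots_field(2,3,6) by (metis one_add_one)
  ultimately have "int_cl (inverse (\<sigma> y - y))"
    unfolding sy inverse_minus_eq inverse_mult_distrib using int_cl_ring(3,4) by blast
  moreover have "\<sigma> y - y \<noteq> 0" using ne by simp
  ultimately show False using s \<open>int_cl y\<close> unfolding local_inertia_def local_integers_eq by blast
qed

end

subsection \<open>Places of the rational function field\<close>

lemma irreducible_divisor_poly:
  fixes P :: "'a::field poly"
  assumes "Polynomial.degree P > 0"
  shows "\<exists>\<pi>. Factorial_Ring.irreducible \<pi> \<and> \<pi> dvd P"
proof -
  define D where "D d \<longleftrightarrow> (\<exists>\<pi>. \<pi> dvd P \<and> Polynomial.degree \<pi> > 0 \<and> Polynomial.degree \<pi> = d)" for d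
  have "D (Polynomial.degree P)" unfolding D_def by (rule exI[of _ P]) (use assms in simp)
  then have DL: "D (Least D)" and Dmin: "\<And>d. d < Least D \<Longrightarrow> \<not> D d"
    by (auto intro: LeastI dest: not_less_Least)
  obtain \<pi> where p: "\<pi> dvd P" "Polynomial.degree \<pi> > 0" "Polynomial.degree \<pi> = Least D"
    using DL unfolding D_def by blast
  have "Factorial_Ring.irreducible \<pi>"
  proof (rule Factorial_Ring.irreducibleI)
    show p0: "\<pi> \<noteq> 0" using p(2) by auto
    show "\<not> \<pi> dvd 1" using p(2) p0 by (simp add: is_unit_iff_degree)
    fix a b assume ab: "\<pi> = a * b"
    have n0: "a \<noteq> 0" "b \<noteq> 0" using p0 ab by auto
    have deg: "Polynomial.degree \<pi> = Polynomial.degree a + Polynomial.degree b" unfolding ab using n0 by (rule degree_mult_eq)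
    show "a dvd 1 \<or> b dvd 1"
    proof (rule ccontr)
      assume "\<not> ?thesis"
      then have pos: "Polynomial.degree a > 0" "Polynomial.degree b > 0" using n0 by (auto simp: is_unit_iff_degree)
      have "a dvd P" using p(1) unfolding ab by (rule dvd_mult_left)
      then have "D (Polynomial.degree a)" using pos(1) unfolding D_def by (intro exI[of _ a]) simp
      then show False using Dmin[of "Polynomial.degree a"] deg pos p(3) by linarith
    qed
  qed
  then show ?thesis using p(1) by blast
qed

lemma finite_degree_less: "finite {p :: 'a::{finite,field} poly. Polynomial.degree p < n}"
proof -
  have "inj_on (\<lambda>p. restrict (Polynomial.coeff p) {..<n}) {p :: 'a poly. Polynomial.degree p < n}"
  proof (rule inj_onI)
    fix p q :: "'a poly"
    assume pq: "p \<in> {p. Polynomial.degree p < n}" "q \<in> {p. Polynomial.degree p < n}"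
      "restrict (Polynomial.coeff p) {..<n} = restrict (Polynomial.coeff q) {..<n}"
    show "p = q"
    proof (rule poly_eqI)
      fix i show "Polynomial.coeff p i = Polynomial.coeff q i"
      proof (cases "i < n")
        case True
        then show ?thesis using fun_cong[OF pq(3), of i] by simp
      next
        case False
        then show ?thesis using pq(1,2) by (simp add: coeff_eq_0)
      qed
    qed
  qed
  moreover have "(\<lambda>p. restrict (Polynomial.coeff p) {..<n}) ` {p :: 'a poly. Polynomial.degree p < n} \<subseteq> {..<n} \<rightarrow>\<^sub>E UNIV"
    by (auto simp: PiE_iff extensional_def split: if_splits)
  moreover have "finite ({..<n} \<rightarrow>\<^sub>E (UNIV :: 'a set))" by (intro finite_PiE) auto
  ultimately show ?thesis using finite_imageD finite_subset by metis
qed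

section \<open>The valuation of an irreducible polynomial\<close>

locale poly_place =
  fixes \<pi> :: "'a::{finite,field} poly"
  assumes irred: "Factorial_Ring.irreducible \<pi>"
begin

lemma prime: "prime_elem \<pi>"
  using field_poly_irreducible_imp_prime[OF irred] .

lemma pi0: "\<pi> \<noteq> 0"
  using irred by (auto simp: Factorial_Ring.irreducible_def)

lemma deg_pos: "Polynomial.degree \<pi> > 0"
  using irred pi0 by (auto simp: Factorial_Ring.irreducible_def is_unit_iff_degree)

lemma prime_dvd: "\<pi> dvd a * b \<longleftrightarrow> \<pi> dvd a \<or> \<pi> dvd b"
  using prime by (rule prime_elem_dvd_mult_iff)

lemma not_dvd_1: "\<not> \<pi> dvd 1"
  using irred by (auto simp: Factorial_Ring.irreducible_def)

lemma split_power:
  assumes "f \<noteq> 0"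
  shows "\<exists>n g. f = \<pi> ^ n * g \<and> \<not> \<pi> dvd g"
  using assms
proof (induction "Polynomial.degree f" arbitrary: f rule: less_induct)
  case less
  show ?case
  proof (cases "\<pi> dvd f")
    case False
    then show ?thesis by (intro exI[of _ 0] exI[of _ f]) simp
  next
    case True
    then obtain h where h: "f = \<pi> * h" by (rule dvdE)
    have h0: "h \<noteq> 0" using less.prems h by auto
    have "Polynomial.degree f = Polynomial.degree \<pi> + Polynomial.degree h"
      unfolding h using pi0 h0 by (rule degree_mult_eq)
    then obtain n g where "h = \<pi> ^ n * g" "\<not> \<pi> dvd g" using less.hyps[of h] h0 deg_pos by auto
    then show ?thesis using h by (intro exI[of _ "Suc n"] exI[of _ g]) simp
  qed
qed

text \<open>The graph of the valuation, with denominators multiplied out so that no reduced fraction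
  has to be chosen.\<close>

definition rel :: "'a poly fract \<Rightarrow> int \<Rightarrow> bool" where
  "rel x n \<longleftrightarrow> (\<exists>a b g h. \<not> \<pi> dvd g \<and> \<not> \<pi> dvd h \<and> x * to_fract (\<pi> ^ b * h) = to_fract (\<pi> ^ a * g) \<and> n = int a - int b)"

lemma power_unique:
  assumes "\<pi> ^ a * g = \<pi> ^ b * h" "\<not> \<pi> dvd g" "\<not> \<pi> dvd h"
  shows "a = b"
proof (rule ccontr)
  assume "a \<noteq> b"
  then consider "a < b" | "b < a" by linarith
  then show False
  proof cases
    case 1
    then have "\<pi> ^ a * g = \<pi> ^ a * (\<pi> ^ (b - a) * h)" using assms(1) by (simp add: mult.assoc[symmetric] power_add[symmetric])
    then have "g = \<pi> ^ (b - a) * h" using pi0 by simp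
    moreover have "\<pi> dvd \<pi> ^ (b - a)" using 1 by (simp add: dvd_power)
    ultimately show False using assms(2) by (metis dvd_mult2)
  next
    case 2
    then have "\<pi> ^ b * h = \<pi> ^ b * (\<pi> ^ (a - b) * g)" using assms(1) by (simp add: mult.assoc[symmetric] power_add[symmetric])
    then have "h = \<pi> ^ (a - b) * g" using pi0 by simp
    moreover have "\<pi> dvd \<pi> ^ (a - b)" using 2 by (simp add: dvd_power)
    ultimately show False using assms(3) by (metis dvd_mult2)
  qed
qed

lemma rel_unique:
  assumes "rel x m" "rel x n"
  shows "m = n"
proof -
  obtain a b g h where 1: "\<not> \<pi> dvd g" "\<not> \<pi> dvd h" "x * to_fract (\<pi> ^ b * h) = to_fract (\<pi> ^ a * g)" "m = int a - int b"
    using assms(1) unfolding rel_def by blast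
  obtain c d i j where 2: "\<not> \<pi> dvd i" "\<not> \<pi> dvd j" "x * to_fract (\<pi> ^ d * j) = to_fract (\<pi> ^ c * i)" "n = int c - int d"
    using assms(2) unfolding rel_def by blast
  have "to_fract (\<pi> ^ a * g) * to_fract (\<pi> ^ d * j) = to_fract (\<pi> ^ c * i) * to_fract (\<pi> ^ b * h)"
    unfolding 1(3)[symmetric] 2(3)[symmetric] by (simp add: mult_ac)
  then have "\<pi> ^ a * g * (\<pi> ^ d * j) = \<pi> ^ c * i * (\<pi> ^ b * h)"
    unfolding to_fract_mult[symmetric] to_fract_eq_iff .
  then have "\<pi> ^ (a + d) * (g * j) = \<pi> ^ (c + b) * (i * h)" by (simp add: power_add mult_ac)
  then have "a + d = c + b" by (rule power_unique) (use 1 2 prime_dvd in auto)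
  then show ?thesis using 1(4) 2(4) by linarith
qed

lemma rel_exists:
  assumes "x \<noteq> 0"
  shows "\<exists>n. rel x n"
proof -
  obtain u v where uv: "v \<noteq> 0" "x = Fraction_Field.Fract u v" by (cases x) auto
  have "u \<noteq> 0" using assms uv by (auto simp: fract_collapse)
  obtain a g where g: "u = \<pi> ^ a * g" "\<not> \<pi> dvd g" using split_power[OF \<open>u \<noteq> 0\<close>] by blast
  obtain b h where h: "v = \<pi> ^ b * h" "\<not> \<pi> dvd h" using split_power[OF uv(1)] by blast
  have "x * to_fract v = to_fract u" using uv by (simp add: Fract_conv_to_fract)
  then have "rel x (int a - int b)" unfolding rel_def g(1) h(1) using g(2) h(2) by blast
  then show ?thesis ..
qed

definition v :: "'a poly fract \<Rightarrow> int" where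
  "v x = (if x = 0 then 0 else THE n. rel x n)"

lemma rel_v:
  assumes "x \<noteq> 0"
  shows "rel x (v x)"
proof -
  have "\<exists>!n. rel x n" using rel_exists[OF assms] rel_unique by blast
  then show ?thesis unfolding v_def using assms theI'[of "rel x"] by simp
qed

lemma v_eqI: "x \<noteq> 0 \<Longrightarrow> rel x n \<Longrightarrow> v x = n"
  using rel_v rel_unique by blast

lemma v_to_fract: "\<not> \<pi> dvd g \<Longrightarrow> v (to_fract (\<pi> ^ n * g)) = int n"
proof (rule v_eqI)
  assume g: "\<not> \<pi> dvd g"
  then have "g \<noteq> 0" by auto
  then show "to_fract (\<pi> ^ n * g) \<noteq> 0" using pi0 by simp
  show "rel (to_fract (\<pi> ^ n * g)) (int n)" unfolding rel_def
    by (rule exI[of _ n], rule exI[of _ 0], rule exI[of _ g], rule exI[of _ 1]) (use g not_dvd_1 in simp)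
qed

lemma v_pi: "v (to_fract \<pi>) = 1"
  using v_to_fract[of 1 1] not_dvd_1 by simp

lemma v_mult:
  assumes "x \<noteq> 0" "y \<noteq> 0"
  shows "v (x * y) = v x + v y"
proof -
  obtain a b g h where 1: "\<not> \<pi> dvd g" "\<not> \<pi> dvd h" "x * to_fract (\<pi> ^ b * h) = to_fract (\<pi> ^ a * g)" "v x = int a - int b"
    using rel_v[OF assms(1)] unfolding rel_def by blast
  obtain c d i j where 2: "\<not> \<pi> dvd i" "\<not> \<pi> dvd j" "y * to_fract (\<pi> ^ d * j) = to_fract (\<pi> ^ c * i)" "v y = int c - int d"
    using rel_v[OF assms(2)] unfolding rel_def by blast
  have "(x * to_fract (\<pi> ^ b * h)) * (y * to_fract (\<pi> ^ d * j)) = to_fract (\<pi> ^ a * g) * to_fract (\<pi> ^ c * i)"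
    unfolding 1(3) 2(3) ..
  moreover have "(x * to_fract (\<pi> ^ b * h)) * (y * to_fract (\<pi> ^ d * j)) = (x * y) * to_fract ((\<pi> ^ b * h) * (\<pi> ^ d * j))"
    unfolding to_fract_mult by (simp add: mult_ac)
  ultimately have "(x * y) * to_fract (\<pi> ^ (b + d) * (h * j)) = to_fract (\<pi> ^ (a + c) * (g * i))"
    unfolding to_fract_mult[symmetric] by (simp add: power_add mult_ac)
  moreover have "\<not> \<pi> dvd h * j" "\<not> \<pi> dvd g * i" using 1 2 prime_dvd by auto
  ultimately have "rel (x * y) (int (a + c) - int (b + d))" unfolding rel_def by blast
  then show ?thesis using v_eqI[of "x * y"] assms 1(4) 2(4) by simp
qed

lemma v_1: "v 1 = 0"
  using v_to_fract[of 1 0] not_dvd_1 by simp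

lemma v_poly_ge:
  assumes "f \<noteq> 0"
  shows "v (to_fract f) \<ge> 0"
  using split_power[OF assms] v_to_fract by fastforce

text \<open>Denominators prime to \<open>\<pi>\<close> describe the valuation ring; the ultrametric
  inequality and the residue classes are both read off from them.\<close>

lemma v_ge_iff:
  assumes "v x \<ge> 0" "x \<noteq> 0"
  obtains u h where "\<not> \<pi> dvd h" "x * to_fract h = to_fract u"
proof -
  obtain a b g h where 1: "\<not> \<pi> dvd g" "\<not> \<pi> dvd h" "x * to_fract (\<pi> ^ b * h) = to_fract (\<pi> ^ a * g)" "v x = int a - int b"
    using rel_v[OF assms(2)] unfolding rel_def by blast
  have ba: "b \<le> a" using 1(4) assms(1) by simp
  have "to_fract (\<pi> ^ b) * (x * to_fract h) = to_fract (\<pi> ^ b) * to_fract (\<pi> ^ (a - b) * g)"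
  proof -
    have A: "to_fract (\<pi> ^ b) * to_fract (\<pi> ^ (a - b) * g) = to_fract (\<pi> ^ a * g)"
      unfolding to_fract_mult[symmetric] mult.assoc[symmetric] power_add[symmetric] using ba by simp
    have B: "to_fract (\<pi> ^ b) * (x * to_fract h) = x * to_fract (\<pi> ^ b * h)"
      unfolding to_fract_mult by (simp add: mult_ac)
    show ?thesis by (rule trans[OF trans[OF B 1(3)] A[symmetric]])
  qed
  moreover have "to_fract (\<pi> ^ b) \<noteq> 0" using pi0 by simp
  ultimately have "x * to_fract h = to_fract (\<pi> ^ (a - b) * g)" by (metis mult_left_cancel)
  then show ?thesis using that 1(2) by blast
qed

text \<open>After division by the term of smaller valuation the claim is that \<open>1 + r\<close>
  is integral for integral \<open>r\<close>, which is seen from a denominator prime to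
  \<open>\<pi>\<close>.\<close>

lemma v_add:
  assumes "x \<noteq> 0" "y \<noteq> 0" "x + y \<noteq> 0"
  shows "min (v x) (v y) \<le> v (x + y)"
proof -
  have *: "v x \<le> v (x + y)" if xy: "v x \<le> v y" "x \<noteq> 0" "y \<noteq> 0" "x + y \<noteq> 0" for x y
  proof -
    define r where "r = y / x"
    have r0: "r \<noteq> 0" "y = x * r" using xy by (auto simp: r_def)
    have "v r \<ge> 0" using v_mult[OF xy(2) r0(1)] xy(1) r0(2) by simp
    then obtain u h where h: "\<not> \<pi> dvd h" "r * to_fract h = to_fract u" using v_ge_iff r0(1) by blast
    have h0: "h \<noteq> 0" using h(1) by auto
    have "x + y = x * (1 + r)" using r0(2) by (simp add: distrib_left)
    then have r1: "1 + r \<noteq> 0" "x + y = x * (1 + r)" using xy(4) by auto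
    have eq: "(1 + r) * to_fract h = to_fract (h + u)" using h(2) by (simp add: distrib_right)
    then have "h + u \<noteq> 0" using r1(1) h0 by (metis mult_eq_0_iff to_fract_eq_0_iff)
    then have "v ((1 + r) * to_fract h) \<ge> 0" unfolding eq by (rule v_poly_ge)
    moreover have "v ((1 + r) * to_fract h) = v (1 + r) + v (to_fract h)" using r1(1) h0 by (intro v_mult) auto
    ultimately have "v (1 + r) + v (to_fract h) \<ge> 0" by linarith
    moreover have "v (to_fract h) = 0" using v_to_fract[OF h(1), of 0] by simp
    ultimately show ?thesis using v_mult[OF xy(2) r1(1)] r1(2) by simp
  qed
  show ?thesis
  proof (cases "v x \<le> v y")
    case True
    then show ?thesis using *[OF True assms] by simp
  next
    case False
    then show ?thesis using *[of y x] assms by (simp add: add.commute)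
  qed
qed

lemma valuation_v: "valuation_on UNIV v"
  unfolding valuation_on_def using v_mult v_add by auto

lemma v_power: "x \<noteq> 0 \<Longrightarrow> v (x ^ n) = int n * v x"
  by (induction n) (auto simp: v_1 v_mult algebra_simps)

lemma place_v: "place v"
  unfolding place_def
proof (intro conjI valuation_v)
  show "v 0 = 0" by (simp add: v_def)
  have "n \<in> v ` (- {0})" for n
  proof (cases "n \<ge> 0")
    case True
    then have "v (to_fract \<pi> ^ nat n) = n" using v_power[of "to_fract \<pi>" "nat n"] pi0 v_pi by simp
    moreover have "to_fract \<pi> ^ nat n \<noteq> 0" using pi0 by simp
    ultimately show ?thesis by (metis ComplI image_eqI singletonD)
  next
    case False
    define x where "x = to_fract \<pi> ^ nat (- n)"
    have x: "x \<noteq> 0" "v x = - n" using v_power[of "to_fract \<pi>" "nat (- n)"] pi0 v_pi False by (auto simp: x_def)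
    have "v (inverse x) = n" using v_mult[of x "inverse x"] x v_1 by simp
    moreover have "inverse x \<noteq> 0" using x by simp
    ultimately show ?thesis by (metis ComplI image_eqI singletonD)
  qed
  then show "v ` (- {0}) = UNIV" by blast
qed

text \<open>The two valuations are told apart at \<open>\<pi>\<close>: the infinite place takes the
  negative of the degree there, whereas \<open>v\<close> takes the value \<open>1\<close>.\<close>

lemma finite_place_v: "finite_place v"
  unfolding finite_place_def
proof (intro conjI place_v)
  have "infinite_place (to_fract \<pi>) = - int (Polynomial.degree \<pi>)"
  proof -
    have "(THE n. \<exists>f g. f \<noteq> 0 \<and> g \<noteq> 0 \<and> to_fract \<pi> = Fraction_Field.Fract f g \<and> n = int (Polynomial.degree g) - int (Polynomial.degree f)) = - int (Polynomial.degree \<pi>)"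
    proof (rule the_equality)
      show "\<exists>f g. f \<noteq> 0 \<and> g \<noteq> 0 \<and> to_fract \<pi> = Fraction_Field.Fract f g \<and> - int (Polynomial.degree \<pi>) = int (Polynomial.degree g) - int (Polynomial.degree f)"
        by (rule exI[of _ \<pi>], rule exI[of _ 1]) (use pi0 in \<open>simp add: to_fract_def\<close>)
      fix n assume "\<exists>f g. f \<noteq> 0 \<and> g \<noteq> 0 \<and> to_fract \<pi> = Fraction_Field.Fract f g \<and> n = int (Polynomial.degree g) - int (Polynomial.degree f)"
      then obtain f g where fg: "f \<noteq> 0" "g \<noteq> 0" "to_fract \<pi> = Fraction_Field.Fract f g" "n = int (Polynomial.degree g) - int (Polynomial.degree f)" by blast
      have "\<pi> * g = f" using fg(1-3) by (simp add: to_fract_def eq_fract)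
      then have "Polynomial.degree f = Polynomial.degree \<pi> + Polynomial.degree g" using degree_mult_eq[OF pi0 fg(2)] by simp
      then show "n = - int (Polynomial.degree \<pi>)" using fg(4) by simp
    qed
    then show ?thesis using pi0 by (simp add: infinite_place_def)
  qed
  then show "v \<noteq> infinite_place" using v_pi by (metis of_nat_0_le_iff neg_0_le_iff_le not_one_le_zero order_trans zero_le_one neg_le_0_iff_le)
qed

text \<open>Modulo \<open>\<pi>\<close> the denominator \<open>h\<close> acts injectively on the
  finitely many polynomials of smaller degree, hence bijectively. So the quotient of
  \<open>u\<close> by \<open>h\<close> is congruent to a polynomial.\<close>

lemma residue_representative:
  assumes "val_ge v x 0"
  shows "\<exists>r. Polynomial.degree r < Polynomial.degree \<pi> \<and> val_ge v (x - to_fract r) 1"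
proof (cases "x = 0")
  case True
  then show ?thesis using deg_pos by (intro exI[of _ 0]) (simp add: val_ge_def)
next
  case False
  then obtain u h where h: "\<not> \<pi> dvd h" "x * to_fract h = to_fract u"
    using v_ge_iff assms unfolding val_ge_def by blast
  have h0: "h \<noteq> 0" using h(1) by auto
  define D where "D = {p :: 'a poly. Polynomial.degree p < Polynomial.degree \<pi>}"
  have small: "p = 0" if "\<pi> dvd p" "Polynomial.degree p < Polynomial.degree \<pi>" for p
    using that dvd_imp_degree_le[of \<pi> p] by fastforce
  have modD: "p mod \<pi> \<in> D" for p
    using degree_mod_less[of \<pi> p] pi0 deg_pos by (auto simp: D_def)
  have "inj_on (\<lambda>r. (h * r) mod \<pi>) D"
  proof (rule inj_onI)
    fix r r' assume r: "r \<in> D" "r' \<in> D" "(h * r) mod \<pi> = (h * r') mod \<pi>"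
    then have "\<pi> dvd h * r - h * r'" by (simp add: mod_eq_dvd_iff)
    then have "\<pi> dvd h * (r - r')" by (simp add: right_diff_distrib)
    then have "\<pi> dvd r - r'" using prime_dvd h(1) by blast
    moreover have "Polynomial.degree (r - r') < Polynomial.degree \<pi>" using r(1,2) unfolding D_def by (auto intro: degree_diff_less)
    ultimately show "r = r'" using small by force
  qed
  moreover have "finite D" unfolding D_def by (rule finite_degree_less)
  ultimately have "(\<lambda>r. (h * r) mod \<pi>) ` D = D" using modD by (intro endo_inj_surj) auto
  then obtain r where r: "r \<in> D" "(h * r) mod \<pi> = u mod \<pi>" using modD[of u] by (metis (no_types, lifting) imageE)
  then have "\<pi> dvd u - h * r" by (metis mod_eq_dvd_iff)
  then obtain z where z: "u - h * r = \<pi> * z" by (rule dvdE)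
  have "(x - to_fract r) * to_fract h = to_fract (u - h * r)"
    using h(2) by (simp add: left_diff_distrib mult.commute[of "to_fract r"])
  then have eq: "(x - to_fract r) * to_fract h = to_fract (\<pi> * z)" unfolding z .
  have "val_ge v (x - to_fract r) 1"
  proof (cases "x - to_fract r = 0")
    case False
    then have "to_fract (\<pi> * z) \<noteq> 0" using eq h0 by (metis mult_eq_0_iff to_fract_eq_0_iff)
    then have z0: "z \<noteq> 0" by auto
    have "v (x - to_fract r) + v (to_fract h) = v (to_fract \<pi>) + v (to_fract z)"
      using v_mult[OF False, of "to_fract h"] v_mult[of "to_fract \<pi>" "to_fract z"] h0 pi0 z0 eq by simp
    moreover have "v (to_fract h) = 0" using v_to_fract[OF h(1), of 0] by simp
    ultimately show ?thesis using v_pi v_poly_ge[OF z0] by (simp add: val_ge_def)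
  qed (simp add: val_ge_def)
  then show ?thesis using r(1) unfolding D_def by blast
qed

end

text \<open>Among the polynomials in the square class of \<open>x\<close> one of least degree is
  taken. If it is not constant, an irreducible factor divides it exactly once, since a double factor
  could be moved into the square.\<close>

lemma square_class_ramified_or_const:
  fixes x :: "'a::{finite,field} poly fract"
  assumes "x \<noteq> 0"
  shows "(\<exists>\<pi>. Factorial_Ring.irreducible \<pi> \<and> odd (poly_place.v \<pi> x)) \<or> (\<exists>c y. c \<noteq> 0 \<and> y \<noteq> 0 \<and> x = to_fract [:c:] * y\<^sup>2)"
proof -
  define D where "D d \<longleftrightarrow> (\<exists>P y. P \<noteq> 0 \<and> y \<noteq> 0 \<and> x = to_fract P * y\<^sup>2 \<and> Polynomial.degree P = d)" for d
  have "\<exists>d. D d"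
  proof -
    obtain f g where fg: "g \<noteq> 0" "x = Fraction_Field.Fract f g" by (cases x) auto
    then have f0: "f \<noteq> 0" using assms by (auto simp: fract_collapse)
    have "x = to_fract (f * g) * (inverse (to_fract g))\<^sup>2"
      using fg by (simp add: Fract_conv_to_fract power2_eq_square field_simps)
    moreover have "f * g \<noteq> 0" "inverse (to_fract g) \<noteq> 0" using f0 fg(1) by auto
    ultimately show ?thesis unfolding D_def by blast
  qed
  then have DL: "D (Least D)" and Dmin: "\<And>d. d < Least D \<Longrightarrow> \<not> D d"
    by (auto intro: LeastI_ex dest: not_less_Least)
  obtain P y where P: "P \<noteq> 0" "y \<noteq> 0" "x = to_fract P * y\<^sup>2" "Polynomial.degree P = Least D"
    using DL unfolding D_def by blast
  show ?thesis
  proof (cases "Polynomial.degree P = 0")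
    case True
    then obtain c where "P = [:c:]" by (rule degree_eq_zeroE)
    then show ?thesis using P by auto
  next
    case False
    then obtain \<pi> where \<pi>: "Factorial_Ring.irreducible \<pi>" "\<pi> dvd P" using irreducible_divisor_poly by blast
    interpret poly_place \<pi> by unfold_locales fact
    obtain Q where Q: "P = \<pi> * Q" using \<pi>(2) by (rule dvdE)
    have "\<not> \<pi> dvd Q"
    proof
      assume "\<pi> dvd Q"
      then obtain R where R: "Q = \<pi> * R" by (rule dvdE)
      have R0: "R \<noteq> 0" using P(1) Q R by auto
      have "x = to_fract R * (to_fract \<pi> * y)\<^sup>2" unfolding P(3) Q R by (simp add: power2_eq_square mult_ac)
      moreover have "to_fract \<pi> * y \<noteq> 0" using pi0 P(2) by simp
      ultimately have "D (Polynomial.degree R)" unfolding D_def using R0 by blast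
      moreover have "Polynomial.degree P = Polynomial.degree \<pi> + (Polynomial.degree \<pi> + Polynomial.degree R)"
        unfolding Q R using pi0 R0 by (simp add: degree_mult_eq)
      ultimately show False using Dmin[of "Polynomial.degree R"] P(4) deg_pos by simp
    qed
    then have "v (to_fract P) = 1" using v_to_fract[of Q 1] Q by simp
    moreover have "v x = v (to_fract P) + 2 * v y"
      unfolding P(3) power2_eq_square using P(1,2) by (simp add: v_mult)
    ultimately have "odd (v x)" by simp
    then show ?thesis using \<pi>(1) by blast
  qed
qed

subsection \<open>Quadratic characters of the rational function field\<close>

declare add_bit_eq_xor [simp del] mult_bit_eq_and [simp del]

section \<open>Field homomorphisms and finite fields\<close>

lemma ring_hom_type_ring_iff:
  "h \<in> Ring.ring_hom type_ring type_ring \<longleftrightarrow> (\<forall>x y. h (x + y) = h x + h y \<and> h (x * y) = h x * h y) \<and> h 1 = 1"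
  by (auto simp: Ring.ring_hom_def)

lemma field_hom_type_ring: "h \<in> Ring.ring_hom type_ring type_ring \<Longrightarrow> field_hom h"
  unfolding ring_hom_type_ring_iff
  by unfold_locales (auto, metis add_cancel_right_right)

lemma (in field_hom) CHAR_eq: "CHAR('b) = CHAR('a)"
proof (rule CHAR_eqI)
  show "of_nat CHAR('a) = (0 :: 'b)" using hom_of_nat[of "CHAR('a)"] by simp
  fix n assume "of_nat n = (0 :: 'b)"
  then have "hom (of_nat n) = 0" by (simp add: hom_of_nat)
  then have "of_nat n = (0 :: 'a)" by simp
  then show "CHAR('a) dvd n" by (simp add: of_nat_eq_0_iff_char_dvd)
qed

lemma (in field_hom) map_poly_times: "map_poly hom (p * q) = map_poly hom p * map_poly hom q"
  by (rule poly_eqI) (simp add: coeff_map_poly coeff_mult hom_sum hom_mult)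

lemma (in field_hom) map_poly_linear: "map_poly hom [:a, b:] = [:hom a, hom b:]"
  by (rule poly_eqI) (simp add: coeff_map_poly coeff_pCons split: nat.split)

lemma (in field_hom) poly_map_poly_hom: "poly (map_poly hom p) (hom x) = hom (poly p x)"
  by (induction p) (simp_all add: map_poly_pCons hom_add hom_mult)

text \<open>Multiplication by a non-zero \<open>x\<close> permutes the non-zero elements; comparing
  their products gives \<open>x ^ card S = 1\<close>.\<close>

lemma finite_field_power:
  fixes x :: "'a::{finite,field}"
  shows "x ^ CARD('a) = x"
proof (cases "x = 0")
  case False
  define S where "S = (UNIV :: 'a set) - {0}"
  have "(\<Prod>y\<in>S. x * y) = \<Prod>S"
    by (rule prod.reindex_bij_witness[of _ "\<lambda>y. y / x" "\<lambda>y. x * y"]) (use False in \<open>auto simp: S_def\<close>)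
  then have "x ^ card S * \<Prod>S = 1 * \<Prod>S" by (simp add: prod.distrib)
  moreover have "\<Prod>S \<noteq> 0" by (simp add: S_def)
  ultimately have "x ^ card S = 1" using mult_right_cancel by blast
  moreover have "CARD('a) = Suc (card S)" unfolding S_def by (rule card.remove) auto
  ultimately show ?thesis by simp
qed simp

text \<open>The sum of all elements is invariant under translation by \<open>1\<close>, so the
  cardinality is zero in the field; if \<open>2\<close> were zero, an odd cardinality would equal
  \<open>1\<close>.\<close>

lemma odd_card_two_nonzero:
  assumes "odd CARD('a::{finite,field})"
  shows "(2 :: 'a) \<noteq> 0"
proof
  assume two: "(2 :: 'a) = 0"
  have "(\<Sum>x\<in>(UNIV :: 'a set). x) = (\<Sum>x\<in>(UNIV :: 'a set). x + 1)"
    by (rule sum.reindex_bij_witness[of _ "\<lambda>x. x + 1" "\<lambda>x. x - 1"]) auto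
  then have "of_nat CARD('a) = (0 :: 'a)" by (simp add: sum.distrib)
  moreover obtain m where "CARD('a) = 2 * m + 1" using assms by (rule oddE)
  ultimately show False using two by simp
qed

lemma square_class_eq: "square_class (d :: 'f::field) = {y\<^sup>2 * d | y. y \<noteq> 0}"
  unfolding square_class_def r_coset_def nonzero_squares_def by auto

section \<open>Characters of the maximal pro-2 quotient\<close>

lemma pro2_kernel_normal: "pro2_kernel K \<lhd> abs_Gal K"
proof -
  interpret group "abs_Gal K" by (rule group_abs_Gal)
  let ?F = "{N. N \<lhd> abs_Gal K \<and> openin (krull K) N \<and> (\<exists>n. order (abs_Gal K Mod N) = 2 ^ n)}"
  \<comment> \<open>The whole group, of index \<open>2 ^ 0\<close>, makes the family non-empty, so
    that its intersection is a subgroup.\<close>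
  have top: "carrier (abs_Gal K) \<in> ?F"
  proof (intro CollectI conjI exI[of _ 0])
    show n: "carrier (abs_Gal K) \<lhd> abs_Gal K" unfolding normal_inv_iff by (auto simp: subgroup_self intro!: comp_in_abs_Gal)
    show "openin (krull K) (carrier (abs_Gal K))" using openin_topspace[of "krull K"] by simp
    have "rcosets\<^bsub>abs_Gal K\<^esub> carrier (abs_Gal K) = {carrier (abs_Gal K)}"
      using coset_join2[OF _ subgroup_self] one_closed unfolding RCOSETS_def by auto
    then show "order (abs_Gal K Mod carrier (abs_Gal K)) = 2 ^ 0" by (simp add: order_def FactGroup_def)
  qed
  have "subgroup (\<Inter>?F) (abs_Gal K)"
    by (rule subgroups_Inter) (use top in \<open>auto simp: normal_inv_iff\<close>)
  then show ?thesis unfolding normal_inv_iff pro2_kernel_def[symmetric]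
    unfolding pro2_kernel_def using top by (auto simp: normal_inv_iff)
qed

locale quadratic_hom =
  fixes K :: "'b::field set" and ch :: "('b \<Rightarrow> 'b) \<Rightarrow> bit"
  assumes cont: "continuous_map (krull K) (discrete_topology UNIV) ch"
    and hom: "\<And>\<sigma> \<tau>. \<sigma> \<in> carrier (abs_Gal K) \<Longrightarrow> \<tau> \<in> carrier (abs_Gal K) \<Longrightarrow> ch (\<sigma> \<circ> \<tau>) = ch \<sigma> + ch \<tau>"
begin

abbreviation "G \<equiv> carrier (abs_Gal K)"

definition ker where "ker = {\<sigma> \<in> G. ch \<sigma> = 0}"

lemma ch_id: "ch id = 0"
  using hom[of id id] by simp

lemma ch_inv:
  assumes "\<sigma> \<in> G"
  shows "ch (inv\<^bsub>abs_Gal K\<^esub> \<sigma>) = ch \<sigma>"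
proof -
  interpret group "abs_Gal K" by (rule group_abs_Gal)
  have "inv\<^bsub>abs_Gal K\<^esub> \<sigma> \<circ> \<sigma> = id" using l_inv[OF assms] by simp
  then have "ch (inv\<^bsub>abs_Gal K\<^esub> \<sigma>) + ch \<sigma> = 0" using hom[OF inv_closed[OF assms] assms] ch_id by simp
  then show ?thesis by (cases "ch (inv\<^bsub>abs_Gal K\<^esub> \<sigma>)"; cases "ch \<sigma>") auto
qed

lemma ker_normal: "ker \<lhd> abs_Gal K"
proof -
  interpret group "abs_Gal K" by (rule group_abs_Gal)
  have "subgroup ker (abs_Gal K)"
    by (rule subgroupI) (auto simp: ker_def ch_inv hom ch_id comp_in_abs_Gal intro!: exI[of _ id])
  moreover have "x \<otimes>\<^bsub>abs_Gal K\<^esub> h \<otimes>\<^bsub>abs_Gal K\<^esub> inv\<^bsub>abs_Gal K\<^esub> x \<in> ker" if "x \<in> G" "h \<in> ker" for x h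
    using that inv_closed[OF that(1)] by (auto simp: ker_def hom comp_in_abs_Gal ch_inv)
  ultimately show ?thesis unfolding normal_inv_iff by blast
qed

text \<open>The cosets of the kernel correspond to the values of \<open>ch\<close>, so its index is
  \<open>1\<close> or \<open>2\<close> and it is one of the groups intersected in
  \<open>pro2_kernel\<close>.\<close>

lemma pro2_kernel_subset: "pro2_kernel K \<subseteq> ker"
proof -
  interpret normal ker "abs_Gal K" by (rule ker_normal)
  have "openin (krull K) ker" using cont unfolding continuous_krull_discrete ker_def by blast
  moreover have "\<exists>n. order (abs_Gal K Mod ker) = 2 ^ n"
  proof -
    have coset: "ker #>\<^bsub>abs_Gal K\<^esub> \<sigma> = {\<tau> \<in> G. ch \<tau> = ch \<sigma>}" if s: "\<sigma> \<in> G" for \<sigma>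
    proof
      show "ker #>\<^bsub>abs_Gal K\<^esub> \<sigma> \<subseteq> {\<tau> \<in> G. ch \<tau> = ch \<sigma>}"
      proof
        fix \<tau> assume "\<tau> \<in> ker #>\<^bsub>abs_Gal K\<^esub> \<sigma>"
        then obtain n where n: "n \<in> G" "ch n = 0" "\<tau> = n \<circ> \<sigma>" unfolding r_coset_def ker_def by auto
        show "\<tau> \<in> {\<tau> \<in> G. ch \<tau> = ch \<sigma>}" using hom[OF n(1) s] n comp_in_abs_Gal[OF n(1) s] by simp
      qed
      show "{\<tau> \<in> G. ch \<tau> = ch \<sigma>} \<subseteq> ker #>\<^bsub>abs_Gal K\<^esub> \<sigma>"
      proof
        fix \<tau> assume t: "\<tau> \<in> {\<tau> \<in> G. ch \<tau> = ch \<sigma>}"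
        define n where "n = \<tau> \<circ> inv_into UNIV \<sigma>"
        have n: "n \<in> G" unfolding n_def using t by (intro comp_in_abs_Gal inv_in_abs_Gal s) auto
        have ns: "n \<circ> \<sigma> = \<tau>" unfolding n_def using abs_Gal_bij[OF s] by (auto simp: fun_eq_iff bij_is_inj)
        have "ch n + ch \<sigma> = ch \<sigma>" using hom[OF n s] ns t by simp
        then have "ch n = 0" by (simp only: add_cancel_left_left)
        then have "n \<in> ker" using n unfolding ker_def by blast
        then show "\<tau> \<in> ker #>\<^bsub>abs_Gal K\<^esub> \<sigma>" unfolding r_coset_def by (rule UN_I) (simp add: ns)
      qed
    qed
    have "rcosets\<^bsub>abs_Gal K\<^esub> ker = (\<lambda>b. {\<tau> \<in> G. ch \<tau> = b}) ` ch ` G"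
      unfolding RCOSETS_def using coset by auto
    moreover have "inj_on (\<lambda>b. {\<tau> \<in> G. ch \<tau> = b}) (ch ` G)" by (auto simp: inj_on_def)
    ultimately have card: "order (abs_Gal K Mod ker) = card (ch ` G)"
      by (simp add: order_def FactGroup_def card_image)
    have "0 \<in> ch ` G" using ch_id id_in_abs_Gal by (metis image_eqI)
    moreover have sub: "ch ` G \<subseteq> {0, 1}"
    proof
      fix b :: bit show "b \<in> {0, 1}" by (cases b) simp_all
    qed
    ultimately have "card (ch ` G) > 0" "card (ch ` G) \<le> 2"
      using card_mono[OF _ sub] finite_subset[OF sub] by (auto simp: card_gt_0_iff)
    then have "card (ch ` G) = 2 ^ 0 \<or> card (ch ` G) = 2 ^ 1" by auto
    then show ?thesis unfolding card by blast
  qed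
  ultimately show ?thesis unfolding pro2_kernel_def using ker_normal by blast
qed

lemma ch_coset:
  assumes "\<tau> \<in> pro2_proj K \<sigma>" "\<sigma> \<in> G"
  shows "\<tau> \<in> G" "ch \<tau> = ch \<sigma>"
proof -
  obtain n where "n \<in> pro2_kernel K" "\<tau> = n \<circ> \<sigma>" using assms(1) unfolding pro2_proj_def r_coset_def by auto
  then show "\<tau> \<in> G" "ch \<tau> = ch \<sigma>" using pro2_kernel_subset assms(2) by (auto simp: ker_def hom comp_in_abs_Gal)
qed

lemma self_in_proj:
  assumes "\<sigma> \<in> G"
  shows "\<sigma> \<in> pro2_proj K \<sigma>"
proof -
  interpret normal "pro2_kernel K" "abs_Gal K" by (rule pro2_kernel_normal)
  show ?thesis unfolding pro2_proj_def by (rule rcos_self[OF assms subgroup_axioms])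
qed

text \<open>The image of the kernel is a closed subgroup of the quotient. If it contains a
  topological generator, it contains the closure of the generated subgroup, which is the whole image
  of \<open>J\<close>.\<close>

lemma vanishes_on_generated:
  assumes gen: "topological_generator_of K c (pro2_proj K ` J)" and J: "J \<subseteq> G" "\<sigma> \<in> J"
    and van: "\<And>\<tau>. \<tau> \<in> c \<Longrightarrow> ch \<tau> = 0"
  shows "ch \<sigma> = 0"
proof -
  interpret normal "pro2_kernel K" "abs_Gal K" by (rule pro2_kernel_normal)
  interpret Q: group "max_pro2 K" unfolding max_pro2_def by (rule factorgroup_is_group)
  have h: "pro2_proj K \<in> hom (abs_Gal K) (max_pro2 K)"
    unfolding max_pro2_def pro2_proj_def[abs_def] by (rule r_coset_hom_Mod)
  then interpret h: group_hom "abs_Gal K" "max_pro2 K" "pro2_proj K"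
    by unfold_locales
  define Z where "Z = pro2_proj K ` ker"
  have Zsub: "subgroup Z (max_pro2 K)"
    unfolding Z_def by (rule h.subgroup_img_is_subgroup) (use ker_normal in \<open>simp add: normal_def\<close>)
  have Zin: "pro2_proj K \<tau> \<in> Z \<longleftrightarrow> ch \<tau> = 0" if t: "\<tau> \<in> G" for \<tau>
  proof
    assume "pro2_proj K \<tau> \<in> Z"
    then obtain \<rho> where r: "\<rho> \<in> ker" "pro2_proj K \<tau> = pro2_proj K \<rho>" unfolding Z_def by blast
    then show "ch \<tau> = 0" using self_in_proj[OF t] ch_coset(2)[of \<tau> \<rho>] by (auto simp: ker_def)
  qed (use t in \<open>auto simp: Z_def ker_def\<close>)
  have carr: "carrier (max_pro2 K) = pro2_proj K ` G"
    unfolding max_pro2_def FactGroup_def RCOSETS_def pro2_proj_def by auto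
  have c: "c \<in> carrier (max_pro2 K)" "max_pro2_topology K closure_of generate (max_pro2 K) {c} = pro2_proj K ` J"
    using gen unfolding topological_generator_of_def by auto
  obtain \<rho> where r: "\<rho> \<in> G" "c = pro2_proj K \<rho>" using c(1) carr by blast
  have "c \<in> Z" using Zin[OF r(1)] van[of \<rho>] self_in_proj[OF r(1)] r(2) by simp
  then have "generate (max_pro2 K) {c} \<subseteq> Z" using Q.generate_subgroup_incl[OF _ Zsub] by blast
  moreover have "closedin (max_pro2_topology K) Z"
  proof -
    have top: "topspace (max_pro2_topology K) = carrier (max_pro2 K)"
    proof
      show "topspace (max_pro2_topology K) \<subseteq> carrier (max_pro2 K)"
        using openin_topspace[of "max_pro2_topology K"] unfolding openin_max_pro2_topology by blast
      have "{\<sigma> \<in> G. pro2_proj K \<sigma> \<in> carrier (max_pro2 K)} = G" using carr by blast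
      then have "openin (max_pro2_topology K) (carrier (max_pro2 K))"
        unfolding openin_max_pro2_topology using openin_topspace[of "krull K"] by simp
      then show "carrier (max_pro2 K) \<subseteq> topspace (max_pro2_topology K)" by (rule openin_subset)
    qed
    \<comment> \<open>Outside \<open>Z\<close> the character is \<open>1\<close>, so the complement
      has an open preimage by continuity.\<close>
    have "{\<sigma> \<in> G. pro2_proj K \<sigma> \<in> carrier (max_pro2 K) - Z} = {\<sigma> \<in> G. ch \<sigma> = 1}" using Zin carr by auto
    then have "openin (max_pro2_topology K) (carrier (max_pro2 K) - Z)"
      unfolding openin_max_pro2_topology using cont unfolding continuous_krull_discrete by auto
    moreover have "Z \<subseteq> carrier (max_pro2 K)" using Zsub by (rule subgroup.subset)
    ultimately show ?thesis unfolding closedin_def top by blast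
  qed
  ultimately have "pro2_proj K ` J \<subseteq> Z" using closure_of_minimal c(2) by metis
  then show ?thesis using Zin J by blast
qed

end

section \<open>Square roots over the base field and over its completions\<close>

locale rational_function_field =
  fixes \<iota> :: "'a::{finite,field} poly fract \<Rightarrow> 'b::field"
    and kv :: "('a poly fract \<Rightarrow> int) \<Rightarrow> 'c::field set"
    and val :: "('a poly fract \<Rightarrow> int) \<Rightarrow> 'c \<Rightarrow> int"
    and \<epsilon> :: "('a poly fract \<Rightarrow> int) \<Rightarrow> 'b \<Rightarrow> 'c"
    and \<sigma> :: "('a poly fract \<Rightarrow> int) \<Rightarrow> ('b \<Rightarrow> 'b) set"
    and Frob :: "('b \<Rightarrow> 'b) set"
  assumes q: "odd CARD('a)"
    and embedding: "\<iota> \<in> Ring.ring_hom type_ring type_ring"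
    and closure: "is_separable_closure_of (range \<iota>)"
    and local: "\<And>v. place v \<Longrightarrow> local_embedding \<iota> v (kv v) (val v) (\<epsilon> v)"
    and inertia: "\<And>v. place v \<Longrightarrow>
      topological_generator_of (range \<iota>) (\<sigma> v) (inertia_image2 (range \<iota>) (kv v) (val v) (\<epsilon> v))"
    and frobenius: "frobenius_lift \<iota> (kv infinite_place) (\<epsilon> infinite_place) Frob"
begin

sublocale \<iota>: field_hom \<iota>
  by (rule field_hom_type_ring[OF embedding])

abbreviation "k \<equiv> range \<iota>"
abbreviation "G \<equiv> carrier (abs_Gal k)"
abbreviation "GG \<equiv> insert Frob (\<sigma> ` Collect finite_place)"

lemma const_hom: "field_hom (\<lambda>c. \<iota> (to_fract [:c:]))"
proof
  show "\<iota> (to_fract [:0:]) = 0" by simp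
  show "\<iota> (to_fract [:1:]) = 1" by (simp flip: one_pCons)
  fix x y :: 'a
  show "\<iota> (to_fract [:x + y:]) = \<iota> (to_fract [:x:]) + \<iota> (to_fract [:y:])"
    unfolding \<iota>.hom_add[symmetric] to_fract_add[symmetric] by simp
  show "\<iota> (to_fract [:x * y:]) = \<iota> (to_fract [:x:]) * \<iota> (to_fract [:y:])"
    unfolding \<iota>.hom_mult[symmetric] to_fract_mult[symmetric] by simp
qed

lemma char_b: "CHAR('b) = CHAR('a)"
  using field_hom.CHAR_eq[OF const_hom] .

lemma prime_char: "Factorial_Ring.prime CHAR('a)"
proof -
  have "CHAR('a) > 0" using finite_imp_CHAR_pos[where ?'a = 'a] by simp
  then show ?thesis using prime_CHAR_semidom[where ?'a = 'a] by blast
qed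

lemma two_b: "(2 :: 'b) \<noteq> 0"
proof -
  interpret c: field_hom "\<lambda>c. \<iota> (to_fract [:c:])" by (rule const_hom)
  have "\<iota> (to_fract [:2:]) \<noteq> 0" using odd_card_two_nonzero[OF q] by simp
  moreover have "\<iota> (to_fract [:2:]) = 2" using c.hom_add[of 1 1] c.hom_one by simp
  ultimately show ?thesis by simp
qed

lemma sqrt_exists:
  assumes "d \<noteq> 0"
  shows "\<exists>r. r\<^sup>2 = \<iota> d \<and> r \<noteq> 0"
proof -
  define p where "p = [:- \<iota> d, 0, 1:]"
  have i0: "\<iota> d \<noteq> 0" using assms by simp
  have "separable_poly p" unfolding separable_poly_def
  proof (rule coprimeI)
    fix e assume e: "e dvd p" "e dvd pderiv p"
    have "pderiv p = [:0, 2:]" by (simp add: p_def pderiv_pCons)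
    \<comment> \<open>The combination \<open>X / 2\<close> times the derivative minus
      \<open>p\<close> is the non-zero constant \<open>\<iota> d\<close>; here \<open>2\<close> has
      to be invertible.\<close>
    then have "e dvd Polynomial.smult (inverse 2) [:0, 1:] * pderiv p - p"
      using e by (intro dvd_diff dvd_mult) auto
    also have "Polynomial.smult (inverse 2) [:0, 1:] * pderiv p - p = [:\<iota> d:]"
      using two_b \<open>pderiv p = [:0, 2:]\<close> by (simp add: p_def)
    finally have "e dvd [:\<iota> d:]" .
    then show "is_unit e" using i0 by (meson dvd_trans is_unit_triv)
  qed
  moreover have "Polynomial.degree p > 0" by (simp add: p_def)
  ultimately obtain r where "poly p r = 0" using closure unfolding is_separable_closure_of_def by blast
  then have "r\<^sup>2 = \<iota> d" by (simp add: p_def power2_eq_square)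
  moreover from this have "r \<noteq> 0" using i0 by auto
  ultimately show ?thesis by blast
qed

text \<open>\<open>chi\<close> quantifies over all square roots of all members of the class. They
  differ from the one root \<open>r\<close> by a sign and a factor from \<open>k\<close>, so testing
  \<open>r\<close> suffices.\<close>

lemma chi_square_class:
  assumes d: "d \<noteq> 0" and r: "r\<^sup>2 = \<iota> d" and s: "s \<in> G"
  shows "chi \<iota> (square_class d) s = (if s r = r then 0 else 1)"
proof -
  have "(\<forall>x. x\<^sup>2 \<in> \<iota> ` square_class d \<longrightarrow> s x = x) \<longleftrightarrow> s r = r"
  proof
    assume "\<forall>x. x\<^sup>2 \<in> \<iota> ` square_class d \<longrightarrow> s x = x"
    moreover have "d \<in> square_class d" unfolding square_class_eq by (auto intro!: exI[of _ 1])
    ultimately show "s r = r" using r by blast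
  next
    assume sr: "s r = r"
    show "\<forall>x. x\<^sup>2 \<in> \<iota> ` square_class d \<longrightarrow> s x = x"
    proof (intro allI impI)
      fix x assume "x\<^sup>2 \<in> \<iota> ` square_class d"
      then obtain y where "x\<^sup>2 = \<iota> (y\<^sup>2 * d)" unfolding square_class_eq by auto
      then have "x\<^sup>2 = (\<iota> y * r)\<^sup>2" by (simp add: \<iota>.hom_mult \<iota>.hom_power power_mult_distrib r)
      then have "x = \<iota> y * r \<or> x = - (\<iota> y * r)" by (simp add: power2_eq_iff)
      moreover have "s (\<iota> y * r) = \<iota> y * r" using abs_Gal_mult[OF s] abs_Gal_fix[OF s, of "\<iota> y"] sr by simp
      ultimately show "s x = x" using abs_Gal_uminus[OF s] by auto
    qed
  qed
  then show ?thesis unfolding chi_def by simp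
qed

lemma sqrt_sign:
  assumes "r\<^sup>2 = \<iota> d" "s \<in> G"
  shows "s r = r \<or> s r = - r"
proof -
  have "(s r)\<^sup>2 = r\<^sup>2" using abs_Gal_power[OF assms(2), of r 2] abs_Gal_fix[OF assms(2), of "\<iota> d"] assms(1) by simp
  then show ?thesis by (simp add: power2_eq_iff)
qed

lemma neg_ne: "r \<noteq> 0 \<Longrightarrow> - r \<noteq> (r :: 'b)"
  using two_b by (metis add_eq_0_iff mult_2 mult_eq_0_iff)

lemma quadratic_hom_chi:
  assumes d: "d \<noteq> 0"
  shows "quadratic_hom k (chi \<iota> (square_class d))"
proof -
  obtain r where r: "r\<^sup>2 = \<iota> d" "r \<noteq> 0" using sqrt_exists[OF d] by blast
  show ?thesis
  proof
    show "continuous_map (krull k) (discrete_topology UNIV) (chi \<iota> (square_class d))"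
      unfolding continuous_krull_discrete
      by (intro allI openin_krull_determined[of "{r}"]) (auto simp: chi_square_class[OF d r(1)])
    fix s t assume st: "s \<in> G" "t \<in> G"
    show "chi \<iota> (square_class d) (s \<circ> t) = chi \<iota> (square_class d) s + chi \<iota> (square_class d) t"
      using sqrt_sign[OF r(1) st(1)] sqrt_sign[OF r(1) st(2)] neg_ne[OF r(2)] abs_Gal_uminus[OF st(1)]
      by (auto simp: chi_square_class[OF d r(1)] st comp_in_abs_Gal)
  qed
qed

text \<open>By density of \<open>k\<close> the residue classes of the completion are those of
  \<open>k\<close>, and these are represented by the finitely many polynomials of degree less than
  that of \<open>\<pi>\<close>.\<close>

lemma complete_dvf_place:
  assumes "Factorial_Ring.irreducible \<pi>"
  defines "v \<equiv> poly_place.v \<pi>"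
  shows "complete_dvf (kv v) (val v) (\<epsilon> v (\<iota> (to_fract \<pi>)))
    ((\<lambda>r. \<epsilon> v (\<iota> (to_fract r))) ` {r. Polynomial.degree r < Polynomial.degree \<pi>})"
proof -
  interpret p: poly_place \<pi> by unfold_locales fact
  have "place v" unfolding v_def by (rule p.place_v)
  note L = local[OF this, unfolded local_embedding_def]
  interpret e: field_hom "\<epsilon> v" by (rule field_hom_type_ring) (use L in blast)
  have F: "subfield (kv v) type_ring" using L unfolding is_separable_closure_of_def by blast
  have inF: "\<epsilon> v (\<iota> x) \<in> kv v" for x using L by auto
  have wv: "x \<noteq> 0 \<Longrightarrow> val v (\<epsilon> v (\<iota> x)) = v x" for x using L by blast
  have vge: "val_ge (val v) (\<epsilon> v (\<iota> x)) n \<longleftrightarrow> val_ge v x n" for x n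
    using wv[of x] by (cases "x = 0") (auto simp: val_ge_def)
  have valu: "valuation_on (kv v) (val v)" using L by blast
  have vadd: "val_ge (val v) (x + y) n" if "x \<in> kv v" "y \<in> kv v" "val_ge (val v) x n" "val_ge (val v) y n" for x y n
    using valu that unfolding valuation_on_def val_ge_def by fastforce
  show ?thesis
  proof
    show "is_separable_closure_of (kv v)" "valuation_on (kv v) (val v)" using L by auto
    show "\<epsilon> v (\<iota> (to_fract \<pi>)) \<in> kv v" by (rule inF)
    show "\<epsilon> v (\<iota> (to_fract \<pi>)) \<noteq> 0" using p.pi0 by simp
    show "val v (\<epsilon> v (\<iota> (to_fract \<pi>))) = 1" using wv[of "to_fract \<pi>"] p.pi0 p.v_pi by (simp add: v_def)
    show "finite ((\<lambda>r. \<epsilon> v (\<iota> (to_fract r))) ` {r. Polynomial.degree r < Polynomial.degree \<pi>})"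
      using finite_degree_less by blast
    show "(\<lambda>r. \<epsilon> v (\<iota> (to_fract r))) ` {r. Polynomial.degree r < Polynomial.degree \<pi>} \<subseteq> kv v" using inF by blast
    show "Factorial_Ring.prime CHAR('c)" using e.CHAR_eq char_b prime_char by simp
    show "val_ge (val v) r 0" if r: "r \<in> (\<lambda>r. \<epsilon> v (\<iota> (to_fract r))) ` {r. Polynomial.degree r < Polynomial.degree \<pi>}" for r
    proof -
      obtain g where g: "r = \<epsilon> v (\<iota> (to_fract g))" using r by blast
      have "val_ge v (to_fract g) 0" using p.v_poly_ge[of g] by (cases "g = 0") (auto simp: val_ge_def v_def)
      then show ?thesis unfolding g vge .
    qed
    show "\<exists>y\<in>kv v. \<forall>N. \<exists>M. \<forall>n\<ge>M. val_ge (val v) (u n - y) N"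
      if "range u \<subseteq> kv v" "\<forall>N. \<exists>M. \<forall>m\<ge>M. \<forall>n\<ge>M. val_ge (val v) (u m - u n) N" for u :: "nat \<Rightarrow> 'c"
      using L that by blast
    fix y assume y: "y \<in> kv v" "val_ge (val v) y 0"
    have "\<forall>y\<in>kv v. \<forall>N. \<exists>x. val_ge (val v) (y - \<epsilon> v (\<iota> x)) N" using L by (elim conjE)
    then obtain x where x: "val_ge (val v) (y - \<epsilon> v (\<iota> x)) 1" using y(1) by blast
    have d: "y - \<epsilon> v (\<iota> x) \<in> kv v" using subfieldD(7)[OF F y(1) inF] .
    \<comment> \<open>Approximation to precision \<open>1\<close> keeps \<open>x\<close> integral at
      \<open>v\<close>, so that its residue class can be taken in \<open>k\<close>.\<close>
    have "val_ge (val v) (\<epsilon> v (\<iota> x)) 0"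
    proof -
      have "val_ge (val v) (\<epsilon> v (\<iota> x) - y) 1"
      proof -
        have "\<epsilon> v (\<iota> (- 1)) = - 1" by (simp add: \<iota>.hom_uminus e.hom_uminus)
        then have m1: "val v (- 1) = 0"
          using wv[of "- 1"] p.v_mult[of "- 1" "- 1"] p.v_1 by (simp add: v_def)
        have m1F: "- 1 \<in> kv v - {0}" using subfieldD(2,5)[OF F] by simp
        have "\<epsilon> v (\<iota> x) - y = (- 1) * (y - \<epsilon> v (\<iota> x))" by simp
        moreover have "val v ((- 1) * (y - \<epsilon> v (\<iota> x))) = val v (- 1) + val v (y - \<epsilon> v (\<iota> x))" if "y - \<epsilon> v (\<iota> x) \<noteq> 0"
          using valu m1F d that unfolding valuation_on_def by blast
        ultimately show ?thesis using x m1 unfolding val_ge_def by auto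
      qed
      then have "val_ge (val v) (\<epsilon> v (\<iota> x) - y) 0" unfolding val_ge_def by linarith
      from vadd[OF subfieldD(7)[OF F inF y(1)] y(1) this y(2)] show ?thesis by simp
    qed
    then have "val_ge v x 0" by (simp add: vge)
    then obtain r where r: "Polynomial.degree r < Polynomial.degree \<pi>" "val_ge v (x - to_fract r) 1"
      using p.residue_representative unfolding v_def by blast
    have "val_ge (val v) (\<epsilon> v (\<iota> (x - to_fract r)) + (y - \<epsilon> v (\<iota> x))) 1"
      by (rule vadd[OF inF d r(2)[folded vge] x])
    then have "val_ge (val v) (y - \<epsilon> v (\<iota> (to_fract r))) 1" by (simp add: \<iota>.hom_minus e.hom_minus)
    then show "\<exists>r\<in>(\<lambda>r. \<epsilon> v (\<iota> (to_fract r))) ` {r. Polynomial.degree r < Polynomial.degree \<pi>}. val_ge (val v) (y - r) 1"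
      using r(1) by blast
  qed
qed

text \<open>A local automorphism preserves the image of \<open>\<epsilon> v\<close>: it permutes the
  roots of a polynomial over \<open>k\<close>, and these already lie in the image because separable
  polynomials split in the smaller closure.\<close>

lemma restrict_local:
  assumes v: "place v" and t: "\<tau> \<in> carrier (abs_Gal (kv v))"
  shows "\<exists>s\<in>G. \<epsilon> v \<circ> s = \<tau> \<circ> \<epsilon> v"
proof -
  note L = local[OF v, unfolded local_embedding_def]
  interpret e: field_hom "\<epsilon> v" by (rule field_hom_type_ring) (use L in blast)
  have inF: "\<epsilon> v (\<iota> x) \<in> kv v" for x using L by auto
  have stab: "\<rho> (\<epsilon> v b) \<in> range (\<epsilon> v)" if r: "\<rho> \<in> carrier (abs_Gal (kv v))" for \<rho> b
  proof -
    obtain p where p: "separable_poly p" "\<forall>i. Polynomial.coeff p i \<in> k" "poly p b = 0" "p \<noteq> 0"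
      by (rule algebraic_over_closure[OF closure, of b])
    \<comment> \<open>Induction on the degree: a linear factor over \<open>'b\<close> is split off,
      and \<open>y\<close> is a root of that factor or of the rest.\<close>
    have split: "y \<in> range (\<epsilon> v)" if "separable_poly g" "poly (map_poly (\<epsilon> v) g) y = 0" for g y
      using that
    proof (induction "Polynomial.degree g" arbitrary: g rule: less_induct)
      case less
      have g0: "g \<noteq> 0" using less.prems(1) by (rule separable_poly_nonzero)
      have "Polynomial.degree g > 0"
      proof (rule ccontr)
        assume "\<not> ?thesis"
        then obtain c where "g = [:c:]" by (metis degree_eq_zeroE not_gr_zero)
        then show False using g0 less.prems(2) by simp
      qed
      then obtain a where a: "poly g a = 0" using less.prems(1) closure unfolding is_separable_closure_of_def by blast
      then obtain h where h: "g = [:- a, 1:] * h" by (metis dvdE poly_eq_0_iff_dvd)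
      have h0: "h \<noteq> 0" using g0 h by auto
      have deg: "Polynomial.degree g = Suc (Polynomial.degree h)"
        unfolding h by (subst degree_mult_eq) (use h0 in auto)
      have eq: "map_poly (\<epsilon> v) g = map_poly (\<epsilon> v) [:- a, 1:] * map_poly (\<epsilon> v) h"
        unfolding h by (rule e.map_poly_times)
      have "poly (map_poly (\<epsilon> v) [:- a, 1:]) y = 0 \<or> poly (map_poly (\<epsilon> v) h) y = 0"
        using less.prems(2) unfolding eq by (simp only: poly_mult mult_eq_0_iff)
      then show ?case
      proof
        assume "poly (map_poly (\<epsilon> v) [:- a, 1:]) y = 0"
        then have "y = \<epsilon> v a" by (simp add: e.map_poly_linear e.hom_uminus)
        then show ?thesis by blast
      next
        assume *: "poly (map_poly (\<epsilon> v) h) y = 0"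
        have "separable_poly h" using separable_poly_dvd[OF less.prems(1)] dvd_triv_right[of h "[:- a, 1:]"] unfolding h by blast
        then show ?thesis using less.hyps[of h] deg * by simp
      qed
    qed
    have co: "\<forall>i. Polynomial.coeff (map_poly (\<epsilon> v) p) i \<in> kv v"
      using p(2) inF by (simp add: coeff_map_poly) (metis imageE)
    have "poly (map_poly (\<epsilon> v) p) (\<rho> (\<epsilon> v b)) = \<rho> (poly (map_poly (\<epsilon> v) p) (\<epsilon> v b))"
      by (rule abs_Gal_poly[OF r co, symmetric])
    also have "\<dots> = 0" using p(3) abs_Gal_0[OF r] by (simp add: e.poly_map_poly_hom)
    finally show ?thesis using split[OF p(1)] by blast
  qed
  define s where "s x = inv_into UNIV (\<epsilon> v) (\<tau> (\<epsilon> v x))" for x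
  have es: "\<epsilon> v (s x) = \<tau> (\<epsilon> v x)" for x unfolding s_def using stab[OF t] by (simp add: f_inv_into_f)
  have inj: "\<epsilon> v x = \<epsilon> v y \<longleftrightarrow> x = y" for x y by simp
  have "surj s" unfolding surj_def
  proof
    fix y
    have t': "inv_into UNIV \<tau> \<in> carrier (abs_Gal (kv v))" using inv_in_abs_Gal[OF t] .
    obtain x where x: "inv_into UNIV \<tau> (\<epsilon> v y) = \<epsilon> v x" using stab[OF t'] by blast
    have "\<tau> (inv_into UNIV \<tau> (\<epsilon> v y)) = \<epsilon> v y" using abs_Gal_bij[OF t] by (simp add: bij_is_surj surj_f_inv_f)
    then have "\<epsilon> v (s x) = \<epsilon> v y" using es x by simp
    then show "\<exists>x. y = s x" using inj by metis
  qed
  moreover have "inj s"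
  proof (rule injI)
    fix x y assume "s x = s y"
    then have "\<tau> (\<epsilon> v x) = \<tau> (\<epsilon> v y)" using es by metis
    then show "x = y" using abs_Gal_inj[OF t] inj by simp
  qed
  moreover have "s (x + y) = s x + s y \<and> s (x * y) = s x * s y" for x y
  proof -
    have "\<epsilon> v (s (x + y)) = \<epsilon> v (s x + s y)" "\<epsilon> v (s (x * y)) = \<epsilon> v (s x * s y)"
      by (simp_all add: es e.hom_add e.hom_mult abs_Gal_add[OF t] abs_Gal_mult[OF t])
    then show ?thesis using inj by blast
  qed
  moreover have "s x = x" if "x \<in> k" for x
  proof -
    have "\<epsilon> v (s x) = \<epsilon> v x" unfolding es using that inF by (auto intro!: abs_Gal_fix[OF t])
    then show ?thesis using inj by blast
  qed
  ultimately have "s \<in> G" unfolding carrier_abs_Gal by (auto simp: bij_def)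
  then show ?thesis using es by (auto simp: fun_eq_iff)
qed

text \<open>The generator lies in the closure of the group it generates, so it is itself the class
  of an inertia element.\<close>

lemma sigma_proj:
  assumes "place v"
  obtains \<tau> where "\<tau> \<in> pull_along k (\<epsilon> v) (local_inertia (kv v) (val v))" "\<sigma> v = pro2_proj k \<tau>"
proof -
  let ?J = "pull_along k (\<epsilon> v) (local_inertia (kv v) (val v))"
  have g: "\<sigma> v \<in> carrier (max_pro2 k)" "max_pro2_topology k closure_of generate (max_pro2 k) {\<sigma> v} = pro2_proj k ` ?J"
    using inertia[OF assms] unfolding topological_generator_of_def inertia_image2_def by auto
  interpret normal "pro2_kernel k" "abs_Gal k" by (rule pro2_kernel_normal)
  interpret Q: group "max_pro2 k" unfolding max_pro2_def by (rule factorgroup_is_group)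
  have carr: "carrier (max_pro2 k) = pro2_proj k ` G"
    unfolding max_pro2_def FactGroup_def RCOSETS_def pro2_proj_def by auto
  have "{\<sigma> \<in> G. pro2_proj k \<sigma> \<in> carrier (max_pro2 k)} = G" using carr by blast
  then have "openin (max_pro2_topology k) (carrier (max_pro2 k))"
    unfolding openin_max_pro2_topology using openin_topspace[of "krull k"] by simp
  then have "carrier (max_pro2 k) \<subseteq> topspace (max_pro2_topology k)" by (rule openin_subset)
  moreover have "generate (max_pro2 k) {\<sigma> v} \<subseteq> carrier (max_pro2 k)" using Q.generate_incl g(1) by simp
  ultimately have "generate (max_pro2 k) {\<sigma> v} \<subseteq> max_pro2_topology k closure_of generate (max_pro2 k) {\<sigma> v}"
    by (intro closure_of_subset) blast
  moreover have "\<sigma> v \<in> generate (max_pro2 k) {\<sigma> v}" by (rule generate.incl) simp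
  ultimately show ?thesis using that g(2) by blast
qed

lemma pull_inertia_odd:
  assumes \<pi>: "Factorial_Ring.irreducible \<pi>" and d: "d \<noteq> 0" "odd (poly_place.v \<pi> d)" and r: "r\<^sup>2 = \<iota> d"
  defines "v \<equiv> poly_place.v \<pi>"
  shows "\<exists>s\<in>pull_along k (\<epsilon> v) (local_inertia (kv v) (val v)). s r = - r"
proof -
  interpret p: poly_place \<pi> by unfold_locales fact
  interpret c: complete_dvf "kv v" "val v" "\<epsilon> v (\<iota> (to_fract \<pi>))"
    "(\<lambda>r. \<epsilon> v (\<iota> (to_fract r))) ` {r. Polynomial.degree r < Polynomial.degree \<pi>}"
    unfolding v_def by (rule complete_dvf_place[OF \<pi>])
  have pv: "place v" unfolding v_def by (rule p.place_v)
  note L = local[OF pv, unfolded local_embedding_def]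
  interpret e: field_hom "\<epsilon> v" by (rule field_hom_type_ring) (use L in blast)
  have "\<exists>\<tau>\<in>local_inertia (kv v) (val v). \<tau> (\<epsilon> v r) = - \<epsilon> v r"
  proof (rule c.inertia_moves_ramified)
    show "(\<epsilon> v r)\<^sup>2 = \<epsilon> v (\<iota> d)" using r by (simp flip: e.hom_power)
    show "\<epsilon> v (\<iota> d) \<in> kv v" using L by auto
    show "\<epsilon> v (\<iota> d) \<noteq> 0" using d by simp
    show "odd (val v (\<epsilon> v (\<iota> d)))" using L d unfolding v_def by auto
  qed
  then obtain \<tau> where t: "\<tau> \<in> local_inertia (kv v) (val v)" "\<tau> (\<epsilon> v r) = - \<epsilon> v r" by blast
  then have "\<tau> \<in> carrier (abs_Gal (kv v))" by (simp add: local_inertia_def)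
  then obtain s where s: "s \<in> G" "\<epsilon> v \<circ> s = \<tau> \<circ> \<epsilon> v" using restrict_local[OF pv] by blast
  have "\<epsilon> v (s r) = \<epsilon> v (- r)" using fun_cong[OF s(2), of r] t(2) by (simp add: e.hom_uminus)
  then have "s r = - r" by simp
  moreover have "s \<in> pull_along k (\<epsilon> v) (local_inertia (kv v) (val v))" unfolding pull_along_def using s t(1) by blast
  ultimately show ?thesis by blast
qed

text \<open>Some inertia element moves the square root; if the character vanished on the generator,
  it would vanish on all of inertia.\<close>

lemma chi_sigma_ramified:
  assumes \<pi>: "Factorial_Ring.irreducible \<pi>" and d: "d \<noteq> 0" "odd (poly_place.v \<pi> d)" and s: "s \<in> \<sigma> (poly_place.v \<pi>)"
  shows "chi \<iota> (square_class d) s = 1"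
proof -
  interpret p: poly_place \<pi> by unfold_locales fact
  interpret q: quadratic_hom k "chi \<iota> (square_class d)" by (rule quadratic_hom_chi[OF d(1)])
  obtain r where r: "r\<^sup>2 = \<iota> d" "r \<noteq> 0" using sqrt_exists[OF d(1)] by blast
  let ?J = "pull_along k (\<epsilon> p.v) (local_inertia (kv p.v) (val p.v))"
  have JG: "?J \<subseteq> G" by (auto simp: pull_along_def)
  obtain t where t: "t \<in> ?J" "t r = - r" using pull_inertia_odd[OF \<pi> d r(1)] by blast
  then have ct: "chi \<iota> (square_class d) t = 1" using chi_square_class[OF d(1) r(1)] neg_ne[OF r(2)] JG by auto
  obtain \<tau> where \<tau>: "\<tau> \<in> ?J" "\<sigma> p.v = pro2_proj k \<tau>" using sigma_proj[OF p.place_v] by blast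
  have \<tau>G: "\<tau> \<in> G" using \<tau>(1) JG by blast
  have eq: "chi \<iota> (square_class d) s' = chi \<iota> (square_class d) \<tau>" if "s' \<in> \<sigma> p.v" for s'
    using q.ch_coset(2)[OF _ \<tau>G] that \<tau>(2) by simp
  have "chi \<iota> (square_class d) \<tau> \<noteq> 0"
  proof
    assume "chi \<iota> (square_class d) \<tau> = 0"
    then have "chi \<iota> (square_class d) t = 0"
      using q.vanishes_on_generated[OF inertia[OF p.place_v, unfolded inertia_image2_def] JG t(1)] eq by simp
    then show False using ct by simp
  qed
  then show ?thesis using eq[OF s] by simp
qed

lemma chi_sigma_unramified:
  assumes \<pi>: "Factorial_Ring.irreducible \<pi>" and d: "d \<noteq> 0" "poly_place.v \<pi> d = 0" and s: "s \<in> \<sigma> (poly_place.v \<pi>)"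
  shows "chi \<iota> (square_class d) s = 0"
proof -
  interpret p: poly_place \<pi> by unfold_locales fact
  interpret q: quadratic_hom k "chi \<iota> (square_class d)" by (rule quadratic_hom_chi[OF d(1)])
  obtain r where r: "r\<^sup>2 = \<iota> d" "r \<noteq> 0" using sqrt_exists[OF d(1)] by blast
  interpret c: complete_dvf "kv p.v" "val p.v" "\<epsilon> p.v (\<iota> (to_fract \<pi>))"
    "(\<lambda>r. \<epsilon> p.v (\<iota> (to_fract r))) ` {r. Polynomial.degree r < Polynomial.degree \<pi>}"
    by (rule complete_dvf_place[OF \<pi>])
  note L = local[OF p.place_v, unfolded local_embedding_def]
  interpret e: field_hom "\<epsilon> p.v" by (rule field_hom_type_ring) (use L in blast)
  let ?J = "pull_along k (\<epsilon> p.v) (local_inertia (kv p.v) (val p.v))"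
  obtain \<tau> where \<tau>: "\<tau> \<in> ?J" "\<sigma> p.v = pro2_proj k \<tau>" using sigma_proj[OF p.place_v] by blast
  have \<tau>G: "\<tau> \<in> G" using \<tau>(1) by (simp add: pull_along_def)
  obtain \<rho> where \<rho>: "\<rho> \<in> local_inertia (kv p.v) (val p.v)" "\<epsilon> p.v \<circ> \<tau> = \<rho> \<circ> \<epsilon> p.v"
    using \<tau>(1) unfolding pull_along_def by blast
  have "\<rho> (\<epsilon> p.v r) = \<epsilon> p.v r"
  proof (rule c.inertia_fixes_unramified)
    show "(\<epsilon> p.v r)\<^sup>2 = \<epsilon> p.v (\<iota> d)" using r(1) by (simp flip: e.hom_power)
    show "\<epsilon> p.v (\<iota> d) \<in> kv p.v" using L by auto
    show "\<epsilon> p.v (\<iota> d) \<noteq> 0" using d by simp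
    show "val p.v (\<epsilon> p.v (\<iota> d)) = 0" using L d by auto
    have "\<epsilon> p.v 2 \<noteq> 0" using two_b by (simp del: e.hom_numeral)
    moreover have "\<epsilon> p.v 2 = 2" using e.hom_add[of 1 1] by simp
    ultimately show "(2 :: 'c) \<noteq> 0" by simp
    show "\<rho> \<in> local_inertia (kv p.v) (val p.v)" by fact
  qed
  then have "\<epsilon> p.v (\<tau> r) = \<epsilon> p.v r" using fun_cong[OF \<rho>(2), of r] by simp
  then have "\<tau> r = r" by simp
  then have "chi \<iota> (square_class d) \<tau> = 0" using chi_square_class[OF d(1) r(1) \<tau>G] by simp
  then show ?thesis using q.ch_coset(2)[OF _ \<tau>G] s \<tau>(2) by simp
qed

text \<open>The square root of a constant lies in the quadratic extension of the constant field,
  where Frobenius is the power map. If fixed, it is a root of \<open>X ^ q - X\<close>, whose roots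
  are exhausted by the \<open>q\<close> constants.\<close>

lemma const_sqrt_fixed:
  assumes z: "z\<^sup>2 = \<iota> (to_fract [:c:])" "c \<noteq> 0" and s: "s \<in> Frob" "s z = z"
  shows "z \<in> k"
proof -
  interpret c: field_hom "\<lambda>c. \<iota> (to_fract [:c:])" by (rule const_hom)
  let ?q = "CARD('a)"
  have q0: "?q > 0" by simp
  have z0: "z \<noteq> 0" using z by auto
  have cq: "(\<iota> (to_fract [:c:])) ^ ?q = \<iota> (to_fract [:c:])" for c
    using finite_field_power[of c] by (metis c.hom_power)
  have "(z ^ ?q)\<^sup>2 = (z\<^sup>2) ^ ?q" by (simp add: power_mult[symmetric] mult.commute)
  also have "\<dots> = z\<^sup>2" unfolding z(1) by (rule cq)
  finally have zq: "z ^ ?q = z \<or> z ^ ?q = - z" by (simp add: power2_eq_iff)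
  \<comment> \<open>As \<open>q\<close> is odd, a sign survives the second power map, so
    \<open>z\<close> satisfies the equation of the field with \<open>q ^ 2\<close> elements; the
    exponent \<open>2 ^ 1\<close> brings it under \<open>frobenius_lift\<close>.\<close>
  have "z ^ (?q ^ (2 ^ 1)) = (z ^ ?q) ^ ?q" by (simp add: power_mult[symmetric] power2_eq_square)
  also have "\<dots> = z" using zq q by (auto simp: power_minus_odd)
  finally have "s z = z ^ ?q" using frobenius s(1) unfolding frobenius_lift_def by blast
  then have zz: "z ^ ?q = z" using s(2) by simp
  define P where "P = Polynomial.monom (1 :: 'b) ?q + (- Polynomial.monom 1 1)"
  have q1: "?q > 1"
  proof -
    have "card {0, 1 :: 'a} \<le> ?q" by (rule card_mono) auto
    then show ?thesis by simp
  qed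
  have degP: "Polynomial.degree P = ?q"
    unfolding P_def by (subst degree_add_eq_left) (use q1 in \<open>auto simp: degree_monom_eq\<close>)
  then have P0: "P \<noteq> 0" using q0 by auto
  have roots: "poly P x = 0 \<longleftrightarrow> x ^ ?q = x" for x by (simp add: P_def poly_monom)
  have "inj (\<lambda>c. \<iota> (to_fract [:c:]))" by (rule injI) simp
  then have card: "card (range (\<lambda>c. \<iota> (to_fract [:c:]))) = ?q" by (rule card_image)
  have "range (\<lambda>c. \<iota> (to_fract [:c:])) = {x. poly P x = 0}"
  proof (rule card_subset_eq)
    show fin: "finite {x. poly P x = 0}" using P0 by (rule poly_roots_finite)
    show sub: "range (\<lambda>c. \<iota> (to_fract [:c:])) \<subseteq> {x. poly P x = 0}" using cq roots by auto
    have "card {x. poly P x = 0} \<le> ?q" using card_poly_roots_bound[OF P0] degP by simp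
    then show "card (range (\<lambda>c. \<iota> (to_fract [:c:]))) = card {x. poly P x = 0}"
      using card card_mono[OF fin sub] by simp
  qed
  then show ?thesis using zz roots by blast
qed

theorem quadratic_hom_trivial:
  assumes "quadratic_hom k ch" and van: "vanishes_on GG ch" and s: "s \<in> G"
  shows "ch s = 0"
proof (rule ccontr)
  assume ne: "ch s \<noteq> 0"
  interpret q: quadratic_hom k ch by fact
  obtain x where x: "x \<noteq> 0" "x\<^sup>2 \<in> k" "\<forall>\<sigma>\<in>G. \<sigma> x = (if ch \<sigma> = 0 then x else - x)"
    using quadratic_character_root[OF closure q.cont q.hom] by blast
  obtain d where d: "x\<^sup>2 = \<iota> d" using x(2) by blast
  have d0: "d \<noteq> 0" using d x(1) by auto
  from square_class_ramified_or_const[OF d0]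
  show False
  proof (elim disjE exE conjE)
    fix \<pi> assume \<pi>: "Factorial_Ring.irreducible \<pi>" "odd (poly_place.v \<pi> d)"
    interpret p: poly_place \<pi> by unfold_locales fact
    let ?J = "pull_along k (\<epsilon> p.v) (local_inertia (kv p.v) (val p.v))"
    obtain t where t: "t \<in> ?J" "t x = - x" using pull_inertia_odd[OF \<pi>(1) d0 \<pi>(2) d] by blast
    have JG: "?J \<subseteq> G" by (auto simp: pull_along_def)
    have "\<sigma> p.v \<in> GG" using p.finite_place_v by blast
    then have van': "ch \<tau> = 0" if "\<tau> \<in> \<sigma> p.v" for \<tau> using van that unfolding vanishes_on_def by blast
    have gen: "topological_generator_of k (\<sigma> p.v) (pro2_proj k ` ?J)"
      using inertia[OF p.place_v] unfolding inertia_image2_def .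
    have "ch t = 0"
    proof (rule q.vanishes_on_generated[OF gen JG t(1)])
      fix \<tau> assume "\<tau> \<in> \<sigma> p.v"
      then show "ch \<tau> = 0" by (rule van')
    qed
    then have "t x = x" using bspec[OF x(3) subsetD[OF JG t(1)]] by simp
    then show False using t(2) neg_ne[OF x(1)] by simp
  next
    fix c y assume c: "c \<noteq> 0" "y \<noteq> 0" "d = to_fract [:c:] * y\<^sup>2"
    \<comment> \<open>Dividing by the square part leaves a square root of the constant
      \<open>c\<close>.\<close>
    define z where "z = x * inverse (\<iota> y)"
    have iy: "\<iota> y \<noteq> 0" using c(2) by simp
    have z2: "z\<^sup>2 = \<iota> (to_fract [:c:])" unfolding z_def power_mult_distrib d c(3)
      using iy by (simp add: \<iota>.hom_mult \<iota>.hom_power power_inverse)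
    obtain \<tau> where \<tau>: "\<tau> \<in> G" "Frob = pro2_proj k \<tau>"
      using frobenius unfolding frobenius_lift_def decomposition_image2_def pull_along_def by blast
    then have \<tau>F: "\<tau> \<in> Frob" using q.self_in_proj by simp
    then have "ch \<tau> = 0" using van unfolding vanishes_on_def by blast
    then have "\<tau> x = x" using bspec[OF x(3) \<tau>(1)] by simp
    moreover have "\<tau> (inverse (\<iota> y)) = inverse (\<iota> y)" using abs_Gal_inverse[OF \<tau>(1)] abs_Gal_fix[OF \<tau>(1), of "\<iota> y"] by simp
    ultimately have "\<tau> z = z" unfolding z_def by (simp add: abs_Gal_mult[OF \<tau>(1)])
    then obtain w where "z = \<iota> w" using const_sqrt_fixed[OF z2 c(1) \<tau>F] by blast
    \<comment> \<open>In the constant case \<open>x\<close> lies in \<open>k\<close>, so no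
      automorphism negates it.\<close>
    then have "x = \<iota> (w * y)" using iy unfolding z_def by (simp add: \<iota>.hom_mult field_simps)
    then have "s x = x" using abs_Gal_fix[OF s, of x] by blast
    moreover have "s x = - x" using bspec[OF x(3) s] ne by simp
    ultimately show False using neg_ne[OF x(1)] by simp
  qed
qed

end

subsection \<open>Expansion maps\<close>

lemma bit_add_self [simp]: "(a :: bit) + a = 0"
  by (cases a) auto

lemma bit_add_add [simp]: "(a :: bit) + (a + b) = b"
  by (simp add: add.assoc[symmetric])

lemma bit_add_eq_0: "(a :: bit) + b = 0 \<longleftrightarrow> a = b"
  by (cases a; cases b) auto

lemma bit_diff_eq: "(a :: bit) - b = c \<longleftrightarrow> b = a + c"
  by (cases a; cases b; cases c) auto

lemma sum_fun_app: "(\<Sum>i\<in>I. g i) y = (\<Sum>i\<in>I. g i y)"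
  by (induction I rule: infinite_finite_induct) (auto simp: zero_fun_def plus_fun_def)

lemma continuous_krull_plus:
  assumes "continuous_map (krull K) (discrete_topology UNIV) f" "continuous_map (krull K) (discrete_topology UNIV) g"
  shows "continuous_map (krull K) (discrete_topology UNIV) (\<lambda>s. f s + (g s :: bit))"
  unfolding continuous_krull_discrete
proof
  fix b :: bit
  have "{s \<in> carrier (abs_Gal K). f s + g s = b} =
    (\<Union>c. {s \<in> carrier (abs_Gal K). f s = c} \<inter> {s \<in> carrier (abs_Gal K). g s = b + c})"
  proof (intro equalityI subsetI)
    fix s assume "s \<in> {s \<in> carrier (abs_Gal K). f s + g s = b}"
    then show "s \<in> (\<Union>c. {s \<in> carrier (abs_Gal K). f s = c} \<inter> {s \<in> carrier (abs_Gal K). g s = b + c})"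
      by (auto simp: add.commute)
  next
    fix s assume "s \<in> (\<Union>c. {s \<in> carrier (abs_Gal K). f s = c} \<inter> {s \<in> carrier (abs_Gal K). g s = b + c})"
    then have "s \<in> carrier (abs_Gal K)" "g s = b + f s" by auto
    then show "s \<in> {s \<in> carrier (abs_Gal K). f s + g s = b}" by (simp add: add.commute[of b])
  qed
  moreover have "openin (krull K) {s \<in> carrier (abs_Gal K). f s = c}" "openin (krull K) {s \<in> carrier (abs_Gal K). g s = c}" for c
    using assms unfolding continuous_krull_discrete by blast+
  ultimately show "openin (krull K) {s \<in> carrier (abs_Gal K). f s + g s = b}"
    by (simp only:) (intro openin_Union ballI, auto intro!: openin_Int)
qed

lemma continuous_krull_res:
  assumes "continuous_map (krull K) (discrete_topology UNIV) f" "K \<subseteq> M"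
  shows "continuous_map (krull M) (discrete_topology UNIV) (res (carrier (abs_Gal M)) f)"
  unfolding continuous_krull_discrete
proof
  fix b
  have sub: "carrier (abs_Gal M) \<subseteq> carrier (abs_Gal K)" using assms(2) by (rule abs_Gal_anti_mono)
  have "openin (krull K) {s \<in> carrier (abs_Gal K). f s = b}" using assms(1) unfolding continuous_krull_discrete by blast
  then have *: "\<forall>s\<in>carrier (abs_Gal K). f s = b \<longrightarrow> (\<exists>A. finite A \<and> (\<forall>t\<in>carrier (abs_Gal K). (\<forall>x\<in>A. t x = s x) \<longrightarrow> f t = b))"
    unfolding openin_krull_iff by simp
  have "\<exists>A. finite A \<and> (\<forall>t\<in>carrier (abs_Gal M). (\<forall>x\<in>A. t x = s x) \<longrightarrow> f t = b)"
    if sM: "s \<in> carrier (abs_Gal M)" "f s = b" for s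
  proof -
    have "s \<in> carrier (abs_Gal K)" using sM(1) sub by blast
    then obtain A where A: "finite A" "\<forall>t\<in>carrier (abs_Gal K). (\<forall>x\<in>A. t x = s x) \<longrightarrow> f t = b"
      using * sM(2) by blast
    then have "\<forall>t\<in>carrier (abs_Gal M). (\<forall>x\<in>A. t x = s x) \<longrightarrow> f t = b" using subsetD[OF sub] by blast
    then show ?thesis using A(1) by blast
  qed
  moreover have "{s \<in> carrier (abs_Gal M). res (carrier (abs_Gal M)) f s = b} = {s \<in> carrier (abs_Gal M). f s = b}"
    by (auto simp: res_def)
  ultimately show "openin (krull M) {s \<in> carrier (abs_Gal M). res (carrier (abs_Gal M)) f s = b}"
    unfolding openin_krull_iff by auto
qed

lemma chi_id: "chi \<iota> c id = 0"
  by (simp add: chi_def)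

lemma chi_set_eq_0: "finite U \<Longrightarrow> c \<in> U \<Longrightarrow> chi \<iota> c s = 0 \<Longrightarrow> chi_set \<iota> U s = 0"
  unfolding chi_set_def by (rule prod_zero) auto

section \<open>Uniqueness of normalized families\<close>

context rational_function_field
begin

lemma phi_comp:
  assumes "phi_family \<iota> GG A c \<Phi>" "S \<subseteq> A" "s \<in> G" "t \<in> G"
  shows "\<Phi> S (s \<circ> t) = \<Phi> S s + \<Phi> S t + (\<Sum>U\<in>Pow S - {{}}. chi_set \<iota> U s * \<Phi> (S - U) t)"
proof -
  have "coboundary (\<Phi> S) s t = (\<Sum>U\<in>Pow S - {{}}. chi_set \<iota> U s * \<Phi> (S - U) t)"
    using assms unfolding phi_family_def by blast
  then show ?thesis unfolding coboundary_def bit_diff_eq .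
qed

lemma phi_continuous:
  assumes "phi_family \<iota> GG A c \<Phi>" "S \<subseteq> A"
  shows "continuous_map (krull k) (discrete_topology UNIV) (\<Phi> S)"
  using assms unfolding phi_family_def cochain2_def by blast

lemma phi_empty: "phi_family \<iota> GG A c \<Phi> \<Longrightarrow> s \<in> G \<Longrightarrow> \<Phi> {} s = chi \<iota> c s"
  unfolding phi_family_def by blast

lemma phi_vanishes: "phi_family \<iota> GG A c \<Phi> \<Longrightarrow> S \<subseteq> A \<Longrightarrow> S \<noteq> {} \<Longrightarrow> vanishes_on GG (\<Phi> S)"
  unfolding phi_family_def by blast

text \<open>By induction the lower members agree, so the two coboundaries coincide and the
  difference is a quadratic character vanishing on the generators. The families may have different
  index sets: this is what identifies maps chosen separately.\<close>

lemma phi_unique: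
  assumes fin: "finite S" and \<Phi>: "phi_family \<iota> GG A c \<Phi>" "phi_family \<iota> GG A' c \<Phi>'"
    and "S \<subseteq> A" "S \<subseteq> A'" "s \<in> G"
  shows "\<Phi> S s = \<Phi>' S s"
  using assms(1,4-6)
proof (induction S arbitrary: s rule: finite_psubset_induct)
  case (psubset S)
  show ?case
  proof (cases "S = {}")
    case True
    then show ?thesis using phi_empty \<Phi> psubset.prems(3) by metis
  next
    case False
    define D where "D t = \<Phi> S t + \<Phi>' S t" for t
    have "quadratic_hom k D"
    proof
      show "continuous_map (krull k) (discrete_topology UNIV) D" unfolding D_def
        using phi_continuous \<Phi> psubset.prems by (intro continuous_krull_plus) blast+
      fix t u assume tu: "t \<in> G" "u \<in> G"
      have "(\<Sum>U\<in>Pow S - {{}}. chi_set \<iota> U t * \<Phi> (S - U) u) = (\<Sum>U\<in>Pow S - {{}}. chi_set \<iota> U t * \<Phi>' (S - U) u)"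
      proof (rule sum.cong)
        fix U assume "U \<in> Pow S - {{}}"
        then have "S - U \<subset> S" by blast
        then have "\<Phi> (S - U) u = \<Phi>' (S - U) u" using psubset.IH[of "S - U" u] psubset.prems tu by blast
        then show "chi_set \<iota> U t * \<Phi> (S - U) u = chi_set \<iota> U t * \<Phi>' (S - U) u" by simp
      qed simp
      then show "D (t \<circ> u) = D t + D u" unfolding D_def
        using phi_comp[OF \<Phi>(1) psubset.prems(1) tu] phi_comp[OF \<Phi>(2) psubset.prems(2) tu]
        by (simp add: add_ac)
    qed
    moreover have "vanishes_on GG D"
      using phi_vanishes[OF \<Phi>(1) psubset.prems(1) False] phi_vanishes[OF \<Phi>(2) psubset.prems(2) False]
      unfolding vanishes_on_def D_def by fastforce
    ultimately have "D s = 0" using quadratic_hom_trivial psubset.prems(3) by blast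
    then show ?thesis unfolding D_def by (simp add: bit_add_eq_0)
  qed
qed

end

section \<open>The group fixing the field of definition\<close>

locale expansion = rational_function_field \<iota> kv val \<epsilon> \<sigma> Frob
  for \<iota> :: "'a::{finite,field} poly fract \<Rightarrow> 'b::field"
    and kv :: "('a poly fract \<Rightarrow> int) \<Rightarrow> 'c::field set" and val \<epsilon> \<sigma> Frob +
  fixes A :: "'a poly fract set set" and c and \<Phi> :: "'a poly fract set set \<Rightarrow> 'b cochain"
  assumes family: "phi_family \<iota> GG A c \<Phi>" and finA: "finite A" and cA: "c \<notin> A"
    and hom_chi: "\<And>b. b \<in> insert c A \<Longrightarrow> quadratic_hom k (chi \<iota> b)"
    and dual: "\<And>b. b \<in> insert c A \<Longrightarrow> \<exists>s\<in>G. chi \<iota> b s = 1 \<and> (\<forall>b'\<in>insert c A - {b}. chi \<iota> b' s = 0)"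
begin

lemma finite_sub: "S \<subseteq> A \<Longrightarrow> finite S"
  using finA finite_subset by blast

lemma chi_comp: "b \<in> insert c A \<Longrightarrow> s \<in> G \<Longrightarrow> t \<in> G \<Longrightarrow> chi \<iota> b (s \<circ> t) = chi \<iota> b s + chi \<iota> b t"
  using quadratic_hom.hom[OF hom_chi] .

text \<open>Every correction term carries a factor \<open>chi_set\<close> over a non-empty subset of
  \<open>S\<close>, and this factor vanishes at \<open>s\<close>.\<close>

lemma comp_fixed:
  assumes "S \<subseteq> A" "s \<in> G" "t \<in> G" "\<And>b. b \<in> S \<Longrightarrow> chi \<iota> b s = 0"
  shows "\<Phi> S (s \<circ> t) = \<Phi> S s + \<Phi> S t"
proof -
  have "(\<Sum>U\<in>Pow S - {{}}. chi_set \<iota> U s * \<Phi> (S - U) t) = 0"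
  proof (rule sum.neutral, rule ballI)
    fix U assume U: "U \<in> Pow S - {{}}"
    then obtain b where "b \<in> U" by blast
    then have "chi_set \<iota> U s = 0" using U assms(1,4) finite_sub by (intro chi_set_eq_0[of U b]) auto
    then show "chi_set \<iota> U s * \<Phi> (S - U) t = 0" by simp
  qed
  then show ?thesis using phi_comp[OF family assms(1-3)] by simp
qed

lemma phi_id: "S \<subseteq> A \<Longrightarrow> \<Phi> S id = 0"
  using comp_fixed[of S id id] by (simp add: chi_id)

text \<open>Elements that can be inserted into a product without changing any member of the family.
  The two-sided form makes normality evident; by \<open>N_I\<close> and \<open>N_D\<close> it
  amounts to the vanishing of all members and all characters.\<close>

definition N where
  "N = {n \<in> G. \<forall>S\<subseteq>A. \<forall>g\<in>G. \<forall>h\<in>G. \<Phi> S (g \<circ> n \<circ> h) = \<Phi> S (g \<circ> h)}"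

lemma N_I:
  assumes "n \<in> G" "\<And>b. b \<in> A \<Longrightarrow> chi \<iota> b n = 0" "\<And>S. S \<subseteq> A \<Longrightarrow> \<Phi> S n = 0"
  shows "n \<in> N"
  unfolding N_def
proof (intro CollectI conjI allI impI ballI assms(1))
  fix S g h assume S: "S \<subseteq> A" and g: "g \<in> G" and h: "h \<in> G"
  have nh: "\<Phi> T (n \<circ> h) = \<Phi> T h" if "T \<subseteq> A" for T
    using comp_fixed[OF that assms(1) h] assms(2,3) that by auto
  have "\<Phi> S (g \<circ> (n \<circ> h)) = \<Phi> S (g \<circ> h)"
  proof -
    have "\<Phi> (S - U) (n \<circ> h) = \<Phi> (S - U) h" for U using nh[of "S - U"] S by blast
    then show ?thesis
      unfolding phi_comp[OF family S g comp_in_abs_Gal[OF assms(1) h]] phi_comp[OF family S g h] nh[OF S] by simp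
  qed
  then show "\<Phi> S (g \<circ> n \<circ> h) = \<Phi> S (g \<circ> h)" by (simp add: comp_assoc)
qed

lemma N_D:
  assumes "n \<in> N"
  shows "n \<in> G" "S \<subseteq> A \<Longrightarrow> \<Phi> S n = 0" "b \<in> insert c A \<Longrightarrow> chi \<iota> b n = 0"
proof -
  show nG: "n \<in> G" using assms by (simp add: N_def)
  have inv: "\<Phi> S (g \<circ> n \<circ> h) = \<Phi> S (g \<circ> h)" if "S \<subseteq> A" "g \<in> G" "h \<in> G" for S g h
    using assms that unfolding N_def by blast
  show z: "\<Phi> S n = 0" if "S \<subseteq> A" for S using inv[OF that, of id id] phi_id[OF that] by simp
  show "chi \<iota> b n = 0" if b: "b \<in> insert c A"
  proof (cases "b = c")
    case True
    then show ?thesis using z[of "{}"] phi_empty[OF family nG] by simp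
  next
    case False
    then have bA: "b \<in> A" using b by blast
    then have bs: "{b} \<subseteq> A" by blast
    \<comment> \<open>With \<open>chi \<iota> c h = 1\<close> the correction term in the expansion
      of \<open>\<Phi> {b}\<close> at \<open>n \<circ> h\<close> is exactly
      \<open>chi \<iota> b n\<close>, which invariance then forces to vanish.\<close>
    obtain h where h: "h \<in> G" "chi \<iota> c h = 1" using dual[of c] by blast
    have "Pow {b} - {{}} = {{b}}" by auto
    then have "\<Phi> {b} (n \<circ> h) = \<Phi> {b} n + \<Phi> {b} h + chi \<iota> b n"
      using phi_comp[OF family bs nG h(1)] phi_empty[OF family h(1)] h(2) by (simp add: chi_set_def)
    moreover have "\<Phi> {b} (n \<circ> h) = \<Phi> {b} h" using inv[OF bs id_in_abs_Gal h(1)] by simp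
    ultimately have "\<Phi> {b} h + chi \<iota> b n = \<Phi> {b} h" using z[OF bs] by simp
    then show ?thesis by (simp only: add_cancel_left_right)
  qed
qed

lemma N_subgroup: "subgroup N (abs_Gal k)"
proof -
  interpret group "abs_Gal k" by (rule group_abs_Gal)
  have inv: "\<Phi> S (g \<circ> n \<circ> h) = \<Phi> S (g \<circ> h)" if "n \<in> N" "S \<subseteq> A" "g \<in> G" "h \<in> G" for n S g h
    using that unfolding N_def by blast
  show ?thesis
  proof (rule subgroupI)
    show "N \<subseteq> G" by (auto simp: N_def)
    have "id \<in> N" unfolding N_def by simp
    then show "N \<noteq> {}" by blast
    fix n assume n: "n \<in> N"
    then have nG: "n \<in> G" by (simp add: N_def)
    show "inv\<^bsub>abs_Gal k\<^esub> n \<in> N" unfolding N_def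
    proof (intro CollectI conjI allI impI ballI inv_closed nG)
      fix S g h assume S: "S \<subseteq> A" and g: "g \<in> G" and h: "h \<in> G"
      let ?m = "inv\<^bsub>abs_Gal k\<^esub> n"
      have m: "?m \<in> G" by (rule inv_closed[OF nG])
      have "n \<circ> ?m = id" using r_inv[OF nG] by simp
      then have "g \<circ> h = g \<circ> n \<circ> (?m \<circ> h)" by (metis comp_assoc comp_id id_comp)
      then have "\<Phi> S (g \<circ> h) = \<Phi> S (g \<circ> (?m \<circ> h))" using inv[OF n S g comp_in_abs_Gal[OF m h]] by simp
      then show "\<Phi> S (g \<circ> ?m \<circ> h) = \<Phi> S (g \<circ> h)" by (simp add: comp_assoc)
    qed
    fix m assume m: "m \<in> N"
    then have mG: "m \<in> G" by (simp add: N_def)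
    have "\<Phi> S (g \<circ> (n \<circ> m) \<circ> h) = \<Phi> S (g \<circ> h)" if "S \<subseteq> A" "g \<in> G" "h \<in> G" for S g h
      using inv[OF n that(1,2) comp_in_abs_Gal[OF mG that(3)]] inv[OF m that] by (simp add: comp_assoc)
    then show "n \<otimes>\<^bsub>abs_Gal k\<^esub> m \<in> N" unfolding N_def using comp_in_abs_Gal[OF nG mG] by simp
  qed
qed

lemma N_normal: "N \<lhd> abs_Gal k"
proof -
  interpret group "abs_Gal k" by (rule group_abs_Gal)
  have "x \<otimes>\<^bsub>abs_Gal k\<^esub> n \<otimes>\<^bsub>abs_Gal k\<^esub> inv\<^bsub>abs_Gal k\<^esub> x \<in> N" if x: "x \<in> G" and n: "n \<in> N" for x n
  proof -
    let ?y = "inv\<^bsub>abs_Gal k\<^esub> x"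
    have y: "?y \<in> G" by (rule inv_closed[OF x])
    have xy: "x \<circ> ?y = id" using r_inv[OF x] by simp
    have nG: "n \<in> G" using n by (simp add: N_def)
    have "\<Phi> S (g \<circ> (x \<circ> n \<circ> ?y) \<circ> h) = \<Phi> S (g \<circ> h)" if "S \<subseteq> A" "g \<in> G" "h \<in> G" for S g h
    proof -
      have "\<Phi> S ((g \<circ> x) \<circ> n \<circ> (?y \<circ> h)) = \<Phi> S ((g \<circ> x) \<circ> (?y \<circ> h))"
        using n that comp_in_abs_Gal[OF that(2) x] comp_in_abs_Gal[OF y that(3)] unfolding N_def by blast
      moreover have "(g \<circ> x) \<circ> (?y \<circ> h) = g \<circ> h" using xy by (metis comp_assoc comp_id)
      ultimately show ?thesis by (simp add: comp_assoc)
    qed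
    then show ?thesis unfolding N_def using comp_in_abs_Gal[OF comp_in_abs_Gal[OF x nG] y] by simp
  qed
  then show ?thesis unfolding normal_inv_iff using N_subgroup by blast
qed

lemma N_open: "openin (krull k) N"
proof -
  have "N = (\<Inter>b\<in>insert c A. {n \<in> G. chi \<iota> b n = 0}) \<inter> (\<Inter>S\<in>Pow A. {n \<in> G. \<Phi> S n = 0})"
  proof (intro equalityI subsetI)
    fix n assume "n \<in> (\<Inter>b\<in>insert c A. {n \<in> G. chi \<iota> b n = 0}) \<inter> (\<Inter>S\<in>Pow A. {n \<in> G. \<Phi> S n = 0})"
    then show "n \<in> N" by (intro N_I) auto
  qed (use N_D in auto)
  moreover have "openin (krull k) {n \<in> G. chi \<iota> b n = 0}" if "b \<in> insert c A" for b
    using quadratic_hom.cont[OF hom_chi[OF that]] unfolding continuous_krull_discrete by blast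
  then have "openin (krull k) (\<Inter>b\<in>insert c A. {n \<in> G. chi \<iota> b n = 0})"
    using finA by (intro openin_Inter) auto
  moreover have "openin (krull k) {n \<in> G. \<Phi> S n = 0}" if "S \<in> Pow A" for S
    using phi_continuous[OF family] that unfolding continuous_krull_discrete by blast
  then have "openin (krull k) (\<Inter>S\<in>Pow A. {n \<in> G. \<Phi> S n = 0})"
    using finA by (intro openin_Inter) auto
  ultimately show ?thesis by (simp add: openin_Int)
qed

text \<open>Left translation by the element dual to \<open>b\<close> turns \<open>\<Phi> S\<close> into \<open>\<Phi> (S - {b})\<close>, up to
  \<open>\<Phi> S\<close> and a constant; so invariance of the top map passes to the whole family.\<close>

lemma invariant_descends:
  assumes n: "n \<in> G" and top: "\<And>g h. g \<in> G \<Longrightarrow> h \<in> G \<Longrightarrow> \<Phi> A (g \<circ> n \<circ> h) = \<Phi> A (g \<circ> h)"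
  shows "n \<in> N"
proof -
  have descend: "\<forall>g\<in>G. \<forall>h\<in>G. \<Phi> (A - B) (g \<circ> n \<circ> h) = \<Phi> (A - B) (g \<circ> h)" if "finite B" "B \<subseteq> A" for B
    using that
  proof (induction B rule: finite_induct)
    case empty
    then show ?case unfolding Diff_empty using top by blast
  next
    case (insert b B)
    define S where "S = A - B"
    have S: "S \<subseteq> A" "b \<in> S" using insert by (auto simp: S_def)
    obtain d where d: "d \<in> G" "chi \<iota> b d = 1" "\<forall>b'\<in>insert c A - {b}. chi \<iota> b' d = 0"
      using dual[of b] insert.prems by blast
    have key: "\<Phi> (S - {b}) x = \<Phi> S (d \<circ> x) + \<Phi> S d + \<Phi> S x" if x: "x \<in> G" for x
    proof -
      \<comment> \<open>\<open>d\<close> is dual to \<open>b\<close>: every other non-empty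
        \<open>U\<close> contains some \<open>b'\<close> whose character vanishes at
        \<open>d\<close>.\<close>
      have "(\<Sum>U\<in>Pow S - {{}}. chi_set \<iota> U d * \<Phi> (S - U) x) = (\<Sum>U\<in>{{b}}. chi_set \<iota> U d * \<Phi> (S - U) x)"
      proof (rule sum.mono_neutral_right)
        show "finite (Pow S - {{}})" using finite_sub[OF S(1)] by simp
        show "{{b}} \<subseteq> Pow S - {{}}" using S(2) by auto
        show "\<forall>U\<in>Pow S - {{}} - {{b}}. chi_set \<iota> U d * \<Phi> (S - U) x = 0"
        proof
          fix U assume U: "U \<in> Pow S - {{}} - {{b}}"
          then obtain b' where b': "b' \<in> U" "b' \<noteq> b" by blast
          have "chi_set \<iota> U d = 0"
            using U b' S(1) d(3) by (intro chi_set_eq_0[of U b'] finite_sub) auto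
          then show "chi_set \<iota> U d * \<Phi> (S - U) x = 0" by simp
        qed
      qed
      also have "\<dots> = \<Phi> (S - {b}) x" using d(2) by (simp add: chi_set_def)
      finally have "\<Phi> S (d \<circ> x) = \<Phi> S d + \<Phi> S x + \<Phi> (S - {b}) x"
        using phi_comp[OF family S(1) d(1) x] by simp
      then show ?thesis by (simp add: add_ac)
    qed
    have IH: "\<Phi> S (g \<circ> n \<circ> h) = \<Phi> S (g \<circ> h)" if "g \<in> G" "h \<in> G" for g h
      using insert.IH insert.prems that unfolding S_def by blast
    have "\<Phi> (S - {b}) (g \<circ> n \<circ> h) = \<Phi> (S - {b}) (g \<circ> h)" if g: "g \<in> G" and h: "h \<in> G" for g h
    proof -
      have "\<Phi> S ((d \<circ> g) \<circ> n \<circ> h) = \<Phi> S ((d \<circ> g) \<circ> h)" using IH[OF comp_in_abs_Gal[OF d(1) g] h] .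
      then have "\<Phi> S (d \<circ> (g \<circ> n \<circ> h)) = \<Phi> S (d \<circ> (g \<circ> h))" by (simp add: comp_assoc)
      then show ?thesis
        unfolding key[OF comp_in_abs_Gal[OF comp_in_abs_Gal[OF g n] h]] key[OF comp_in_abs_Gal[OF g h]]
        using IH[OF g h] by simp
    qed
    moreover have eq: "A - insert b B = S - {b}" by (auto simp: S_def)
    ultimately show ?case unfolding eq by blast
  qed
  have "\<Phi> S (g \<circ> n \<circ> h) = \<Phi> S (g \<circ> h)" if Sgh: "S \<subseteq> A" "g \<in> G" "h \<in> G" for S g h
  proof -
    have "A - (A - S) = S" "finite (A - S)" "A - S \<subseteq> A" using Sgh(1) finA by auto
    then show ?thesis using descend[of "A - S"] Sgh(2,3) by metis
  qed
  then show ?thesis unfolding N_def using n by blast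
qed

text \<open>\<open>N\<close> is the greatest admissible subgroup: if the top map factors through a
  normal subgroup, its elements can be inserted into products without changing the value, and
  \<open>invariant_descends\<close> extends this to the whole family.\<close>

lemma field_of_definition_eq: "field_of_definition k (\<Phi> A) = fixed_field N"
proof -
  interpret group "abs_Gal k" by (rule group_abs_Gal)
  have "(GREATEST N. N \<lhd> abs_Gal k \<and> openin (krull k) N \<and> factors_through k N (\<Phi> A)) = N"
  proof (rule Greatest_equality)
    have "\<Phi> A s = \<Phi> A t" if st: "s \<in> G" "t \<in> G" "N #>\<^bsub>abs_Gal k\<^esub> s = N #>\<^bsub>abs_Gal k\<^esub> t" for s t
    proof -
      have "s \<in> N #>\<^bsub>abs_Gal k\<^esub> t" using rcos_self[OF st(1) N_subgroup] st(3) by simp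
      then obtain n where n: "n \<in> N" "s = n \<circ> t" unfolding r_coset_def by auto
      have "\<Phi> A (id \<circ> n \<circ> t) = \<Phi> A (id \<circ> t)" using n(1) st(2) unfolding N_def by (simp del: comp_id id_comp)
      then show ?thesis using n(2) by simp
    qed
    then show "N \<lhd> abs_Gal k \<and> openin (krull k) N \<and> factors_through k N (\<Phi> A)"
      using N_normal N_open unfolding factors_through_def by blast
    fix N' assume N': "N' \<lhd> abs_Gal k \<and> openin (krull k) N' \<and> factors_through k N' (\<Phi> A)"
    then interpret N': normal N' "abs_Gal k" by blast
    show "N' \<subseteq> N"
    proof
      fix n assume n: "n \<in> N'"
      then have nG: "n \<in> G" using N'.subset by blast
      show "n \<in> N"
      proof (rule invariant_descends[OF nG])
        fix g h assume gh: "g \<in> G" "h \<in> G"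
        let ?m = "g \<otimes>\<^bsub>abs_Gal k\<^esub> n \<otimes>\<^bsub>abs_Gal k\<^esub> inv\<^bsub>abs_Gal k\<^esub> g"
        have m: "?m \<in> N'" using N'.inv_op_closed2[OF gh(1) n] .
        have c: "g \<circ> h \<in> G" "g \<circ> n \<circ> h \<in> G" using gh nG by (auto intro!: comp_in_abs_Gal)
        have ig: "inv\<^bsub>abs_Gal k\<^esub> g \<circ> g = id" using l_inv[OF gh(1)] by simp
        \<comment> \<open>Normality moves the inserted element to the left end, where it only
          changes the representative of a right coset.\<close>
        have "g \<circ> n \<circ> h = ?m \<otimes>\<^bsub>abs_Gal k\<^esub> (g \<circ> h)"
        proof -
          have "?m \<otimes>\<^bsub>abs_Gal k\<^esub> (g \<circ> h) = g \<circ> n \<circ> (inv\<^bsub>abs_Gal k\<^esub> g \<circ> g) \<circ> h" by (simp add: comp_assoc)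
          then show ?thesis using ig by simp
        qed
        then have "g \<circ> n \<circ> h \<in> N' #>\<^bsub>abs_Gal k\<^esub> (g \<circ> h)" unfolding r_coset_def using m by blast
        then have "N' #>\<^bsub>abs_Gal k\<^esub> (g \<circ> h) = N' #>\<^bsub>abs_Gal k\<^esub> (g \<circ> n \<circ> h)"
          by (rule repr_independence[OF _ c(1) N'.subgroup_axioms])
        then show "\<Phi> A (g \<circ> n \<circ> h) = \<Phi> A (g \<circ> h)" using N' c unfolding factors_through_def by metis
      qed
    qed
  qed
  then show ?thesis unfolding field_of_definition_def by simp
qed

lemma fixes_field_of_definition:
  assumes "s \<in> G"
  shows "(\<forall>x\<in>field_of_definition k (\<Phi> A). s x = x) \<longleftrightarrow> s \<in> N"
proof
  assume "\<forall>x\<in>field_of_definition k (\<Phi> A). s x = x"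
  then show "s \<in> N"
    using fixed_field_open_subgroup[OF closure N_subgroup N_open assms] unfolding field_of_definition_eq by blast
qed (auto simp: field_of_definition_eq fixed_field_def)

end

declare One_nat_def [simp del]

section \<open>The given polynomials and elements dual to their characters\<close>

locale expansion_data = rational_function_field \<iota> kv val \<epsilon> \<sigma> Frob
  for \<iota> :: "'a::{finite,field} poly fract \<Rightarrow> 'b::field"
    and kv :: "('a poly fract \<Rightarrow> int) \<Rightarrow> 'c::field set" and val \<epsilon> \<sigma> Frob +
  fixes f :: "nat \<Rightarrow> 'a poly" and s :: nat
  assumes s: "s \<ge> 1"
    and polys: "\<And>i. i \<in> {1..s + 1} \<Longrightarrow> squarefree (f i) \<and> Polynomial.degree (f i) > 0"
    and pairwise_coprime: "\<And>i j. i \<in> {1..s + 1} \<Longrightarrow> j \<in> {1..s + 1} \<Longrightarrow> i \<noteq> j \<Longrightarrow> coprime (f i) (f j)"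
    and phi_i_exist: "\<And>i. i \<in> {1..s} \<Longrightarrow>
      phi_exists \<iota> GG ((\<lambda>i. square_class (to_fract (f i))) ` ({1..s} - {i})) (square_class (to_fract (f i)))"
    and phi_top_exists: "phi_exists \<iota> GG ((\<lambda>i. square_class (to_fract (f i))) ` {1..s}) (square_class (to_fract (f (s + 1))))"
begin

definition a where "a i = square_class (to_fract (f i))"

lemma a_eta: "(\<lambda>i. square_class (to_fract (f i))) = a"
  by (simp add: a_def fun_eq_iff)

lemma f0: "i \<in> {1..s + 1} \<Longrightarrow> f i \<noteq> 0"
  using polys by fastforce

lemma quadratic_hom_a: "i \<in> {1..s + 1} \<Longrightarrow> quadratic_hom k (chi \<iota> (a i))"
  unfolding a_def by (rule quadratic_hom_chi) (use f0 in simp)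

text \<open>An inertia generator at a prime dividing \<open>f j\<close> serves: squarefreeness gives
  \<open>f j\<close> the valuation \<open>1\<close> there, and coprimality gives the other
  polynomials the valuation \<open>0\<close>.\<close>

lemma dual_generator:
  assumes j: "j \<in> {1..s + 1}"
  shows "\<exists>x\<in>GG. \<exists>t\<in>x. t \<in> G \<and> (\<forall>l\<in>{1..s + 1}. chi \<iota> (a l) t = (if l = j then 1 else 0))"
proof -
  obtain \<pi> where \<pi>: "Factorial_Ring.irreducible \<pi>" "\<pi> dvd f j" using irreducible_divisor_poly polys[OF j] by blast
  interpret p: poly_place \<pi> by unfold_locales fact
  have x: "\<sigma> p.v \<in> GG" using p.finite_place_v by blast
  obtain \<tau> where \<tau>: "\<tau> \<in> pull_along k (\<epsilon> p.v) (local_inertia (kv p.v) (val p.v))" "\<sigma> p.v = pro2_proj k \<tau>"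
    using sigma_proj[OF p.place_v] by blast
  have \<tau>G: "\<tau> \<in> G" using \<tau>(1) by (simp add: pull_along_def)
  have t: "\<tau> \<in> \<sigma> p.v" using quadratic_hom.self_in_proj[OF quadratic_hom_a[OF j] \<tau>G] \<tau>(2) by simp
  have "chi \<iota> (a l) \<tau> = (if l = j then 1 else 0)" if l: "l \<in> {1..s + 1}" for l
  proof (cases "l = j")
    case True
    obtain g where g: "f j = \<pi> * g" using \<pi>(2) by (rule dvdE)
    have "\<not> \<pi> dvd g"
    proof
      assume "\<pi> dvd g"
      then obtain h where "g = \<pi> * h" by (rule dvdE)
      then have "\<pi>\<^sup>2 dvd f j" using g by (simp add: power2_eq_square)
      then have "is_unit \<pi>" using polys[OF j] unfolding squarefree_def by blast
      then show False using p.not_dvd_1 by blast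
    qed
    then have "p.v (to_fract (f j)) = 1" using p.v_to_fract[of g 1] g by simp
    then have "odd (p.v (to_fract (f j)))" by simp
    then show ?thesis unfolding a_def True
      using chi_sigma_ramified[OF \<pi>(1) _ _ t, of "to_fract (f j)"] f0[OF j] by simp
  next
    case False
    have "\<not> \<pi> dvd f l"
    proof
      assume dvd: "\<pi> dvd f l"
      have "is_unit \<pi>" by (rule coprime_common_divisor[OF pairwise_coprime[OF l j False] dvd \<pi>(2)])
      then show False using p.not_dvd_1 by blast
    qed
    then have "p.v (to_fract (f l)) = 0" using p.v_to_fract[of "f l" 0] by simp
    then show ?thesis unfolding a_def
      using chi_sigma_unramified[OF \<pi>(1) _ _ t, of "to_fract (f l)"] f0[OF l] False by simp
  qed
  then show ?thesis using x t \<tau>G by blast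
qed

text \<open>The dual elements separate the classes, so index sets can be traded for sets of
  classes.\<close>

lemma inj_a: "inj_on a {1..s + 1}"
proof (rule inj_onI)
  fix i j assume ij: "i \<in> {1..s + 1}" "j \<in> {1..s + 1}" "a i = a j"
  obtain t where "\<forall>l\<in>{1..s + 1}. chi \<iota> (a l) t = (if l = j then 1 else 0)" using dual_generator[OF ij(2)] by blast
  then have "chi \<iota> (a i) t = (if i = j then 1 else 0)" "chi \<iota> (a j) t = 1" using ij(1,2) by auto
  then show "i = j" using ij(3) by (auto split: if_splits)
qed

lemma expansionI:
  assumes fam: "phi_family \<iota> GG (a ` J) (a i) \<Phi>" and J: "J \<subseteq> {1..s + 1}" and i: "i \<in> {1..s + 1}" "i \<notin> J"
  shows "expansion \<iota> kv val \<epsilon> \<sigma> Frob (a ` J) (a i) \<Phi>"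
proof (intro expansion.intro expansion_axioms.intro)
  show "rational_function_field \<iota> kv val \<epsilon> \<sigma> Frob" by (rule rational_function_field_axioms)
  show "phi_family \<iota> GG (a ` J) (a i) \<Phi>" by fact
  have fJ: "finite J" using J finite_subset by blast
  then show "finite (a ` J)" by simp
  show "a i \<notin> a ` J"
  proof
    assume "a i \<in> a ` J"
    then obtain j where "j \<in> J" "a i = a j" by blast
    then show False using inj_onD[OF inj_a, of i j] J i by blast
  qed
  fix b assume "b \<in> insert (a i) (a ` J)"
  then obtain j where j: "j \<in> insert i J" "b = a j" by blast
  have jr: "j \<in> {1..s + 1}" using j(1) J i by blast
  then show "quadratic_hom k (chi \<iota> b)" unfolding j(2) by (rule quadratic_hom_a)
  obtain t where t: "t \<in> G" "\<forall>l\<in>{1..s + 1}. chi \<iota> (a l) t = (if l = j then 1 else 0)" using dual_generator[OF jr] by blast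
  have "chi \<iota> b' t = 0" if b': "b' \<in> insert (a i) (a ` J) - {b}" for b'
  proof -
    obtain l where l: "l \<in> insert i J" "b' = a l" using b' by blast
    then have "l \<noteq> j" "l \<in> {1..s + 1}" using b' j(2) J i by auto
    then show ?thesis using t(2) l(2) by simp
  qed
  moreover have "chi \<iota> b t = 1" using t(2) jr j(2) by simp
  ultimately show "\<exists>s\<in>G. chi \<iota> b s = 1 \<and> (\<forall>b'\<in>insert (a i) (a ` J) - {b}. chi \<iota> b' s = 0)" using t(1) by blast
qed

text \<open>A product of dual elements, one for each member of \<open>J\<close>.\<close>

lemma prescribed_signs:
  assumes "finite J" "J \<subseteq> {1..s + 1}"
  shows "\<exists>h\<in>G. \<forall>l\<in>{1..s + 1}. chi \<iota> (a l) h = (if l \<in> J then 1 else 0)"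
  using assms
proof (induction J rule: finite_induct)
  case empty
  have "\<forall>l\<in>{1..s + 1}. chi \<iota> (a l) id = (if l \<in> {} then 1 else 0)"
    by (rule ballI) (simp only: chi_id empty_iff if_False)
  then show ?case using id_in_abs_Gal by blast
next
  case (insert j J)
  obtain h where h: "h \<in> G" "\<forall>l\<in>{1..s + 1}. chi \<iota> (a l) h = (if l \<in> J then 1 else 0)" using insert by blast
  obtain t where t: "t \<in> G" "\<forall>l\<in>{1..s + 1}. chi \<iota> (a l) t = (if l = j then 1 else 0)"
    using dual_generator[of j] insert.prems by blast
  have "chi \<iota> (a l) (h \<circ> t) = (if l \<in> insert j J then 1 else 0)" if l: "l \<in> {1..s + 1}" for l
    using quadratic_hom.hom[OF quadratic_hom_a[OF l] h(1) t(1)] h(2) t(2) l insert.hyps by auto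
  then show ?case using comp_in_abs_Gal[OF h(1) t(1)] by blast
qed

subsection \<open>The multiquadratic field\<close>

abbreviation "A0 \<equiv> a ` {1..s}"
abbreviation "E \<equiv> sqrt_field \<iota> A0"
abbreviation "Q \<equiv> Gal E k"

definition r where "r i = (SOME x. x\<^sup>2 = \<iota> (to_fract (f i)) \<and> x \<noteq> 0)"

lemma r:
  assumes "i \<in> {1..s + 1}"
  shows "(r i)\<^sup>2 = \<iota> (to_fract (f i))" "r i \<noteq> 0"
  using someI_ex[OF sqrt_exists[of "to_fract (f i)"]] f0[OF assms] unfolding r_def by auto

lemma chi_a: "i \<in> {1..s + 1} \<Longrightarrow> h \<in> G \<Longrightarrow> chi \<iota> (a i) h = (if h (r i) = r i then 0 else 1)"
  unfolding a_def by (rule chi_square_class) (use f0 r in auto)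

lemma subfield_E: "subfield E type_ring"
  unfolding sqrt_field_def by (rule subfield_generate_field)

lemma k_E: "k \<subseteq> E"
  unfolding sqrt_field_def by (rule order.trans[OF Un_upper1 generate_field_superset])

lemma r_E: "i \<in> {1..s} \<Longrightarrow> r i \<in> E"
proof -
  assume i: "i \<in> {1..s}"
  have "to_fract (f i) \<in> a i" unfolding a_def square_class_eq by (auto intro!: exI[of _ 1])
  then have "r i \<in> {x. \<exists>c\<in>A0. x\<^sup>2 \<in> \<iota> ` c}" using r(1)[of i] i by auto
  then show ?thesis unfolding sqrt_field_def by (intro subsetD[OF generate_field_superset] UnI2)
qed

text \<open>\<open>E\<close> is generated over \<open>k\<close> by all square roots of all members
  of the classes. Each is, up to sign, a multiple of some \<open>r i\<close> by an element of
  \<open>k\<close>, so it is enough to test the \<open>r i\<close>.\<close>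

lemma E_least:
  assumes D: "subfield D type_ring" "k \<subseteq> D" "\<And>i. i \<in> {1..s} \<Longrightarrow> r i \<in> D"
  shows "E \<subseteq> D"
  unfolding sqrt_field_def
proof (rule generate_field_least[OF D(1)], rule Un_least[OF D(2)], rule subsetI)
  fix x assume "x \<in> {x. \<exists>c\<in>A0. x\<^sup>2 \<in> \<iota> ` c}"
  then obtain i z where i: "i \<in> {1..s}" "z \<in> a i" "x\<^sup>2 = \<iota> z" by auto
  then obtain y where y: "z = y\<^sup>2 * to_fract (f i)" unfolding a_def square_class_eq by blast
  have "x\<^sup>2 = (\<iota> y * r i)\<^sup>2" using r(1)[of i] i by (simp add: y \<iota>.hom_mult \<iota>.hom_power power_mult_distrib)
  then have "x = \<iota> y * r i \<or> x = - (\<iota> y * r i)" by (simp add: power2_eq_iff)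
  moreover have "\<iota> y * r i \<in> D" using D(2) by (intro subfieldD(4)[OF D(1)] D(3) i(1)) blast
  ultimately show "x \<in> D" using subfieldD(5)[OF D(1)] by auto
qed

lemma agree_on_E:
  assumes "h \<in> G" "h' \<in> G" "\<And>i. i \<in> {1..s} \<Longrightarrow> h (r i) = h' (r i)" "x \<in> E"
  shows "h x = h' x"
proof -
  have "E \<subseteq> {x. h x = h' x}"
  proof (rule E_least)
    show "subfield {x. h x = h' x} type_ring" unfolding subfield_type_ring_iff
      using abs_Gal_1[OF assms(1)] abs_Gal_1[OF assms(2)]
      by (auto simp: abs_Gal_add[OF assms(1)] abs_Gal_add[OF assms(2)] abs_Gal_mult[OF assms(1)] abs_Gal_mult[OF assms(2)]
          abs_Gal_uminus[OF assms(1)] abs_Gal_uminus[OF assms(2)] abs_Gal_inverse[OF assms(1)] abs_Gal_inverse[OF assms(2)])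
    show "k \<subseteq> {x. h x = h' x}" using abs_Gal_fix[OF assms(1)] abs_Gal_fix[OF assms(2)] by auto
  qed (use assms(3) in auto)
  then show ?thesis using assms(4) by blast
qed

lemma same_chi_agree:
  assumes h: "h \<in> G" "h' \<in> G" "\<And>i. i \<in> {1..s} \<Longrightarrow> chi \<iota> (a i) h = chi \<iota> (a i) h'" "x \<in> E"
  shows "h x = h' x"
proof (rule agree_on_E[OF h(1,2) _ h(4)])
  fix i assume i: "i \<in> {1..s}"
  then have i': "i \<in> {1..s + 1}" by simp
  show "h (r i) = h' (r i)"
    using h(3)[OF i] chi_a[OF i' h(1)] chi_a[OF i' h(2)] sqrt_sign[OF r(1)[OF i'] h(1)] sqrt_sign[OF r(1)[OF i'] h(2)]
    by (auto split: if_splits)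
qed

lemma G_stable_E:
  assumes h: "h \<in> G"
  shows "h ` E \<subseteq> E"
proof -
  note ES = subfieldD[OF subfield_E]
  have "E \<subseteq> {x. h x \<in> E}"
  proof (rule E_least)
    show "subfield {x. h x \<in> E} type_ring" unfolding subfield_type_ring_iff
      by (auto simp: abs_Gal_1[OF h] abs_Gal_add[OF h] abs_Gal_mult[OF h] abs_Gal_uminus[OF h] abs_Gal_inverse[OF h] intro: ES)
    show "k \<subseteq> {x. h x \<in> E}" using abs_Gal_fix[OF h] k_E by auto
    fix i assume i: "i \<in> {1..s}"
    then have i': "i \<in> {1..s + 1}" by simp
    show "r i \<in> {x. h x \<in> E}" using sqrt_sign[OF r(1)[OF i'] h] r_E[OF i] ES(5)[OF r_E[OF i]] by auto
  qed
  then show ?thesis by blast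
qed

lemma restrict_Q:
  assumes h: "h \<in> G"
  shows "restrict h E \<in> carrier Q"
proof -
  have "bij_betw h E E" unfolding bij_betw_def
  proof
    show "inj_on h E" using abs_Gal_inj[OF h] by (auto simp: inj_on_def)
    show "h ` E = E"
    proof
      show "E \<subseteq> h ` E"
      proof
        fix x assume "x \<in> E"
        then have "inv_into UNIV h x \<in> E" using G_stable_E[OF inv_in_abs_Gal[OF h]] by blast
        moreover have "h (inv_into UNIV h x) = x" using abs_Gal_bij[OF h] by (simp add: bij_is_surj surj_f_inv_f)
        ultimately show "x \<in> h ` E" by (metis image_eqI)
      qed
    qed (rule G_stable_E[OF h])
  qed
  moreover have "bij_betw (restrict h E) E E \<longleftrightarrow> bij_betw h E E" by (rule bij_betw_cong) simp
  ultimately have "bij_betw (restrict h E) E E" by blast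
  moreover have "\<iota> x \<in> E" for x using k_E by blast
  ultimately show ?thesis unfolding Gal_def
    using subfieldD(3,4)[OF subfield_E] abs_Gal_add[OF h] abs_Gal_mult[OF h] abs_Gal_fix[OF h] k_E by auto
qed

text \<open>The lift is a product of dual elements with the same signs as \<open>g\<close> on the
  chosen roots; it agrees with \<open>g\<close> on \<open>E\<close> because both are determined by
  these roots.\<close>

lemma lift_Q:
  assumes g: "g \<in> carrier Q"
  shows "\<exists>h\<in>G. restrict h E = g"
proof -
  note ES = subfieldD[OF subfield_E]
  have g': "g \<in> extensional E" "\<And>x y. x \<in> E \<Longrightarrow> y \<in> E \<Longrightarrow> g (x + y) = g x + g y"
    "\<And>x y. x \<in> E \<Longrightarrow> y \<in> E \<Longrightarrow> g (x * y) = g x * g y" "\<And>x. x \<in> k \<Longrightarrow> g x = x"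
    using g unfolding Gal_def by auto
  \<comment> \<open>The roots that \<open>g\<close> moves, hence negates; the lift has to negate the
    same ones.\<close>
  define J where "J = {i \<in> {1..s}. g (r i) \<noteq> r i}"
  obtain h where h: "h \<in> G" "\<forall>l\<in>{1..s + 1}. chi \<iota> (a l) h = (if l \<in> J then 1 else 0)"
    using prescribed_signs[of J] unfolding J_def by force
  have one: "(1 :: 'b) \<in> k" using \<iota>.hom_one by (metis rangeI)
  have mone: "(- 1 :: 'b) \<in> k" using \<iota>.hom_uminus[of 1] \<iota>.hom_one by (metis rangeI)
  have zero: "(0 :: 'b) \<in> k" using \<iota>.hom_zero by (metis rangeI)
  have "E \<subseteq> {x \<in> E. h x = g x}"
  proof (rule E_least)
    show "subfield {x \<in> E. h x = g x} type_ring" unfolding subfield_type_ring_iff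
    proof (intro conjI ballI)
      show "1 \<in> {x \<in> E. h x = g x}" using ES(2) g'(4)[OF one] abs_Gal_1[OF h(1)] by simp
      fix x assume x: "x \<in> {x \<in> E. h x = g x}"
      have "g ((- 1) * x) = g (- 1) * g x" using x ES(2,5) by (intro g'(3)) auto
      then have "g (- x) = - g x" using g'(4)[OF mone] by simp
      then show "- x \<in> {x \<in> E. h x = g x}" using x ES(5) abs_Gal_uminus[OF h(1)] by simp
      have "g (inverse x) = inverse (g x)"
      proof (cases "x = 0")
        case True
        then show ?thesis using g'(4)[OF zero] by simp
      next
        case False
        have "g (x * inverse x) = g x * g (inverse x)" using x ES(6) by (intro g'(3)) auto
        then have "g x * g (inverse x) = 1" using False g'(4)[OF one] by simp
        then show ?thesis by (metis inverse_unique)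
      qed
      then show "inverse x \<in> {x \<in> E. h x = g x}" using x ES(6) abs_Gal_inverse[OF h(1)] by simp
      fix y assume y: "y \<in> {x \<in> E. h x = g x}"
      show "x + y \<in> {x \<in> E. h x = g x}" "x * y \<in> {x \<in> E. h x = g x}"
        using x y ES(3,4) g'(2,3) abs_Gal_add[OF h(1)] abs_Gal_mult[OF h(1)] by auto
    qed
    show "k \<subseteq> {x \<in> E. h x = g x}" using k_E g'(4) abs_Gal_fix[OF h(1)] by auto
    fix i assume i: "i \<in> {1..s}"
    then have i': "i \<in> {1..s + 1}" by simp
    have rE: "r i \<in> E" by (rule r_E[OF i])
    have "(g (r i))\<^sup>2 = g ((r i)\<^sup>2)" using g'(3)[OF rE rE] by (simp add: power2_eq_square)
    also have "\<dots> = (r i)\<^sup>2" unfolding r(1)[OF i'] by (rule g'(4)) simp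
    finally have gs: "g (r i) = r i \<or> g (r i) = - r i" by (simp add: power2_eq_iff)
    have "h (r i) = g (r i)"
    proof (cases "i \<in> J")
      case True
      then have "h (r i) \<noteq> r i" using h(2) i' chi_a[OF i' h(1)] by auto
      then have "h (r i) = - r i" using sqrt_sign[OF r(1)[OF i'] h(1)] by blast
      then show ?thesis using True gs unfolding J_def by auto
    next
      case False
      then have "chi \<iota> (a i) h = 0" using h(2) i' by simp
      then have "h (r i) = r i" using chi_a[OF i' h(1)] by (metis zero_neq_one)
      then show ?thesis using False i unfolding J_def by auto
    qed
    then show "r i \<in> {x \<in> E. h x = g x}" using rE by simp
  qed
  then have "restrict h E = g" using g'(1) by (intro extensionalityI[of _ E]) auto
  then show ?thesis using h(1) by blast
qed

text \<open>The same choice as inside \<open>conj_char\<close>, so that it can be folded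
  there.\<close>

definition lift where "lift g = (SOME h. h \<in> G \<and> restrict h E = g)"

lemma lift:
  assumes "g \<in> carrier Q"
  shows "lift g \<in> G" "restrict (lift g) E = g"
proof -
  have "\<exists>h. h \<in> G \<and> restrict h E = g" using lift_Q[OF assms] by blast
  from someI_ex[OF this] show "lift g \<in> G" "restrict (lift g) E = g" unfolding lift_def by auto
qed

lemma lift_eqI:
  assumes "g \<in> carrier Q" "g' \<in> carrier Q" "\<And>i. i \<in> {1..s} \<Longrightarrow> chi \<iota> (a i) (lift g) = chi \<iota> (a i) (lift g')"
  shows "g = g'"
proof -
  have "restrict (lift g) E = restrict (lift g') E"
    using same_chi_agree[OF lift(1)[OF assms(1)] lift(1)[OF assms(2)] assms(3)] by (intro restrict_ext) blast
  then show ?thesis using lift(2) assms(1,2) by metis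
qed

lemma finite_Q: "finite (carrier Q)"
proof -
  have "inj_on (\<lambda>g. {i \<in> {1..s}. chi \<iota> (a i) (lift g) = 0}) (carrier Q)"
  proof (rule inj_onI)
    fix g g' assume gg: "g \<in> carrier Q" "g' \<in> carrier Q"
      "{i \<in> {1..s}. chi \<iota> (a i) (lift g) = 0} = {i \<in> {1..s}. chi \<iota> (a i) (lift g') = 0}"
    show "g = g'"
    proof (rule lift_eqI[OF gg(1,2)])
      fix i assume "i \<in> {1..s}"
      then have "chi \<iota> (a i) (lift g) = 0 \<longleftrightarrow> chi \<iota> (a i) (lift g') = 0" using gg(3) by blast
      then show "chi \<iota> (a i) (lift g) = chi \<iota> (a i) (lift g')"
        by (cases "chi \<iota> (a i) (lift g)"; cases "chi \<iota> (a i) (lift g')") auto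
    qed
  qed
  then show ?thesis
    by (rule inj_on_finite[where B = "Pow {1..s}"]) auto
qed

lemma chi_set_A0: "chi_set \<iota> A0 h = (\<Prod>i\<in>{1..s}. chi \<iota> (a i) h)"
  unfolding chi_set_def using inj_on_subset[OF inj_a, of "{1..s}"] by (simp add: prod.reindex)

lemma chi_set_eq_1_iff: "chi_set \<iota> A0 h = 1 \<longleftrightarrow> (\<forall>i\<in>{1..s}. chi \<iota> (a i) h = 1)"
proof
  assume *: "chi_set \<iota> A0 h = 1"
  show "\<forall>i\<in>{1..s}. chi \<iota> (a i) h = 1"
  proof
    fix i assume "i \<in> {1..s}"
    then have "chi \<iota> (a i) h \<noteq> 0" using * unfolding chi_set_A0 by (metis finite_atLeastAtMost prod_zero_iff zero_neq_one)
    then show "chi \<iota> (a i) h = 1" by (cases "chi \<iota> (a i) h") auto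
  qed
qed (simp add: chi_set_A0)

text \<open>Exactly one element of \<open>Q\<close> changes the sign of every \<open>\<surd>a\<^sub>i\<close>.\<close>

lemma sum_chi_set_Q: "(\<Sum>g\<in>carrier Q - {\<one>\<^bsub>Q\<^esub>}. chi_set \<iota> A0 (lift g)) = 1"
proof -
  obtain h where h: "h \<in> G" "\<forall>l\<in>{1..s + 1}. chi \<iota> (a l) h = (if l \<in> {1..s} then 1 else 0)"
    using prescribed_signs[of "{1..s}"] by force
  define g1 where "g1 = restrict h E"
  have g1: "g1 \<in> carrier Q" unfolding g1_def by (rule restrict_Q[OF h(1)])
  have agree: "lift g1 x = h x" if "x \<in> E" for x using fun_cong[OF lift(2)[OF g1], of x] that by (simp add: g1_def)
  have one1: "chi \<iota> (a i) (lift g1) = 1" if i: "i \<in> {1..s}" for i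
    using chi_a[OF _ lift(1)[OF g1], of i] chi_a[OF _ h(1), of i] h(2) i agree[OF r_E[OF i]] by simp
  have oneQ: "\<one>\<^bsub>Q\<^esub> = restrict id E" by (auto simp: Gal_def restrict_def)
  \<comment> \<open>The element negating all roots moves \<open>r 1\<close>, so it survives the
    removal of the identity; this is where at least one index is required.\<close>
  have "g1 \<noteq> \<one>\<^bsub>Q\<^esub>"
  proof
    assume "g1 = \<one>\<^bsub>Q\<^esub>"
    then have "restrict h E (r 1) = restrict id E (r 1)" unfolding g1_def oneQ by simp
    moreover have "r 1 \<in> E" using r_E[of 1] s by simp
    ultimately have "h (r 1) = r 1" by simp
    then have "chi \<iota> (a 1) h = 0" using chi_a[OF _ h(1), of 1] by simp
    then show False using h(2) s by simp
  qed
  have "(\<Sum>g\<in>carrier Q - {\<one>\<^bsub>Q\<^esub>}. chi_set \<iota> A0 (lift g)) = (\<Sum>g\<in>{g1}. chi_set \<iota> A0 (lift g))"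
  proof (rule sum.mono_neutral_right)
    show "finite (carrier Q - {\<one>\<^bsub>Q\<^esub>})" using finite_Q by simp
    show "{g1} \<subseteq> carrier Q - {\<one>\<^bsub>Q\<^esub>}" using g1 \<open>g1 \<noteq> \<one>\<^bsub>Q\<^esub>\<close> by blast
    show "\<forall>g\<in>carrier Q - {\<one>\<^bsub>Q\<^esub>} - {g1}. chi_set \<iota> A0 (lift g) = 0"
    proof
      fix g assume g: "g \<in> carrier Q - {\<one>\<^bsub>Q\<^esub>} - {g1}"
      have "chi_set \<iota> A0 (lift g) \<noteq> 1"
      proof
        assume "chi_set \<iota> A0 (lift g) = 1"
        then have "\<forall>i\<in>{1..s}. chi \<iota> (a i) (lift g) = 1" by (simp only: chi_set_eq_1_iff)
        then have "g = g1" using one1 g g1 by (intro lift_eqI) auto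
        then show False using g by blast
      qed
      then show "chi_set \<iota> A0 (lift g) = 0" by (cases "chi_set \<iota> A0 (lift g)") auto
    qed
  qed
  also have "\<dots> = 1" using one1 chi_set_eq_1_iff[of "lift g1"] by simp
  finally show ?thesis .
qed

subsection \<open>Evaluation at inertia above \<open>a\<^sub>s\<^sub>+\<^sub>1\<close>\<close>

abbreviation "topmap \<equiv> phi \<iota> GG A0 (a (s + 1))"
abbreviation "sidemap i \<equiv> phi \<iota> GG (a ` ({1..s} - {i})) (a i)"
abbreviation "M \<equiv> compositum ((\<lambda>i. field_of_definition k (sidemap i)) ` {1..s})"
abbreviation "H \<equiv> carrier (abs_Gal M)"

lemma top_family: "phi_family \<iota> GG A0 (a (s + 1)) (SOME \<Phi>. phi_family \<iota> GG A0 (a (s + 1)) \<Phi>)"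
  using phi_top_exists unfolding phi_exists_def a_eta a_def[symmetric] by (metis someI_ex)

lemma side_family:
  "i \<in> {1..s} \<Longrightarrow> phi_family \<iota> GG (a ` ({1..s} - {i})) (a i) (SOME \<Phi>. phi_family \<iota> GG (a ` ({1..s} - {i})) (a i) \<Phi>)"
  using phi_i_exist[of i] unfolding phi_exists_def a_eta a_def[symmetric] by (metis someI_ex)

lemma top_expansion:
  "expansion \<iota> kv val \<epsilon> \<sigma> Frob A0 (a (s + 1)) (SOME \<Phi>. phi_family \<iota> GG A0 (a (s + 1)) \<Phi>)"
  by (rule expansionI[OF top_family]) auto

lemma side_expansion:
  assumes "i \<in> {1..s}"
  shows "expansion \<iota> kv val \<epsilon> \<sigma> Frob (a ` ({1..s} - {i})) (a i) (SOME \<Phi>. phi_family \<iota> GG (a ` ({1..s} - {i})) (a i) \<Phi>)"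
  by (rule expansionI[OF side_family[OF assms]]) (use assms in auto)

text \<open>The open subgroup that cuts out the field of definition of the side map at
  \<open>i\<close>.\<close>

definition NN where
  "NN i = expansion.N \<iota> (a ` ({1..s} - {i})) (SOME \<Phi>. phi_family \<iota> GG (a ` ({1..s} - {i})) (a i) \<Phi>)"

lemma side_fixed:
  assumes "i \<in> {1..s}" "t \<in> G"
  shows "(\<forall>x\<in>field_of_definition k (sidemap i). t x = x) \<longleftrightarrow> t \<in> NN i"
  using expansion.fixes_field_of_definition[OF side_expansion[OF assms(1)] assms(2)]
  unfolding NN_def phi_def .

lemma field_M: "i \<in> {1..s} \<Longrightarrow> field_of_definition k (sidemap i) \<subseteq> M"
  unfolding compositum_def by (rule order.trans[OF _ generate_field_superset]) blast

text \<open>\<open>compositum\<close> is generated by the given fields alone, so \<open>k\<close>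
  enters through one of the fields of definition.\<close>

lemma k_M: "k \<subseteq> M"
proof -
  have one: "1 \<in> {1..s}" using s by simp
  interpret expansion \<iota> kv val \<epsilon> \<sigma> Frob "a ` ({1..s} - {1})" "a 1" "SOME \<Phi>. phi_family \<iota> GG (a ` ({1..s} - {1})) (a 1) \<Phi>"
    by (rule side_expansion[OF one])
  have "k \<subseteq> field_of_definition k (sidemap 1)"
    using field_of_definition_eq N_D(1) abs_Gal_fix unfolding phi_def[symmetric] fixed_field_def by fastforce
  then show ?thesis using field_M[OF one] by blast
qed

lemma H_iff:
  assumes "t \<in> G"
  shows "t \<in> H \<longleftrightarrow> (\<forall>i\<in>{1..s}. t \<in> NN i)"
proof
  assume "t \<in> H"
  then have "\<forall>x\<in>M. t x = x" by (simp add: carrier_abs_Gal)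
  then show "\<forall>i\<in>{1..s}. t \<in> NN i" using side_fixed[OF _ assms] field_M by blast
next
  assume *: "\<forall>i\<in>{1..s}. t \<in> NN i"
  have "M \<subseteq> {x. t x = x}" unfolding compositum_def
    by (rule generate_field_least[OF subfield_fixed[OF assms]]) (use * side_fixed[OF _ assms] in blast)
  then show "t \<in> H" using assms unfolding carrier_abs_Gal by blast
qed

lemma H_G: "H \<subseteq> G"
  by (rule abs_Gal_anti_mono[OF k_M])

lemma H_chi:
  assumes "t \<in> H" "i \<in> {1..s}"
  shows "chi \<iota> (a i) t = 0"
proof -
  have "t \<in> NN i" using H_iff H_G assms by blast
  then show ?thesis using expansion.N_D(3)[OF side_expansion[OF assms(2)]] unfolding NN_def by blast
qed

text \<open>The map of \<open>S\<close> is chosen for \<open>S\<close> alone;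
  \<open>phi_unique\<close> identifies it with a member of the side family at \<open>i\<close>, and
  all of these vanish on \<open>H\<close>.\<close>

lemma H_side:
  assumes "t \<in> H" "i \<in> {1..s}" "S \<subset> {1..s} - {i}" "phi_exists \<iota> GG (a ` S) (a i)"
  shows "phi \<iota> GG (a ` S) (a i) t = 0"
proof -
  let ?P = "SOME \<Phi>. phi_family \<iota> GG (a ` ({1..s} - {i})) (a i) \<Phi>"
  have tN: "t \<in> NN i" "t \<in> G" using H_iff H_G assms(1,2) by blast+
  have sub: "a ` S \<subseteq> a ` ({1..s} - {i})" using assms(3) by blast
  have fam: "phi_family \<iota> GG (a ` S) (a i) (SOME \<Phi>. phi_family \<iota> GG (a ` S) (a i) \<Phi>)"
    using assms(4) unfolding phi_exists_def by (metis someI_ex)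
  have "finite (a ` S)" using assms(3) finite_subset by blast
  then have "phi \<iota> GG (a ` S) (a i) t = ?P (a ` S) t"
    unfolding phi_def using phi_unique[OF _ fam side_family[OF assms(2)] order.refl sub tN(2)] by blast
  also have "\<dots> = 0" using expansion.N_D(2)[OF side_expansion[OF assms(2)] _ sub] tN(1) unfolding NN_def by blast
  finally show ?thesis .
qed

text \<open>The first two clauses make the restriction to \<open>H\<close> a quadratic character;
  the last is the linear condition that separates the sum of conjugates from the span. All three are
  stable under sums.\<close>

definition good where
  "good t0 F \<longleftrightarrow> continuous_map (krull k) (discrete_topology UNIV) F \<and>
     (\<forall>t\<in>H. \<forall>u\<in>H. F (t \<circ> u) = F t + F u) \<and> F t0 = (0 :: bit)"

lemma good_add: "good t0 F \<Longrightarrow> good t0 F' \<Longrightarrow> good t0 (F + F')"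
  unfolding good_def plus_fun_def using continuous_krull_plus by (auto simp: add_ac)

lemma good_sum: "(\<And>p. p \<in> P \<Longrightarrow> good t0 (F p)) \<Longrightarrow> good t0 (\<Sum>p\<in>P. F p)"
proof (induction P rule: infinite_finite_induct)
  case (insert x P)
  then show ?case unfolding sum.insert[OF insert.hyps] by (intro good_add) auto
qed (auto simp: good_def zero_fun_def)

lemma good_quadratic: "good t0 F \<Longrightarrow> quadratic_character_on M (res H F)"
  unfolding good_def quadratic_character_on_def
  using continuous_krull_res[OF _ k_M] by (auto simp: res_def comp_in_abs_Gal)

lemma top_good:
  assumes "topmap t0 = 0"
  shows "good t0 topmap"
proof -
  interpret T: expansion \<iota> kv val \<epsilon> \<sigma> Frob A0 "a (s + 1)" "SOME \<Phi>. phi_family \<iota> GG A0 (a (s + 1)) \<Phi>"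
    by (rule top_expansion)
  have "topmap (t \<circ> u) = topmap t + topmap u" if "t \<in> H" "u \<in> H" for t u
    unfolding phi_def by (rule T.comp_fixed) (use that H_G H_chi in auto)
  then show ?thesis unfolding good_def using assms phi_continuous[OF top_family] unfolding phi_def by blast
qed

text \<open>Each term of the coboundary has on its left a factor vanishing on \<open>H\<close>: a
  product of characters over a non-empty set, or the map of a strict subset, which belongs to the
  side family. At \<open>t0\<close> the normalization applies.\<close>

lemma hat_good:
  assumes i: "i \<in> {1..s}" and S: "S\<^sub>1 \<subset> {1..s} - {i}" "S\<^sub>2 \<subset> {1..s} - {i}"
    and ex: "phi_hat_exists \<iota> GG (a ` S\<^sub>1) (a ` S\<^sub>2) (a i) (a (s + 1))" and t0: "x \<in> GG" "t0 \<in> x"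
  shows "good t0 (phi_hat \<iota> GG (a ` S\<^sub>1) (a ` S\<^sub>2) (a i) (a (s + 1)))"
proof -
  define \<Psi> where "\<Psi> = (SOME \<Psi>. phi_hat_family \<iota> GG (a ` S\<^sub>1) (a ` S\<^sub>2) (a i) (a (s + 1)) \<Psi>)"
  have "phi_hat_family \<iota> GG (a ` S\<^sub>1) (a ` S\<^sub>2) (a i) (a (s + 1)) \<Psi>"
    using ex unfolding phi_hat_exists_def \<Psi>_def by (metis someI_ex)
  then have P: "cochain2 k (\<Psi> (a ` S\<^sub>1) (a ` S\<^sub>2))" "vanishes_on GG (\<Psi> (a ` S\<^sub>1) (a ` S\<^sub>2))"
    "\<forall>g\<^sub>1\<in>G. \<forall>g\<^sub>2\<in>G. coboundary (\<Psi> (a ` S\<^sub>1) (a ` S\<^sub>2)) g\<^sub>1 g\<^sub>2 =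
            (\<Sum>(U\<^sub>1, U\<^sub>2) \<in> Pow (a ` S\<^sub>1) \<times> Pow (a ` S\<^sub>2) - {({}, {})}.
               chi_set \<iota> (U\<^sub>1 \<union> U\<^sub>2) g\<^sub>1 * \<Psi> (a ` S\<^sub>1 - U\<^sub>1) (a ` S\<^sub>2 - U\<^sub>2) g\<^sub>2) +
            phi \<iota> GG (a ` S\<^sub>1) (a i) g\<^sub>1 * (\<Sum>U\<in>Pow (a ` S\<^sub>2). chi_set \<iota> U g\<^sub>1 * phi \<iota> GG (a ` S\<^sub>2 - U) (a (s + 1)) g\<^sub>2)"
    unfolding phi_hat_family_def by blast+
  have "\<Psi> (a ` S\<^sub>1) (a ` S\<^sub>2) (t \<circ> u) = \<Psi> (a ` S\<^sub>1) (a ` S\<^sub>2) t + \<Psi> (a ` S\<^sub>1) (a ` S\<^sub>2) u"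
    if t: "t \<in> H" and u: "u \<in> H" for t u
  proof -
    have "phi \<iota> GG (a ` S\<^sub>1) (a i) t = 0"
      using H_side[OF t i S(1)] ex unfolding phi_hat_exists_def by blast
    moreover have "(\<Sum>(U\<^sub>1, U\<^sub>2) \<in> Pow (a ` S\<^sub>1) \<times> Pow (a ` S\<^sub>2) - {({}, {})}.
               chi_set \<iota> (U\<^sub>1 \<union> U\<^sub>2) t * \<Psi> (a ` S\<^sub>1 - U\<^sub>1) (a ` S\<^sub>2 - U\<^sub>2) u) = 0"
    proof (rule sum.neutral, rule ballI)
      fix p assume p: "p \<in> Pow (a ` S\<^sub>1) \<times> Pow (a ` S\<^sub>2) - {({}, {})}"
      obtain U\<^sub>1 U\<^sub>2 where pU: "p = (U\<^sub>1, U\<^sub>2)" by (cases p)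
      then have U: "U\<^sub>1 \<subseteq> a ` S\<^sub>1" "U\<^sub>2 \<subseteq> a ` S\<^sub>2" "\<not> (U\<^sub>1 = {} \<and> U\<^sub>2 = {})" using p by auto
      then have sub: "U\<^sub>1 \<union> U\<^sub>2 \<subseteq> A0" using S by blast
      obtain b where b: "b \<in> U\<^sub>1 \<union> U\<^sub>2" using U(3) by blast
      then obtain j where "j \<in> {1..s}" "b = a j" using sub by blast
      then have "chi \<iota> b t = 0" using H_chi[OF t] by blast
      moreover have "finite (U\<^sub>1 \<union> U\<^sub>2)" using sub finite_subset by blast
      ultimately have "chi_set \<iota> (U\<^sub>1 \<union> U\<^sub>2) t = 0" using b by (intro chi_set_eq_0) auto
      then show "(case p of (U\<^sub>1, U\<^sub>2) \<Rightarrow> chi_set \<iota> (U\<^sub>1 \<union> U\<^sub>2) t * \<Psi> (a ` S\<^sub>1 - U\<^sub>1) (a ` S\<^sub>2 - U\<^sub>2) u) = 0"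
        unfolding pU by simp
    qed
    ultimately have "coboundary (\<Psi> (a ` S\<^sub>1) (a ` S\<^sub>2)) t u = 0" using P(3) t u H_G by (simp add: subset_iff)
    then show ?thesis unfolding coboundary_def bit_diff_eq by simp
  qed
  moreover have "\<Psi> (a ` S\<^sub>1) (a ` S\<^sub>2) t0 = 0" using P(2) t0 unfolding vanishes_on_def by blast
  moreover have "continuous_map (krull k) (discrete_topology UNIV) (\<Psi> (a ` S\<^sub>1) (a ` S\<^sub>2))"
    using P(1) unfolding cochain2_def by blast
  ultimately show ?thesis unfolding good_def phi_hat_def \<Psi>_def by blast
qed

text \<open>For inertia \<open>t0\<close> at a prime dividing \<open>a\<^sub>s\<^sub>+\<^sub>1\<close>, the coefficient \<open>\<Phi> {} t0 = 1\<close> is the only member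
  of the topmap family that does not vanish.\<close>

lemma conj_top:
  assumes t0: "x \<in> GG" "t0 \<in> x" "t0 \<in> G" and chi0: "\<And>i. i \<in> {1..s} \<Longrightarrow> chi \<iota> (a i) t0 = 0" "chi \<iota> (a (s + 1)) t0 = 1"
    and g: "g \<in> carrier Q"
  shows "conj_char k E topmap g t0 = chi_set \<iota> A0 (lift g)"
proof -
  define \<Phi> where "\<Phi> = (SOME \<Phi>. phi_family \<iota> GG A0 (a (s + 1)) \<Phi>)"
  interpret T: expansion \<iota> kv val \<epsilon> \<sigma> Frob A0 "a (s + 1)" \<Phi> unfolding \<Phi>_def by (rule top_expansion)
  interpret Gr: group "abs_Gal k" by (rule group_abs_Gal)
  define l where "l = lift g"
  have l: "l \<in> G" unfolding l_def by (rule lift(1)[OF g])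
  define h where "h = inv\<^bsub>abs_Gal k\<^esub> l"
  have h: "h \<in> G" unfolding h_def by (rule Gr.inv_closed[OF l])
  have lh: "l \<circ> h = id" using Gr.r_inv[OF l] unfolding h_def by simp
  define t where "t = h \<circ> t0 \<circ> l"
  have t: "t \<in> G" unfolding t_def by (intro comp_in_abs_Gal h l t0)
  \<comment> \<open>Every element of the field with two elements is its own negative, so inverting
    \<open>l\<close> does not change the value.\<close>
  have chi_h: "chi \<iota> (a i) h = chi \<iota> (a i) l" if "i \<in> {1..s}" for i
    unfolding h_def using quadratic_hom.ch_inv[OF quadratic_hom_a l, of i] that by simp
  have chi_t: "chi \<iota> b t = 0" if bA: "b \<in> A0" for b
  proof -
    obtain i where i: "i \<in> {1..s}" "b = a i" using bA by blast
    have i': "a i \<in> insert (a (s + 1)) A0" using i by blast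
    have "chi \<iota> (a i) t = chi \<iota> (a i) h + chi \<iota> (a i) t0 + chi \<iota> (a i) l"
      unfolding t_def using T.chi_comp[OF i' comp_in_abs_Gal[OF h t0(3)] l] T.chi_comp[OF i' h t0(3)] by simp
    then show ?thesis using chi_h[OF i(1)] chi0(1)[OF i(1)] i(2) by simp
  qed
  have van: "\<Phi> S t0 = 0" if "S \<subseteq> A0" "S \<noteq> {}" for S
    using phi_vanishes[OF T.family that] t0(1,2) unfolding vanishes_on_def by blast
  have ne: "A0 \<noteq> {}" using s by simp
  \<comment> \<open>Both expansions of this one product are compared. On the left all characters
    vanish at \<open>t\<close>, so the map is additive; on the right the expansion ends at
    \<open>t0\<close>, where a single correction term survives.\<close>
  have "t \<circ> h = h \<circ> t0" unfolding t_def using lh by (simp add: comp_assoc)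
  then have "\<Phi> A0 t + \<Phi> A0 h = \<Phi> A0 (h \<circ> t0)" using T.comp_fixed[OF order.refl t h chi_t] by simp
  also have "\<dots> = \<Phi> A0 h + \<Phi> A0 t0 + (\<Sum>U\<in>Pow A0 - {{}}. chi_set \<iota> U h * \<Phi> (A0 - U) t0)"
    by (rule phi_comp[OF T.family order.refl h t0(3)])
  also have "(\<Sum>U\<in>Pow A0 - {{}}. chi_set \<iota> U h * \<Phi> (A0 - U) t0) = (\<Sum>U\<in>{A0}. chi_set \<iota> U h * \<Phi> (A0 - U) t0)"
  proof (rule sum.mono_neutral_right)
    show "{A0} \<subseteq> Pow A0 - {{}}" using ne by blast
    show "\<forall>U\<in>Pow A0 - {{}} - {A0}. chi_set \<iota> U h * \<Phi> (A0 - U) t0 = 0"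
    proof
      fix U assume "U \<in> Pow A0 - {{}} - {A0}"
      then have "A0 - U \<noteq> {}" by blast
      then have "\<Phi> (A0 - U) t0 = 0" by (intro van) auto
      then show "chi_set \<iota> U h * \<Phi> (A0 - U) t0 = 0" by simp
    qed
  qed simp
  also have "\<dots> = chi_set \<iota> A0 h" using phi_empty[OF T.family t0(3)] chi0(2) by simp
  also have "chi_set \<iota> A0 h = chi_set \<iota> A0 l" unfolding chi_set_A0 using chi_h by simp
  finally have "\<Phi> A0 t = chi_set \<iota> A0 l" using van[OF order.refl ne] by (simp add: add.commute[of "\<Phi> A0 t"])
  then show ?thesis unfolding conj_char_def Let_def lift_def[symmetric] phi_def \<Phi>_def[symmetric] l_def[symmetric]
    by (simp add: h_def[symmetric] t_def)
qed

theorem independence: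
  assumes hat_exist: "\<And>i S\<^sub>1 S\<^sub>2. i \<in> {1..s} \<Longrightarrow> S\<^sub>1 \<subset> {1..s} - {i} \<Longrightarrow> S\<^sub>2 \<subset> {1..s} - {i} \<Longrightarrow>
      S\<^sub>1 \<inter> S\<^sub>2 = {} \<Longrightarrow> phi_hat_exists \<iota> GG (a ` S\<^sub>1) (a ` S\<^sub>2) (a i) (a (s + 1))"
  defines "hat \<equiv> \<lambda>i. topmap + (\<Sum>(S\<^sub>1, S\<^sub>2) \<in> {(S\<^sub>1, S\<^sub>2). S\<^sub>1 \<union> S\<^sub>2 = {1..s} - {i} \<and> S\<^sub>1 \<inter> S\<^sub>2 = {} \<and>
            S\<^sub>1 \<subset> {1..s} - {i} \<and> S\<^sub>2 \<subset> {1..s} - {i}}.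
          phi_hat \<iota> GG (a ` S\<^sub>1) (a ` S\<^sub>2) (a i) (a (s + 1)))"
  shows "quadratic_character_on M (res H topmap) \<and>
    (\<forall>i\<in>{1..s}. quadratic_character_on M (res H (hat i))) \<and>
    res H (\<Sum>g \<in> carrier Q - {\<one>\<^bsub>Q\<^esub>}. conj_char k E topmap g)
      \<notin> bit_span ((\<lambda>i. res H (hat i)) ` {1..s})"
proof -
  have "s + 1 \<in> {1..s + 1}" by simp
  from dual_generator[OF this] obtain x t0 where t0: "x \<in> GG" "t0 \<in> x" "t0 \<in> G"
    "\<forall>l\<in>{1..s + 1}. chi \<iota> (a l) t0 = (if l = s + 1 then 1 else 0)" by blast
  have chi0: "chi \<iota> (a i) t0 = 0" if "i \<in> {1..s}" for i using bspec[OF t0(4), of i] that by simp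
  have chi1: "chi \<iota> (a (s + 1)) t0 = 1" using bspec[OF t0(4), of "s + 1"] by simp
  have t0H: "t0 \<in> H" unfolding H_iff[OF t0(3)]
  proof
    fix i assume i: "i \<in> {1..s}"
    define \<Phi> where "\<Phi> = (SOME \<Phi>. phi_family \<iota> GG (a ` ({1..s} - {i})) (a i) \<Phi>)"
    interpret T: expansion \<iota> kv val \<epsilon> \<sigma> Frob "a ` ({1..s} - {i})" "a i" \<Phi>
      unfolding \<Phi>_def by (rule side_expansion[OF i])
    have phi0: "\<Phi> S t0 = 0" if "S \<subseteq> a ` ({1..s} - {i})" for S
    \<comment> \<open>\<open>\<Phi> {}\<close> is prescribed rather than normalized; it is the
      character of \<open>a i\<close>, which vanishes at \<open>t0\<close> by coprimality.\<close>
    proof (cases "S = {}")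
      case True
      then show ?thesis using phi_empty[OF T.family t0(3)] chi0[OF i] by simp
    next
      case False
      then show ?thesis using phi_vanishes[OF T.family that] t0(1,2) unfolding vanishes_on_def by blast
    qed
    have "t0 \<in> T.N"
    proof (rule T.N_I[OF t0(3)])
      fix b assume "b \<in> a ` ({1..s} - {i})"
      then obtain l where "l \<in> {1..s}" "b = a l" by blast
      then show "chi \<iota> b t0 = 0" using chi0 by blast
    next
      fix S assume "S \<subseteq> a ` ({1..s} - {i})"
      then show "\<Phi> S t0 = 0" by (rule phi0)
    qed
    then show "t0 \<in> NN i" unfolding NN_def \<Phi>_def .
  qed
  have "A0 \<noteq> {}" using s by simp
  then have top0: "topmap t0 = 0" unfolding phi_def
    using phi_vanishes[OF top_family order.refl] t0(1,2) unfolding vanishes_on_def by blast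
  have hat: "good t0 (hat i)" if i: "i \<in> {1..s}" for i
    unfolding hat_def
  proof (rule good_add[OF top_good[OF top0]], rule good_sum)
    fix p assume p: "p \<in> {(S\<^sub>1, S\<^sub>2). S\<^sub>1 \<union> S\<^sub>2 = {1..s} - {i} \<and> S\<^sub>1 \<inter> S\<^sub>2 = {} \<and>
            S\<^sub>1 \<subset> {1..s} - {i} \<and> S\<^sub>2 \<subset> {1..s} - {i}}"
    obtain S\<^sub>1 S\<^sub>2 where pS: "p = (S\<^sub>1, S\<^sub>2)" by (cases p)
    then have S: "S\<^sub>1 \<subset> {1..s} - {i}" "S\<^sub>2 \<subset> {1..s} - {i}" "S\<^sub>1 \<inter> S\<^sub>2 = {}" using p by auto
    show "good t0 (case p of (S\<^sub>1, S\<^sub>2) \<Rightarrow> phi_hat \<iota> GG (a ` S\<^sub>1) (a ` S\<^sub>2) (a i) (a (s + 1)))"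
      unfolding pS prod.case by (rule hat_good[OF i S(1,2) hat_exist[OF i S] t0(1,2)])
  qed
  interpret bs: Modules.module "bit_scale :: bit \<Rightarrow> (('b \<Rightarrow> 'b) \<Rightarrow> bit) \<Rightarrow> _" by (rule module_bit_scale)
  have span0: "F t0 = 0" if "F \<in> bit_span ((\<lambda>i. res H (hat i)) ` {1..s})" for F
    using that
  proof (induction rule: bs.span_induct_alt)
    case base
    then show ?case by (simp add: zero_fun_def)
  next
    case (step c x y)
    then obtain i where "i \<in> {1..s}" "x = res H (hat i)" by blast
    then have "x t0 = 0" using hat unfolding good_def res_def by simp
    then show ?case using step by (simp add: plus_fun_def bit_scale_def)
  qed
  have "res H (\<Sum>g \<in> carrier Q - {\<one>\<^bsub>Q\<^esub>}. conj_char k E topmap g) t0 = 1"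
  proof -
    have "(\<Sum>g \<in> carrier Q - {\<one>\<^bsub>Q\<^esub>}. conj_char k E topmap g) t0 = (\<Sum>g \<in> carrier Q - {\<one>\<^bsub>Q\<^esub>}. conj_char k E topmap g t0)"
      by (rule sum_fun_app)
    also have "\<dots> = (\<Sum>g \<in> carrier Q - {\<one>\<^bsub>Q\<^esub>}. chi_set \<iota> A0 (lift g))"
      by (rule sum.cong[OF refl]) (use conj_top[OF t0(1-3) chi0 chi1] in blast)
    also have "\<dots> = 1" by (rule sum_chi_set_Q)
    finally show ?thesis using t0H by (simp add: res_def)
  qed
  then have "res H (\<Sum>g \<in> carrier Q - {\<one>\<^bsub>Q\<^esub>}. conj_char k E topmap g) \<notin> bit_span ((\<lambda>i. res H (hat i)) ` {1..s})"
    using span0 by force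
  then show ?thesis using good_quadratic[OF top_good[OF top0]] good_quadratic[OF hat] by blast
qed

end

theorem proposition5p14:
  fixes \<iota> :: "'a::{finite,field} poly fract \<Rightarrow> 'b::field"
    and kv :: "('a poly fract \<Rightarrow> int) \<Rightarrow> 'c::field set"
    and val :: "('a poly fract \<Rightarrow> int) \<Rightarrow> 'c \<Rightarrow> int"
    and \<epsilon> :: "('a poly fract \<Rightarrow> int) \<Rightarrow> 'b \<Rightarrow> 'c"
    and \<sigma> :: "('a poly fract \<Rightarrow> int) \<Rightarrow> ('b \<Rightarrow> 'b) set"
    and Frob :: "('b \<Rightarrow> 'b) set"
    and f :: "nat \<Rightarrow> 'a poly"
    and s :: nat
    and k M E :: "'b set"
    and \<GG> :: "('b \<Rightarrow> 'b) set set"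
    and a :: "nat \<Rightarrow> 'a poly fract set"
    and \<phi> :: "'b cochain"
    and \<phi>hat :: "nat \<Rightarrow> 'b cochain"
    and H :: "('b \<Rightarrow> 'b) set"
    and Q :: "('b \<Rightarrow> 'b) monoid"
  defines "k \<equiv> range \<iota>"
    and "\<GG> \<equiv> insert Frob (\<sigma> ` Collect finite_place)"
    and "a \<equiv> \<lambda>i. square_class (to_fract (f i))"
  assumes q: "CARD('a) mod 8 = 1"
    and s: "s \<ge> 3"
    and embedding: "\<iota> \<in> ring_hom type_ring type_ring"
    and closure: "is_separable_closure_of k"
    and local: "\<And>v. place v \<Longrightarrow> local_embedding \<iota> v (kv v) (val v) (\<epsilon> v)"
    and inertia: "\<And>v. place v \<Longrightarrow>
      topological_generator_of k (\<sigma> v) (inertia_image2 k (kv v) (val v) (\<epsilon> v))"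
    and frobenius: "frobenius_lift \<iota> (kv infinite_place) (\<epsilon> infinite_place) Frob"
    and polys: "\<And>i. i \<in> {1..s + 1} \<Longrightarrow> squarefree (f i) \<and> Polynomial.lead_coeff (f i) = 1 \<and> Polynomial.degree (f i) > 0"
    and pairwise_coprime:
      "\<And>i j. i \<in> {1..s + 1} \<Longrightarrow> j \<in> {1..s + 1} \<Longrightarrow> i \<noteq> j \<Longrightarrow> coprime (f i) (f j)"
    and hat_exist: "\<And>i S\<^sub>1 S\<^sub>2. i \<in> {1..s} \<Longrightarrow> S\<^sub>1 \<subset> {1..s} - {i} \<Longrightarrow> S\<^sub>2 \<subset> {1..s} - {i} \<Longrightarrow>
      S\<^sub>1 \<inter> S\<^sub>2 = {} \<Longrightarrow> phi_hat_exists \<iota> \<GG> (a ` S\<^sub>1) (a ` S\<^sub>2) (a i) (a (s + 1))"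
    and phi_i_exist: "\<And>i. i \<in> {1..s} \<Longrightarrow> phi_exists \<iota> \<GG> (a ` ({1..s} - {i})) (a i)"
    and phi_top_exists: "phi_exists \<iota> \<GG> (a ` {1..s}) (a (s + 1))"
  defines "\<phi> \<equiv> phi \<iota> \<GG> (a ` {1..s}) (a (s + 1))"
    and "\<phi>hat \<equiv> \<lambda>i. \<phi> +
      (\<Sum>(S\<^sub>1, S\<^sub>2) \<in> {(S\<^sub>1, S\<^sub>2). S\<^sub>1 \<union> S\<^sub>2 = {1..s} - {i} \<and> S\<^sub>1 \<inter> S\<^sub>2 = {} \<and>
            S\<^sub>1 \<subset> {1..s} - {i} \<and> S\<^sub>2 \<subset> {1..s} - {i}}.
          phi_hat \<iota> \<GG> (a ` S\<^sub>1) (a ` S\<^sub>2) (a i) (a (s + 1)))"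
    and "M \<equiv> compositum
      ((\<lambda>i. field_of_definition k (phi \<iota> \<GG> (a ` ({1..s} - {i})) (a i))) ` {1..s})"
    and "H \<equiv> carrier (abs_Gal M)"
    and "E \<equiv> sqrt_field \<iota> (a ` {1..s})"
    and "Q \<equiv> Gal E k"
  shows "quadratic_character_on M (res H \<phi>) \<and>
    (\<forall>i\<in>{1..s}. quadratic_character_on M (res H (\<phi>hat i))) \<and>
    res H (\<Sum>g \<in> carrier Q - {\<one>\<^bsub>Q\<^esub>}. conj_char k E \<phi> g)
      \<notin> bit_span ((\<lambda>i. res H (\<phi>hat i)) ` {1..s})"
proof -
  interpret D: expansion_data \<iota> kv val \<epsilon> \<sigma> Frob f s
  proof (intro expansion_data.intro rational_function_field.intro expansion_data_axioms.intro)
    show "odd CARD('a)" using q by presburger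
    show "\<iota> \<in> ring_hom type_ring type_ring" by (rule embedding)
    show "is_separable_closure_of (range \<iota>)" using closure unfolding k_def .
    show "local_embedding \<iota> v (kv v) (val v) (\<epsilon> v)" if "place v" for v using local[OF that] .
    show "topological_generator_of (range \<iota>) (\<sigma> v) (inertia_image2 (range \<iota>) (kv v) (val v) (\<epsilon> v))"
      if "place v" for v using inertia[OF that] unfolding k_def .
    show "frobenius_lift \<iota> (kv infinite_place) (\<epsilon> infinite_place) Frob" by (rule frobenius)
    show "s \<ge> 1" using s by simp
    show "squarefree (f i) \<and> Polynomial.degree (f i) > 0" if "i \<in> {1..s + 1}" for i
      using polys[OF that] by blast
    show "coprime (f i) (f j)" if "i \<in> {1..s + 1}" "j \<in> {1..s + 1}" "i \<noteq> j" for i j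
      using pairwise_coprime[OF that] .
    show "phi_exists \<iota> (insert Frob (\<sigma> ` Collect finite_place))
        ((\<lambda>i. square_class (to_fract (f i))) ` ({1..s} - {i})) (square_class (to_fract (f i)))"
      if "i \<in> {1..s}" for i using phi_i_exist[OF that] unfolding a_def \<GG>_def .
    show "phi_exists \<iota> (insert Frob (\<sigma> ` Collect finite_place))
        ((\<lambda>i. square_class (to_fract (f i))) ` {1..s}) (square_class (to_fract (f (s + 1))))"
      using phi_top_exists unfolding a_def \<GG>_def .
  qed
  have Da: "D.a = a" unfolding a_def by (rule D.a_eta[symmetric])
  show ?thesis
    using D.independence[unfolded Da, OF hat_exist[unfolded \<GG>_def]]
    unfolding \<phi>hat_def \<phi>_def H_def M_def Q_def E_def \<GG>_def k_def .
qed

end
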